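(* Let $(\xi_n)_{n\in\mathbb{Z}}$ be a stationary Markov chain with values in a measurable space $(S,\mathcal{A})$, with invariant distribution $\pi$, and let $f\in\mathbb{L}_0^2(\pi)$. Put $X_i=f(\xi_i)$ and $S_n=\sum_{i=1}^n X_i$. Assume that \[ \sum_{n\geq1}\frac{\|E(S_n\mid\xi_0)\|^2}{n^2}<\infty \quad\text{and}\quad \sum_{n\geq1}\frac{\|E(S_n\mid\xi_n)\|^2}{n^2}<\infty . \] Then: (a) there is $\sigma^2\in[0,\infty)$ such that $\lim_{n\to\infty} E(S_n^2)/n=\sigma^2$; (b) if the chain is totally ergodic, then the limit $\eta^2=\lim_{n\to\infty}\frac1n\|E(S_n\mid\xi_0,\xi_n)\|^2$ exists; and (c) if the chain is totally ergodic, then, with $\sigma^2$ from (a) and $\eta^2$ from (b), \[ \frac{S_n-E(S_n\mid\xi_0,\xi_n)}{\sqrt n}\Rightarrow N(0,\sigma^2-\eta^2), \] where $\Rightarrow$ denotes convergence in distribution.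
   Context: The chain is defined on a probability space $(\Omega,\mathcal{F},\mathbb{P})$ and admits a regular conditional distribution $Q(x,A)=\mathbb{P}(\xi_1\in A\mid\xi_0=x)$; $Q$ also denotes the Markov operator $(Qf)(x)=\int_S f(s)Q(x,ds)$. $\pi(A)=\mathbb{P}(\xi_0\in A)$ is the invariant distribution. $\mathbb{L}_0^2(\pi)$ is the set of measurable $f$ on $S$ with $\int f^2\,d\pi<\infty$ and $\int f\,d\pi=0$. $\|\cdot\|$ denotes the norm of $\mathbb{L}^2(\mathbb{P})$. The chain is called ergodic if the only functions with $Qf=f$ are constants, and totally ergodic if $Q^k$ is ergodic (only constants are $Q^k$-invariant) for every positive integer $k$. $N(0,s^2)$ denotes a centered normal random variable with variance $s^2$. *)

theory Defs
  imports "HOL-Probability.Probability"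
begin

definition gen_sigma :: "'a measure \<Rightarrow> 's measure \<Rightarrow> (int \<Rightarrow> 'a \<Rightarrow> 's) \<Rightarrow> int set \<Rightarrow> 'a measure" where
  "gen_sigma M S xi K = sigma (space M) (\<Union>k\<in>K. {xi k -` A \<inter> space M | A. A \<in> sets S})"

definition stationary_markov_chain ::
  "'a measure \<Rightarrow> 's measure \<Rightarrow> (int \<Rightarrow> 'a \<Rightarrow> 's) \<Rightarrow> ('s \<Rightarrow> 's measure) \<Rightarrow> bool" where
  "stationary_markov_chain M S xi Q \<longleftrightarrow>
     prob_space M \<and>
     (\<forall>n. xi n \<in> M \<rightarrow>\<^sub>M S) \<and>
     Q \<in> S \<rightarrow>\<^sub>M prob_algebra S \<and>
     (\<forall>J h. finite J \<longrightarrow>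
        distr M (Pi\<^sub>M J (\<lambda>_. S)) (\<lambda>\<omega>. \<lambda>j\<in>J. xi (j + h) \<omega>) =
        distr M (Pi\<^sub>M J (\<lambda>_. S)) (\<lambda>\<omega>. \<lambda>j\<in>J. xi j \<omega>)) \<and>
     (\<forall>n. \<forall>A\<in>sets S.
        AE \<omega> in M. real_cond_exp M (gen_sigma M S xi {..n}) (indicator (xi (n + 1) -` A \<inter> space M)) \<omega>
                     = measure (Q (xi n \<omega>)) A)"

definition inv_dist :: "'a measure \<Rightarrow> 's measure \<Rightarrow> (int \<Rightarrow> 'a \<Rightarrow> 's) \<Rightarrow> 's measure" where
  "inv_dist M S xi = distr M S (xi 0)"

definition markov_op :: "('s \<Rightarrow> 's measure) \<Rightarrow> ('s \<Rightarrow> real) \<Rightarrow> 's \<Rightarrow> real" where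
  "markov_op Q f x = (\<integral>s. f s \<partial>(Q x))"

definition L2_0 :: "'s measure \<Rightarrow> ('s \<Rightarrow> real) set" where
  "L2_0 \<pi> = {f. f \<in> borel_measurable \<pi> \<and> integrable \<pi> (\<lambda>x. (f x)\<^sup>2) \<and> (\<integral>x. f x \<partial>\<pi>) = 0}"

definition totally_ergodic :: "'s measure \<Rightarrow> ('s \<Rightarrow> 's measure) \<Rightarrow> bool" where
  "totally_ergodic \<pi> Q \<longleftrightarrow>
     (\<forall>k::nat. k \<ge> 1 \<longrightarrow>
        (\<forall>f. f \<in> borel_measurable \<pi> \<and> integrable \<pi> (\<lambda>x. (f x)\<^sup>2) \<and>
             (AE x in \<pi>. (markov_op Q ^^ k) f x = f x)
             \<longrightarrow> (\<exists>c. AE x in \<pi>. f x = c)))"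

definition L2_norm_P :: "'a measure \<Rightarrow> ('a \<Rightarrow> real) \<Rightarrow> real" where
  "L2_norm_P M g = sqrt (\<integral>\<omega>. (g \<omega>)\<^sup>2 \<partial>M)"

definition normal_law :: "real \<Rightarrow> real measure" where
  "normal_law s2 = (if s2 > 0 then density lborel (normal_density 0 (sqrt s2)) else return borel 0)"

end

theory Submission
  imports Defs
begin

text \<open>
  Write \<open>S(a,b)\<close> for the sum of \<open>f(\<xi>\<^sub>i)\<close> over \<open>a < i \<le> b\<close> and \<open>D(a,b) = S(a,b) - E(S(a,b) | \<xi>\<^sub>a, \<xi>\<^sub>b)\<close>.

  By the Markov property \<open>D(a,b)\<close> is orthogonal to everything that depends only on the chain up to
  time \<open>a\<close> and from time \<open>b\<close> on. Hence \<open>D(0,n) - (D(0,m) + D(m,2m) + \<dots> + D((u-1)m,um))\<close> has squared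
  norm \<open>a\<^sub>n - u a\<^sub>m\<close>, where \<open>a\<^sub>n = \<parallel>D(0,n)\<parallel>\<^sup>2\<close>. So \<open>a\<^sub>n / n\<close> converges to its supremum, and for large \<open>m\<close>
  the variable \<open>D(0,n)\<close> is close in norm to a sum of stationary martingale differences.
  Their conditional variances are a function of \<open>\<xi>\<^bsub>km\<^esub>\<close>; since \<open>Q\<^sup>m\<close> is ergodic, von Neumann's argument
  writes this function, up to a small error in \<open>L\<^sup>1\<close>, as a constant plus a coboundary \<open>\<phi> - Q\<^sup>m \<phi>\<close>, and
  the coboundary telescopes in the characteristic function of the sum. Levy's continuity theorem
  yields the central limit theorem.

  For the variance of \<open>S\<^sub>n\<close> the Markov property gives
  \<open>\<bar>E S\<^bsub>n+m\<^esub>\<^sup>2 - E S\<^sub>n\<^sup>2 - E S\<^sub>m\<^sup>2\<bar> \<le> 2 \<parallel>E(S\<^sub>n | \<xi>\<^sub>n)\<parallel> \<parallel>E(S\<^sub>m | \<xi>\<^sub>0)\<parallel>\<close>, and both norms are subadditive, so that the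
  two series control the error along dyadic times and then along all times.
\<close>

section \<open>Nearly additive and superadditive sequences\<close>

text \<open>The transition law is given only one step forward in time, whereas orthogonality of
  \<open>D(a,b)\<close> involves past and future at once. The backward Markov property is therefore
  obtained by induction on the length of the future, and self-adjointness of conditional expectation
  carries it from indicators to integrable variables. Conditional expectations are fixed only up to
  null sets, so stationarity cannot be applied to them literally; they are computed once on a finite
  path space and pulled back to each starting time. The conditional variance of
  \<open>D(0,m)\<close> is integrable but perhaps not square integrable, hence outside the reach of
  a Hilbert space argument; truncation closes this gap and is the reason for an error in
  \<open>L1\<close>. Because \<open>m\<close> has to grow, ergodicity is required of arbitrarily
  high powers of \<open>Q\<close>, which is what total ergodicity provides. The limit
  \<open>\<eta>2\<close> is not found by an argument of its own: it is the limit of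
  \<open>E S_n^2 / n\<close> minus the limit of \<open>a_n / n\<close>.\<close>

lemma subadditive_square_le_window_sum:
  fixes x :: "nat \<Rightarrow> real"
  assumes nonneg: "\<And>n. 0 \<le> x n" and sub: "\<And>m n. x (m + n) \<le> x m + x n" and "2 \<le> n"
  shows "(x n)\<^sup>2 / real n \<le> 32 * (\<Sum>i\<in>{n div 4<..n}. (x i)\<^sup>2 / (real i)\<^sup>2)"
proof -
  \<comment> \<open>Each split \<open>n = j + (n - j)\<close> bounds \<open>x n\<close>. For
    \<open>j\<close> in \<open>J\<close> both parts lie in the window \<open>{n div 4<..n}\<close>,
    and \<open>J\<close> has at least \<open>n / 8\<close> elements, so averaging over
    \<open>J\<close> trades one value for a window sum. The final 32 is this 8 times the 4 that
    comes from squaring a sum of two terms and covering the window twice.\<close>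
  define J where "J = {n div 4<..n div 2}"
  have cJ: "real n \<le> 8 * real (card J)"
  proof -
    have "2 * (n div 4) \<le> n div 2" "n < 4 * (n div 4) + 4" "1 \<le> n div 2" using \<open>2 \<le> n\<close> by linarith+
    then have "n \<le> 8 * (n div 2 - n div 4)" by (cases "n div 4 = 0") linarith+
    then have "real n \<le> real (8 * (n div 2 - n div 4))" by (simp only: of_nat_le_iff)
    then show ?thesis by (simp add: J_def)
  qed
  have step: "(x n)\<^sup>2 \<le> 2 * (x j)\<^sup>2 + 2 * (x (n - j))\<^sup>2" if "j \<in> J" for j
  proof -
    have "x n \<le> x j + x (n - j)"
    proof -
      have "j + (n - j) = n" using that by (auto simp: J_def)
      then show ?thesis using sub[of j "n - j"] by simp
    qed
    then have "(x n)\<^sup>2 \<le> (x j + x (n - j))\<^sup>2" using nonneg by (intro power_mono)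
    also have "\<dots> \<le> 2 * (x j)\<^sup>2 + 2 * (x (n - j))\<^sup>2"
      using zero_le_power2[of "x j - x (n - j)"] by (simp add: power2_eq_square algebra_simps)
    finally show ?thesis .
  qed
  let ?W = "{n div 4<..n}"
  have s1: "(\<Sum>j\<in>J. (x j)\<^sup>2) \<le> (\<Sum>i\<in>?W. (x i)\<^sup>2)"
    by (rule sum_mono2) (auto simp: J_def)
  have s2: "(\<Sum>j\<in>J. (x (n - j))\<^sup>2) \<le> (\<Sum>i\<in>?W. (x i)\<^sup>2)"
  proof -
    have "(\<Sum>j\<in>J. (x (n - j))\<^sup>2) = (\<Sum>i\<in>(\<lambda>j. n - j) ` J. (x i)\<^sup>2)"
      by (subst sum.reindex) (auto simp: J_def inj_on_def)
    also have "\<dots> \<le> (\<Sum>i\<in>?W. (x i)\<^sup>2)"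
      using \<open>2 \<le> n\<close> by (intro sum_mono2) (auto simp: J_def)
    finally show ?thesis .
  qed
  have "real (card J) * (x n)\<^sup>2 = (\<Sum>j\<in>J. (x n)\<^sup>2)" by simp
  also have "\<dots> \<le> (\<Sum>j\<in>J. 2 * (x j)\<^sup>2 + 2 * (x (n - j))\<^sup>2)" by (intro sum_mono step)
  also have "\<dots> \<le> 4 * (\<Sum>i\<in>?W. (x i)\<^sup>2)"
    using s1 s2 by (simp add: sum.distrib flip: sum_distrib_left)
  finally have 1: "real (card J) * (x n)\<^sup>2 \<le> 4 * (\<Sum>i\<in>?W. (x i)\<^sup>2)" .
  have "real n * (x n)\<^sup>2 \<le> 8 * (real (card J) * (x n)\<^sup>2)"
    using mult_right_mono[OF cJ, of "(x n)\<^sup>2"] by simp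
  then have 2: "real n * (x n)\<^sup>2 \<le> 32 * (\<Sum>i\<in>?W. (x i)\<^sup>2)" using 1 by linarith
  have "(\<Sum>i\<in>?W. (x i)\<^sup>2 / (real n)\<^sup>2) \<le> (\<Sum>i\<in>?W. (x i)\<^sup>2 / (real i)\<^sup>2)"
    by (intro sum_mono divide_left_mono power_mono mult_pos_pos) auto
  then have 3: "(\<Sum>i\<in>?W. (x i)\<^sup>2) / (real n)\<^sup>2 \<le> (\<Sum>i\<in>?W. (x i)\<^sup>2 / (real i)\<^sup>2)"
    by (simp add: sum_divide_distrib)
  have "(x n)\<^sup>2 / real n = real n * (x n)\<^sup>2 / (real n)\<^sup>2"
    using \<open>2 \<le> n\<close> by (simp add: power2_eq_square)
  also have "\<dots> \<le> 32 * (\<Sum>i\<in>?W. (x i)\<^sup>2) / (real n)\<^sup>2" using 2 by (intro divide_right_mono) auto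
  finally show ?thesis using 3 by simp
qed

text \<open>The window sums of \<open>t\<close> are differences \<open>T n - T (n div 4)\<close> of
  convergent partial sums: they tend to 0, and along powers of two they telescope. This is how
  subadditivity, without any monotonicity of \<open>x\<close>, recovers information on single terms
  from the series.\<close>

lemma subadditive_square_summable_imp:
  fixes x :: "nat \<Rightarrow> real"
  assumes nonneg: "\<And>n. 0 \<le> x n" and sub: "\<And>m n. x (m + n) \<le> x m + x n"
    and summ: "summable (\<lambda>n. (x (Suc n))\<^sup>2 / (real (Suc n))\<^sup>2)"
  shows "(\<lambda>n. (x n)\<^sup>2 / real n) \<longlonglongrightarrow> 0"
    and "summable (\<lambda>k. (x (2 ^ k))\<^sup>2 / 2 ^ k)"
proof -
  define t where "t i = (x i)\<^sup>2 / (real i)\<^sup>2" for i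
  have t: "summable t" using summ unfolding t_def by (subst summable_Suc_iff[symmetric])
  have t0: "0 \<le> t i" for i by (simp add: t_def)
  define T where "T n = (\<Sum>i\<le>n. t i)" for n
  have Tlim: "T \<longlonglongrightarrow> suminf t" unfolding T_def using summable_LIMSEQ'[OF t] .
  have win: "(\<Sum>i\<in>{n div 4<..n}. t i) = T n - T (n div 4)" for n
  proof -
    have "{..n} = {..n div 4} \<union> {n div 4<..n}" by auto
    then show ?thesis unfolding T_def by (simp add: sum.union_disjoint[of "{..n div 4}"] ivl_disj_int)
  qed
  have bnd: "(x n)\<^sup>2 / real n \<le> 32 * (T n - T (n div 4))" if "2 \<le> n" for n
    using subadditive_square_le_window_sum[OF nonneg sub that] unfolding win[symmetric] t_def by simp
  have "filterlim (\<lambda>n::nat. n div 4) at_top at_top"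
    unfolding filterlim_at_top eventually_sequentially
    by (metis div_le_mono nonzero_mult_div_cancel_left zero_neq_numeral)
  then have "(\<lambda>n. T (n div 4)) \<longlonglongrightarrow> suminf t"
    using Tlim filterlim_compose by blast
  then have "(\<lambda>n. 32 * (T n - T (n div 4))) \<longlonglongrightarrow> 32 * (suminf t - suminf t)"
    by (intro tendsto_intros Tlim)
  then have l: "(\<lambda>n. 32 * (T n - T (n div 4))) \<longlonglongrightarrow> 0" by simp
  show "(\<lambda>n. (x n)\<^sup>2 / real n) \<longlonglongrightarrow> 0"
  proof (rule real_tendsto_sandwich[OF _ _ tendsto_const l])
    show "\<forall>\<^sub>F n in sequentially. (x n)\<^sup>2 / real n \<le> 32 * (T n - T (n div 4))"
      using bnd eventually_sequentially by blast
  qed auto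
  have Tle: "T n \<le> suminf t" for n unfolding T_def
    using sum_le_suminf[OF t, of "{..n}"] t0 by simp
  have T0: "0 \<le> T n" for n unfolding T_def by (simp add: sum_nonneg t0)
  \<comment> \<open>The shift by 2 turns the window at \<open>2 ^ (k + 2)\<close> into the indices
    between \<open>2 ^ k\<close> and \<open>2 ^ (k + 2)\<close>. Each index lies in at most two such
    windows, which doubles 32 to 64.\<close>
  have tele: "(\<Sum>k<K. (x (2 ^ (k + 2)))\<^sup>2 / 2 ^ (k + 2)) \<le> 64 * suminf t" for K
  proof -
    have "(\<Sum>k<K. (x (2 ^ (k + 2)))\<^sup>2 / 2 ^ (k + 2)) \<le> (\<Sum>k<K. 32 * (T (2 ^ (k + 2)) - T (2 ^ k)))"
    proof (rule sum_mono)
      fix k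
      have "(2::nat) ^ (k + 2) div 4 = 2 ^ k" by simp
      moreover have "(2::nat) \<le> 2 ^ (k + 2)" using one_le_power[of "2::nat" k] by simp
      ultimately show "(x (2 ^ (k + 2)))\<^sup>2 / 2 ^ (k + 2) \<le> 32 * (T (2 ^ (k + 2)) - T (2 ^ k))"
        using bnd[of "2 ^ (k + 2)"] by (simp only: of_nat_power of_nat_numeral)
    qed
    also have "\<dots> = 32 * (T (2 ^ (K + 1)) + T (2 ^ K) - T 2 - T 1)"
      by (induction K) (auto simp: algebra_simps numeral_2_eq_2)
    also have "\<dots> \<le> 32 * (suminf t + suminf t)"
      using Tle[of "2 ^ (K + 1)"] Tle[of "2 ^ K"] T0[of 2] T0[of 1]
      by (intro mult_left_mono) auto
    finally show ?thesis by simp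
  qed
  have "summable (\<lambda>k. (x (2 ^ (k + 2)))\<^sup>2 / 2 ^ (k + 2))"
    by (rule bounded_imp_summable[where B = "64 * suminf t"])
       (use tele in \<open>auto simp: lessThan_Suc_atMost[symmetric] simp del: sum.lessThan_Suc\<close>)
  then show "summable (\<lambda>k. (x (2 ^ k))\<^sup>2 / 2 ^ k)"
    by (subst summable_iff_shift[of _ 2, symmetric])
qed

text \<open>Doubling the time changes \<open>b (2 ^ k) / 2 ^ k\<close> by the defect of additivity
  at \<open>(2 ^ k, 2 ^ k)\<close> divided by \<open>2 * 2 ^ k\<close>, and these increments are
  summable.\<close>

lemma dyadic_limit_of_nearly_additive:
  fixes b p q :: "nat \<Rightarrow> real"
  assumes near: "\<And>m n. \<bar>b (m + n) - b m - b n\<bar> \<le> q m + p n"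
    and sp: "summable (\<lambda>k. p (2 ^ k) / 2 ^ k)" and sq: "summable (\<lambda>k. q (2 ^ k) / 2 ^ k)"
  shows "convergent (\<lambda>k. b (2 ^ k) / 2 ^ k)"
proof -
  define c where "c k = b (2 ^ k) / 2 ^ k" for k
  have "norm (c (Suc k) - c k) \<le> p (2 ^ k) / 2 ^ k + q (2 ^ k) / 2 ^ k" for k
  proof -
    have n: "\<bar>b (2 ^ Suc k) - 2 * b (2 ^ k)\<bar> \<le> q (2 ^ k) + p (2 ^ k)"
    proof -
      have "(2::nat) ^ Suc k = 2 ^ k + 2 ^ k" by simp
      then show ?thesis using near[of "2 ^ k" "2 ^ k"] by (simp only: mult_2 diff_diff_eq)
    qed
    have "c (Suc k) - c k = (b (2 ^ Suc k) - 2 * b (2 ^ k)) / (2 * 2 ^ k)"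
      by (simp add: c_def field_simps)
    then have "\<bar>c (Suc k) - c k\<bar> = \<bar>b (2 ^ Suc k) - 2 * b (2 ^ k)\<bar> / (2 * 2 ^ k)"
      by (simp add: abs_divide abs_mult)
    also have "\<dots> \<le> (q (2 ^ k) + p (2 ^ k)) / (2 * 2 ^ k)" using n by (intro divide_right_mono) auto
    also have "\<dots> \<le> (q (2 ^ k) + p (2 ^ k)) / 2 ^ k"
      using n by (intro divide_left_mono) auto
    finally show ?thesis by (simp add: add_divide_distrib add.commute)
  qed
  then have "summable (\<lambda>k. c (Suc k) - c k)"
    by (intro summable_comparison_test'[OF summable_add[OF sp sq], of 0]) auto
  then have "convergent (\<lambda>n. \<Sum>k<n. c (Suc k) - c k)" by (simp add: summable_iff_convergent)
  then have "convergent (\<lambda>n. c n - c 0)" by (simp add: sum_lessThan_telescope)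
  then have "convergent c" using convergent_diff_const_right_iff by blast
  then show ?thesis by (simp add: c_def[abs_def])
qed

text \<open>After subtraction of the linear part, a strong induction splits off the largest power of
  two from \<open>n\<close>. The powers split off add up to \<open>n\<close>, so errors proportional
  to them stay linear in \<open>n\<close> with a small slope.\<close>

lemma nearly_additive_limit:
  fixes b p q :: "nat \<Rightarrow> real"
  assumes near: "\<And>m n. \<bar>b (m + n) - b m - b n\<bar> \<le> q m + p n"
    and p: "(\<lambda>n. p n / real n) \<longlonglongrightarrow> 0" and q: "(\<lambda>n. q n / real n) \<longlonglongrightarrow> 0"
    and dy: "(\<lambda>k. b (2 ^ k) / 2 ^ k) \<longlonglongrightarrow> L"
  shows "(\<lambda>n. b n / real n) \<longlonglongrightarrow> L"
proof -
  define d where "d n = b n - L * real n" for n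
  have dnear: "\<bar>d (m + n)\<bar> \<le> \<bar>d m\<bar> + \<bar>d n\<bar> + q m + p n" for m n
  proof -
    have "d (m + n) = (b (m + n) - b m - b n) + d m + d n" by (simp add: d_def algebra_simps)
    then show ?thesis using near[of m n] by linarith
  qed
  have linear: "\<exists>C. \<forall>n. \<bar>d n\<bar> \<le> 4 * e * real n + C" if "e > 0" for e
  proof -
    have ev: "\<forall>\<^sub>F n in sequentially. u n \<le> e * real n" if "(\<lambda>n. u n / real n) \<longlonglongrightarrow> 0" for u
    proof -
      have "\<forall>\<^sub>F n in sequentially. u n / real n < e" using order_tendstoD(2)[OF that \<open>e > 0\<close>] .
      moreover have "\<forall>\<^sub>F n::nat in sequentially. n > 0" by (rule eventually_gt_at_top)
      ultimately show ?thesis by eventually_elim (auto simp: field_simps)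
    qed
    obtain N1 where N1: "\<And>n. n \<ge> N1 \<Longrightarrow> p n \<le> e * real n"
      using ev[OF p] unfolding eventually_sequentially by blast
    obtain N2 where N2: "\<And>n. n \<ge> N2 \<Longrightarrow> q n \<le> e * real n"
      using ev[OF q] unfolding eventually_sequentially by blast
    \<comment> \<open>\<open>C1\<close> absorbs the finitely many small indices, because the
      remainder \<open>n'\<close> below may be arbitrarily small compared with
      \<open>2 ^ k\<close>.\<close>
    define C1 where "C1 = (\<Sum>n<N1. \<bar>p n\<bar>)"
    have pC: "p n \<le> e * real n + C1" for n
    proof (cases "n \<ge> N1")
      case True then show ?thesis using N1[of n] by (simp add: C1_def sum_nonneg add_increasing2)
    next
      case False
      then have "\<bar>p n\<bar> \<le> C1" unfolding C1_def by (intro member_le_sum) auto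
      then show ?thesis using \<open>e > 0\<close> by (smt (verit) mult_nonneg_nonneg of_nat_0_le_iff)
    qed
    have "(\<lambda>k. b (2 ^ k) / 2 ^ k - L) \<longlonglongrightarrow> 0" using dy by (rule LIM_zero)
    then have "\<forall>\<^sub>F k in sequentially. \<bar>b (2 ^ k) / 2 ^ k - L\<bar> < e"
      using tendstoD[of _ 0] \<open>e > 0\<close> by (fastforce simp: dist_real_def)
    then obtain K1 where K1: "\<And>k. k \<ge> K1 \<Longrightarrow> \<bar>b (2 ^ k) / 2 ^ k - L\<bar> < e"
      unfolding eventually_sequentially by blast
    have d2: "\<bar>d (2 ^ k)\<bar> \<le> e * 2 ^ k" if "k \<ge> K1" for k
    proof -
      have "d (2 ^ k) = (b (2 ^ k) / 2 ^ k - L) * 2 ^ k" by (simp add: d_def field_simps)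
      then have "\<bar>d (2 ^ k)\<bar> = \<bar>b (2 ^ k) / 2 ^ k - L\<bar> * 2 ^ k" by (simp add: abs_mult)
      then show ?thesis using K1[OF that] by simp
    qed
    obtain K2 :: nat where "(1/2) ^ K2 < e / (1 + \<bar>C1\<bar>)"
      using real_arch_pow_inv[of "e / (1 + \<bar>C1\<bar>)" "1/2"] \<open>e > 0\<close> by auto
    then have "1 + \<bar>C1\<bar> < e * 2 ^ K2" by (simp add: field_simps power_divide)
    then have K2: "C1 \<le> e * 2 ^ K2" by linarith
    \<comment> \<open>Beyond \<open>K\<close> the dyadic deviations are small, \<open>C1\<close> is
      at most \<open>e * 2 ^ k\<close>, and \<open>2 ^ k\<close> exceeds \<open>N2\<close> because
      \<open>k \<le> 2 ^ k\<close>.\<close>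
    define K where "K = max K1 (max K2 N2)"
    have K: "C1 \<le> e * 2 ^ k" if "k \<ge> K" for k
    proof -
      have "(2::real) ^ K2 \<le> 2 ^ k" using that by (intro power_increasing) (auto simp: K_def)
      then show ?thesis using K2 \<open>e > 0\<close> by (meson mult_left_mono less_imp_le order_trans)
    qed
    define C where "C = (\<Sum>n<2 ^ K. \<bar>d n\<bar>)"
    have C0: "C \<ge> 0" unfolding C_def by (simp add: sum_nonneg)
    have "\<bar>d n\<bar> \<le> 4 * e * real n + C" for n
    proof (induction n rule: less_induct)
      case (less n)
      show ?case
      proof (cases "n < 2 ^ K")
        case True
        then have "\<bar>d n\<bar> \<le> C" unfolding C_def by (intro member_le_sum) auto
        then show ?thesis using \<open>e > 0\<close> by (smt (verit) mult_nonneg_nonneg of_nat_0_le_iff)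
      next
        case False
        then have "1 \<le> n" using one_le_power[of "2::nat" K] by linarith
        then obtain k where k: "2 ^ k \<le> n" "n < 2 ^ (k + 1)"
          using ex_power_ivl1[of 2 n] by auto
        have "K \<le> k"
        proof (rule ccontr)
          assume "\<not> K \<le> k"
          then have "(2::nat) ^ (k + 1) \<le> 2 ^ K" by (intro power_increasing) auto
          then show False using False k by linarith
        qed
        define n' where "n' = n - 2 ^ k"
        have n: "n = 2 ^ k + n'" "n' < 2 ^ k" using k by (auto simp: n'_def)
        have rn: "real n = 2 ^ k + real n'" "real n' < 2 ^ k" using n by (auto simp flip: of_nat_power of_nat_less_iff)
        have "k \<le> 2 ^ k" using less_exp[of k] by simp
        then have "N2 \<le> 2 ^ k" using \<open>K \<le> k\<close> unfolding K_def by linarith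
        then have "q (2 ^ k) \<le> e * 2 ^ k" using N2[of "2 ^ k"] by simp
        moreover have "p n' \<le> e * 2 ^ k + e * 2 ^ k"
          using pC[of n'] K[OF \<open>K \<le> k\<close>] mult_strict_left_mono[OF rn(2) \<open>e > 0\<close>] by linarith
        moreover have "\<bar>d (2 ^ k)\<bar> \<le> e * 2 ^ k" using d2 \<open>K \<le> k\<close> by (simp add: K_def)
        moreover have "\<bar>d n'\<bar> \<le> 4 * e * real n' + C" using less[of n'] n by simp
        \<comment> \<open>Four errors of size \<open>e * 2 ^ k\<close> meet here: one from
          \<open>d (2 ^ k)\<close>, one from \<open>q (2 ^ k)\<close>, and two from
          \<open>p n'\<close>, the second of which pays for \<open>C1\<close>.\<close>
        ultimately have "\<bar>d n\<bar> \<le> 4 * (e * 2 ^ k) + 4 * e * real n' + C"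
          using dnear[of "2 ^ k" n', folded n(1)] by linarith
        then show ?thesis by (simp add: rn algebra_simps)
      qed
    qed
    then show ?thesis by blast
  qed
  have "(\<lambda>n. b n / real n - L) \<longlonglongrightarrow> 0"
  proof (rule LIMSEQ_I)
    fix r :: real assume "r > 0"
    then obtain C where C: "\<And>n. \<bar>d n\<bar> \<le> 4 * (r / 8) * real n + C" using linear[of "r / 8"] by auto
    obtain N :: nat where N: "real N > 2 * \<bar>C\<bar> / r" using reals_Archimedean2 by blast
    have "norm (b n / real n - L - 0) < r" if "n \<ge> Suc N" for n
    proof -
      have n0: "real n > 0" using that by simp
      have "2 * \<bar>C\<bar> / r < real n" using N that by linarith
      then have "\<bar>C\<bar> < (r / 2) * real n" using \<open>r > 0\<close> by (simp add: field_simps)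
      then have "\<bar>d n\<bar> < r * real n" using C[of n] by (simp add: field_simps)
      moreover have "b n / real n - L = d n / real n" using n0 by (simp add: d_def field_simps)
      ultimately show ?thesis using n0 by (simp add: abs_divide divide_less_eq)
    qed
    then show "\<exists>no. \<forall>n\<ge>no. norm (b n / real n - L - 0) < r" by blast
  qed
  then show ?thesis by (rule LIM_zero_cancel)
qed

lemma real_div_over_tendsto:
  assumes "0 < m"
  shows "(\<lambda>n. real (n div m) / real n) \<longlonglongrightarrow> 1 / real m"
proof (rule real_tendsto_sandwich[where f = "\<lambda>n. 1 / real m - 1 / real n" and h = "\<lambda>_. 1 / real m"])
  have "(\<lambda>n. 1 / real m - 1 / real n) \<longlonglongrightarrow> 1 / real m - 0"
    by (intro tendsto_intros lim_1_over_n)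
  then show "(\<lambda>n. 1 / real m - 1 / real n) \<longlonglongrightarrow> 1 / real m" by simp
  show "\<forall>\<^sub>F n in sequentially. 1 / real m - 1 / real n \<le> real (n div m) / real n"
    using eventually_gt_at_top[of 0]
  proof eventually_elim
    case (elim n)
    have "n < m * (n div m) + m" using assms by (metis add_less_cancel_left div_mod_decomp mod_less_divisor mult.commute)
    then have "real n < real m * real (n div m) + real m" by (metis of_nat_add of_nat_less_iff of_nat_mult)
    then have "real n / real m \<le> real (n div m) + 1" using assms by (simp add: field_simps)
    then have "(real n / real m) / real n \<le> (real (n div m) + 1) / real n"
      by (intro divide_right_mono) auto
    then show ?case using elim by (simp add: add_divide_distrib)
  qed
  show "\<forall>\<^sub>F n in sequentially. real (n div m) / real n \<le> 1 / real m"
    using eventually_gt_at_top[of 0]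
  proof eventually_elim
    case (elim n)
    have "real m * real (n div m) \<le> real n" by (metis div_times_less_eq_dividend of_nat_le_iff of_nat_mult mult.commute)
    then show ?case using assms elim by (simp add: field_simps)
  qed
qed simp

text \<open>Fekete's argument with the remainder block dropped: for fixed \<open>m\<close>, the
  \<open>n div m\<close> full blocks already give the quotient \<open>a m / m\<close> in the limit.
  This form of superadditivity is what the orthogonal decomposition delivers, and it identifies the
  limit with the supremum.\<close>

lemma superadditive_limit:
  fixes a :: "nat \<Rightarrow> real"
  assumes sup: "\<And>m n. real (n div m) * a m \<le> a n" and bdd: "\<And>n. a n / real n \<le> C"
  obtains L where "(\<lambda>n. a n / real n) \<longlonglongrightarrow> L" "\<And>n. 1 \<le> n \<Longrightarrow> a n / real n \<le> L"
proof -
  define L where "L = (SUP n\<in>{1..}. a n / real n)"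
  have bA: "bdd_above ((\<lambda>n. a n / real n) ` {1..})" using bdd by (auto simp: bdd_above_def)
  have le: "a n / real n \<le> L" if "1 \<le> n" for n
    unfolding L_def using that by (intro cSUP_upper bA) auto
  have "(\<lambda>n. a n / real n) \<longlonglongrightarrow> L"
  proof (rule order_tendstoI)
    fix y assume "y < L"
    then obtain m where m: "1 \<le> m" "y < a m / real m"
      unfolding L_def using less_cSUP_iff[OF _ bA] by auto
    have "(\<lambda>n. real (n div m) / real n * a m) \<longlonglongrightarrow> 1 / real m * a m"
      using m by (intro tendsto_intros real_div_over_tendsto) auto
    then have "\<forall>\<^sub>F n in sequentially. y < real (n div m) / real n * a m"
      using m(2) by (intro order_tendstoD(1)) auto
    then show "\<forall>\<^sub>F n in sequentially. y < a n / real n"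
    proof eventually_elim
      case (elim n)
      have "real (n div m) / real n * a m \<le> a n / real n"
        using divide_right_mono[OF sup[of n m], of "real n"] by simp
      then show ?case using elim by simp
    qed
  next
    fix y assume y: "L < y"
    show "\<forall>\<^sub>F n in sequentially. a n / real n < y"
      using eventually_ge_at_top[of 1] by eventually_elim (use le y in fastforce)
  qed
  then show thesis using that le by blast
qed

section \<open>Square integrable functions and the mean ergodic theorem\<close>

definition sq_integrable :: "'a measure \<Rightarrow> ('a \<Rightarrow> real) \<Rightarrow> bool" where
  "sq_integrable M X \<longleftrightarrow> X \<in> borel_measurable M \<and> integrable M (\<lambda>x. (X x)\<^sup>2)"

abbreviation sq_norm :: "'a measure \<Rightarrow> ('a \<Rightarrow> real) \<Rightarrow> real" where
  "sq_norm M X \<equiv> (\<integral>x. (X x)\<^sup>2 \<partial>M)"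

lemma sq_integrable_measurable: "sq_integrable M X \<Longrightarrow> X \<in> borel_measurable M"
  and sq_integrable_square: "sq_integrable M X \<Longrightarrow> integrable M (\<lambda>x. (X x)\<^sup>2)"
  by (auto simp: sq_integrable_def)

lemma sq_integrable_mult:
  assumes X: "sq_integrable M X" and Y: "sq_integrable M Y"
  shows "integrable M (\<lambda>x. X x * Y x)"
proof (rule Bochner_Integration.integrable_bound[of M "\<lambda>x. (X x)\<^sup>2 + (Y x)\<^sup>2"])
  show "AE x in M. norm (X x * Y x) \<le> norm ((X x)\<^sup>2 + (Y x)\<^sup>2)"
  proof (rule AE_I2)
    fix x
    have "2 * (\<bar>X x\<bar> * \<bar>Y x\<bar>) \<le> (X x)\<^sup>2 + (Y x)\<^sup>2"
      using zero_le_power2[of "\<bar>X x\<bar> - \<bar>Y x\<bar>"] by (simp add: power2_eq_square algebra_simps)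
    moreover have "0 \<le> \<bar>X x\<bar> * \<bar>Y x\<bar>" by simp
    ultimately have "\<bar>X x\<bar> * \<bar>Y x\<bar> \<le> (X x)\<^sup>2 + (Y x)\<^sup>2" by linarith
    then show "norm (X x * Y x) \<le> norm ((X x)\<^sup>2 + (Y x)\<^sup>2)" by (simp add: abs_mult)
  qed
qed (use assms in \<open>auto simp: sq_integrable_def\<close>)

lemma sq_integrable_add:
  assumes X: "sq_integrable M X" and Y: "sq_integrable M Y"
  shows "sq_integrable M (\<lambda>x. X x + Y x)"
proof -
  have "integrable M (\<lambda>x. (X x)\<^sup>2 + (Y x)\<^sup>2 + 2 * (X x * Y x))"
    using assms sq_integrable_mult[OF X Y] by (auto simp: sq_integrable_def)
  then show ?thesis using assms by (auto simp: sq_integrable_def power2_sum algebra_simps)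
qed

lemma sq_integrable_cmult:
  "sq_integrable M X \<Longrightarrow> sq_integrable M (\<lambda>x. c * X x)"
  by (auto simp: sq_integrable_def power_mult_distrib)

lemma sq_integrable_diff:
  assumes X: "sq_integrable M X" and Y: "sq_integrable M Y"
  shows "sq_integrable M (\<lambda>x. X x - Y x)"
  using sq_integrable_add[OF X sq_integrable_cmult[OF Y, of "-1"]] by simp

lemma sq_integrable_sum:
  assumes "\<And>i. i \<in> I \<Longrightarrow> sq_integrable M (X i)"
  shows "sq_integrable M (\<lambda>x. \<Sum>i\<in>I. X i x)"
proof (cases "finite I")
  case True
  then show ?thesis using assms
  proof (induction I)
    case empty
    then show ?case by (simp add: sq_integrable_def)
  next
    case (insert i I)
    then show ?case by (simp add: sq_integrable_add)
  qed
qed (simp add: sq_integrable_def)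

lemma sq_integrable_abs: "sq_integrable M X \<Longrightarrow> sq_integrable M (\<lambda>x. \<bar>X x\<bar>)"
  by (auto simp: sq_integrable_def)

lemma (in finite_measure) sq_integrable_bounded:
  assumes "X \<in> borel_measurable M" "AE x in M. \<bar>X x\<bar> \<le> B"
  shows "sq_integrable M X"
proof -
  have "AE x in M. norm ((X x)\<^sup>2) \<le> B\<^sup>2"
    using assms(2) by eventually_elim (auto intro: power2_le_iff_abs_le[THEN iffD2] simp: abs_le_square_iff[symmetric])
  then have "integrable M (\<lambda>x. (X x)\<^sup>2)"
    using assms(1) by (intro integrable_const_bound[of _ "B\<^sup>2"]) auto
  then show ?thesis using assms(1) by (simp add: sq_integrable_def)
qed

lemma (in finite_measure) sq_integrable_const: "sq_integrable M (\<lambda>_. c)"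
  by (auto simp: sq_integrable_def)

lemma (in finite_measure) sq_integrable_integrable:
  assumes "sq_integrable M X" shows "integrable M X"
  using sq_integrable_mult[OF assms sq_integrable_const[of 1]] by simp

lemma sq_integrable_cong_AE:
  assumes "AE x in M. X x = Y x" "Y \<in> borel_measurable M" "sq_integrable M X"
  shows "sq_integrable M Y"
proof -
  have "AE x in M. (X x)\<^sup>2 = (Y x)\<^sup>2" using assms(1) by eventually_elim simp
  then have "integrable M (\<lambda>x. (X x)\<^sup>2) = integrable M (\<lambda>x. (Y x)\<^sup>2)"
    using assms by (intro integrable_cong_AE) (auto simp: sq_integrable_def)
  then show ?thesis using assms by (auto simp: sq_integrable_def)
qed

lemma integral_square_add:
  assumes X: "sq_integrable M X" and Y: "sq_integrable M Y"
  shows "(\<integral>x. (X x + Y x)\<^sup>2 \<partial>M) = sq_norm M X + 2 * (\<integral>x. X x * Y x \<partial>M) + sq_norm M Y"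
proof -
  have "(\<integral>x. (X x + Y x)\<^sup>2 \<partial>M) = (\<integral>x. (X x)\<^sup>2 + 2 * (X x * Y x) + (Y x)\<^sup>2 \<partial>M)"
    by (simp add: power2_sum algebra_simps)
  also have "\<dots> = sq_norm M X + 2 * (\<integral>x. X x * Y x \<partial>M) + sq_norm M Y"
    using assms sq_integrable_mult[OF X Y] by (auto simp: sq_integrable_def)
  finally show ?thesis .
qed

lemma integral_square_diff:
  assumes X: "sq_integrable M X" and Y: "sq_integrable M Y"
  shows "(\<integral>x. (X x - Y x)\<^sup>2 \<partial>M) = sq_norm M X - 2 * (\<integral>x. X x * Y x \<partial>M) + sq_norm M Y"
  using integral_square_add[OF X sq_integrable_cmult[OF Y, of "-1"]] by simp

lemma integral_Cauchy_Schwarz: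
  assumes X: "sq_integrable M X" and Y: "sq_integrable M Y"
  shows "(\<integral>x. \<bar>X x * Y x\<bar> \<partial>M) \<le> sqrt (sq_norm M X) * sqrt (sq_norm M Y)"
proof -
  define A B C where "A = sq_norm M X" and "B = sq_norm M Y"
    and "C = (\<integral>x. \<bar>X x\<bar> * \<bar>Y x\<bar> \<partial>M)"
  note aX = sq_integrable_abs[OF X] and aY = sq_integrable_abs[OF Y]
  have B0: "0 \<le> B" by (simp add: B_def)
  have "C\<^sup>2 \<le> A * B"
  proof (cases "B = 0")
    case True
    have "AE x in M. (Y x)\<^sup>2 = 0"
      using True integral_nonneg_eq_0_iff_AE[OF sq_integrable_square[OF Y]]
      by (simp add: B_def)
    then have "AE x in M. \<bar>X x\<bar> * \<bar>Y x\<bar> = 0" by eventually_elim simp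
    then have "C = 0" unfolding C_def
      using sq_integrable_mult[OF aX aY] by (subst integral_nonneg_eq_0_iff_AE) auto
    then show ?thesis using True by simp
  next
    case False
    \<comment> \<open>\<open>B * \<bar>X\<bar> - C * \<bar>Y\<bar>\<close> is \<open>B\<close> times
      the component of \<open>\<bar>X\<bar>\<close> orthogonal to \<open>\<bar>Y\<bar>\<close>; the
      scaling by \<open>B\<close> avoids a division.\<close>
    have "0 \<le> (\<integral>x. (B * \<bar>X x\<bar> - C * \<bar>Y x\<bar>)\<^sup>2 \<partial>M)" by simp
    also have "\<dots> = (\<integral>x. (B * \<bar>X x\<bar>)\<^sup>2 \<partial>M) - 2 * (\<integral>x. (B * \<bar>X x\<bar>) * (C * \<bar>Y x\<bar>) \<partial>M) + (\<integral>x. (C * \<bar>Y x\<bar>)\<^sup>2 \<partial>M)"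
      by (intro integral_square_diff sq_integrable_cmult aX aY)
    also have "(\<integral>x. (B * \<bar>X x\<bar>) * (C * \<bar>Y x\<bar>) \<partial>M) = (\<integral>x. (B * C) * (\<bar>X x\<bar> * \<bar>Y x\<bar>) \<partial>M)"
      by (simp add: mult_ac)
    finally have "0 \<le> B * (A * B - C\<^sup>2)"
      by (simp add: power_mult_distrib A_def[symmetric] B_def[symmetric] C_def[symmetric])
         (simp add: algebra_simps power2_eq_square)
    then show ?thesis using False B0 by (simp add: zero_le_mult_iff)
  qed
  then have "\<bar>C\<bar> \<le> sqrt (A * B)" using real_le_rsqrt by (simp add: real_le_rsqrt)
  then show ?thesis by (simp add: A_def B_def C_def real_sqrt_mult abs_mult)
qed

lemma abs_integral_mult_le:
  assumes X: "sq_integrable M X" and Y: "sq_integrable M Y"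
  shows "\<bar>\<integral>x. X x * Y x \<partial>M\<bar> \<le> sqrt (sq_norm M X) * sqrt (sq_norm M Y)"
  using integral_Cauchy_Schwarz[OF assms] integral_abs_bound[of M "\<lambda>x. X x * Y x"] by linarith

lemma (in prob_space) integral_abs_le_L2:
  assumes X: "sq_integrable M X"
  shows "(\<integral>x. \<bar>X x\<bar> \<partial>M) \<le> sqrt (sq_norm M X)"
  using integral_Cauchy_Schwarz[OF X sq_integrable_const[of 1]] by (simp add: prob_space)

lemma L2_triangle:
  assumes X: "sq_integrable M X" and Y: "sq_integrable M Y"
  shows "sqrt (\<integral>x. (X x + Y x)\<^sup>2 \<partial>M) \<le> sqrt (sq_norm M X) + sqrt (sq_norm M Y)"
proof (rule real_le_lsqrt)
  have "(\<integral>x. X x * Y x \<partial>M) \<le> sqrt (sq_norm M X) * sqrt (sq_norm M Y)"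
    using abs_integral_mult_le[OF X Y] by linarith
  then show "(\<integral>x. (X x + Y x)\<^sup>2 \<partial>M) \<le> (sqrt (sq_norm M X) + sqrt (sq_norm M Y))\<^sup>2"
    unfolding integral_square_add[OF X Y] by (simp add: power2_sum)
qed auto

lemma integral_square_tendsto:
  assumes X: "sq_integrable M X" and Y: "\<And>n. sq_integrable M (Y n)"
    and lim: "(\<lambda>n. \<integral>x. (Y n x - X x)\<^sup>2 \<partial>M) \<longlonglongrightarrow> 0"
  shows "(\<lambda>n. \<integral>x. (Y n x)\<^sup>2 \<partial>M) \<longlonglongrightarrow> sq_norm M X"
proof -
  note D = sq_integrable_diff[OF Y X]
  have "(\<lambda>n. \<integral>x. X x * (Y n x - X x) \<partial>M) \<longlonglongrightarrow> 0"
  proof (rule tendsto_0_le[where K = "sqrt (sq_norm M X)"])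
    show "(\<lambda>n. sqrt (\<integral>x. (Y n x - X x)\<^sup>2 \<partial>M)) \<longlonglongrightarrow> 0"
      using tendsto_real_sqrt[OF lim] by simp
    show "\<forall>\<^sub>F n in sequentially. norm (\<integral>x. X x * (Y n x - X x) \<partial>M)
        \<le> norm (sqrt (\<integral>x. (Y n x - X x)\<^sup>2 \<partial>M)) * sqrt (sq_norm M X)"
      using abs_integral_mult_le[OF X D] by (simp add: mult.commute)
  qed
  then have "(\<lambda>n. (sq_norm M X) + 2 * (\<integral>x. X x * (Y n x - X x) \<partial>M) + (\<integral>x. (Y n x - X x)\<^sup>2 \<partial>M))
      \<longlonglongrightarrow> sq_norm M X + 2 * 0 + 0"
    by (intro tendsto_intros lim)
  then show ?thesis by (simp add: integral_square_add[OF X D, symmetric])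
qed

text \<open>Riesz-Fischer: a rapidly converging subsequence has an almost sure limit, and Fatou's
  lemma turns that limit into a limit in norm of the whole sequence.\<close>

lemma (in prob_space) L2_complete:
  assumes r: "\<And>n::nat. sq_integrable M (r n)"
    and Cauchy: "\<And>e. 0 < e \<Longrightarrow> \<exists>K. \<forall>i\<ge>K. \<forall>j\<ge>K. (\<integral>x. (r i x - r j x)\<^sup>2 \<partial>M) \<le> e"
  obtains R where "sq_integrable M R" "(\<lambda>n. \<integral>x. (r n x - R x)\<^sup>2 \<partial>M) \<longlonglongrightarrow> 0"
proof -
  note [measurable] = sq_integrable_measurable[OF r]
  \<comment> \<open>The bound \<open>(1/4) ^ k\<close> on squared distances gives distances
    \<open>(1/2) ^ k\<close>, which are summable.\<close>
  have "\<exists>K. \<forall>i\<ge>K. \<forall>j\<ge>K. (\<integral>x. (r i x - r j x)\<^sup>2 \<partial>M) \<le> (1/4) ^ k" for k :: nat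
    by (rule Cauchy) simp
  then obtain K where K: "\<And>k i j. i \<ge> K k \<Longrightarrow> j \<ge> K k \<Longrightarrow> (\<integral>x. (r i x - r j x)\<^sup>2 \<partial>M) \<le> (1/4) ^ k"
    by metis
  \<comment> \<open>The sum makes \<open>s\<close> increasing and at least \<open>K k\<close>; the
    summand \<open>k\<close> makes it unbounded, which the Fatou step relies on.\<close>
  define s where "s k = k + (\<Sum>j\<le>k. K j)" for k
  have sK: "K k \<le> s k" for k unfolding s_def using member_le_sum[of k "{..k}" K] by auto
  have smono: "s k \<le> s (Suc k)" for k by (simp add: s_def)
  define g where "g k x = r (s (Suc k)) x - r (s k) x" for k x
  have g[measurable]: "g k \<in> borel_measurable M" for k unfolding g_def by simp
  have gsi: "sq_integrable M (g k)" for k unfolding g_def by (intro sq_integrable_diff r)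
  have gint: "(\<integral>x. \<bar>g k x\<bar> \<partial>M) \<le> (1/2) ^ k" for k
  proof -
    have "sq_norm M (g k) \<le> (1/4) ^ k"
      unfolding g_def using sK[of k] smono[of k] by (intro K) auto
    then have "sqrt (sq_norm M (g k)) \<le> sqrt ((1/4) ^ k)" by simp
    also have "\<dots> = (1/2) ^ k" by (simp add: real_sqrt_power real_sqrt_divide)
    finally show ?thesis using integral_abs_le_L2[OF gsi, of k] by linarith
  qed
  have "(\<integral>\<^sup>+x. (\<Sum>k. ennreal \<bar>g k x\<bar>) \<partial>M) = (\<Sum>k. \<integral>\<^sup>+x. ennreal \<bar>g k x\<bar> \<partial>M)"
    by (rule nn_integral_suminf) simp
  also have "\<dots> = (\<Sum>k. ennreal (\<integral>x. \<bar>g k x\<bar> \<partial>M))"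
    using sq_integrable_integrable[OF gsi] by (subst nn_integral_eq_integral) auto
  also have "\<dots> \<le> (\<Sum>k. ennreal ((1/2) ^ k))"
    using gint by (intro suminf_le ennreal_leI) auto
  also have "\<dots> = ennreal (\<Sum>k. (1/2) ^ k)"
    by (intro suminf_ennreal2) auto
  also have "\<dots> < \<infinity>" by simp
  finally have "(\<integral>\<^sup>+x. (\<Sum>k. ennreal \<bar>g k x\<bar>) \<partial>M) \<noteq> \<infinity>" by simp
  then have "AE x in M. (\<Sum>k. ennreal \<bar>g k x\<bar>) \<noteq> \<infinity>"
    by (intro nn_integral_PInf_AE) auto
  then have AEsum: "AE x in M. summable (\<lambda>k. g k x)"
  proof eventually_elim
    case (elim x)
    then have "summable (\<lambda>k. \<bar>g k x\<bar>)" by (intro summable_suminf_not_top) auto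
    then show ?case by (rule summable_rabs_cancel)
  qed
  define R where "R x = r (s 0) x + (\<Sum>k. g k x)" for x
  have R[measurable]: "R \<in> borel_measurable M" unfolding R_def by measurable
  have tele: "r (s 0) x + (\<Sum>k<n. g k x) = r (s n) x" for n x
    by (induction n) (auto simp: g_def)
  have AElim: "AE x in M. (\<lambda>k. r (s k) x) \<longlonglongrightarrow> R x" using AEsum
  proof eventually_elim
    case (elim x)
    then have "(\<lambda>n. r (s 0) x + (\<Sum>k<n. g k x)) \<longlonglongrightarrow> R x"
      unfolding R_def by (intro tendsto_intros summable_LIMSEQ)
    then show ?case by (simp add: tele)
  qed
  have Fatou: "(\<integral>\<^sup>+x. ennreal ((r n x - R x)\<^sup>2) \<partial>M) \<le> ennreal e"
    if L: "\<And>i j. i \<ge> L \<Longrightarrow> j \<ge> L \<Longrightarrow> (\<integral>x. (r i x - r j x)\<^sup>2 \<partial>M) \<le> e" and "n \<ge> L" for n L e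
  proof -
    have "AE x in M. ennreal ((r n x - R x)\<^sup>2) = liminf (\<lambda>k. ennreal ((r n x - r (s k) x)\<^sup>2))"
      using AElim
    proof eventually_elim
      case (elim x)
      have "(\<lambda>k. ennreal ((r n x - r (s k) x)\<^sup>2)) \<longlonglongrightarrow> ennreal ((r n x - R x)\<^sup>2)"
        by (intro tendsto_ennrealI tendsto_intros elim)
      then show ?case using lim_imp_Liminf[OF trivial_limit_sequentially] by metis
    qed
    then have "(\<integral>\<^sup>+x. ennreal ((r n x - R x)\<^sup>2) \<partial>M) = (\<integral>\<^sup>+x. liminf (\<lambda>k. ennreal ((r n x - r (s k) x)\<^sup>2)) \<partial>M)"
      by (rule nn_integral_cong_AE)
    also have "\<dots> \<le> liminf (\<lambda>k. \<integral>\<^sup>+x. ennreal ((r n x - r (s k) x)\<^sup>2) \<partial>M)"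
      by (rule nn_integral_liminf) simp
    also have "\<dots> \<le> ennreal e"
    proof (rule Liminf_le)
      have "(\<integral>\<^sup>+x. ennreal ((r n x - r (s k) x)\<^sup>2) \<partial>M) \<le> ennreal e" if "k \<ge> L" for k
      proof -
        have "s k \<ge> L" using that by (simp add: s_def)
        then have "(\<integral>x. (r n x - r (s k) x)\<^sup>2 \<partial>M) \<le> e" using L \<open>n \<ge> L\<close> by blast
        then show ?thesis
          using sq_integrable_diff[OF r[of n] r[of "s k"]]
          by (subst nn_integral_eq_integral) (auto simp: sq_integrable_def intro: ennreal_leI)
      qed
      then show "\<forall>\<^sub>F k in sequentially. (\<integral>\<^sup>+x. ennreal ((r n x - r (s k) x)\<^sup>2) \<partial>M) \<le> ennreal e"
        unfolding eventually_sequentially by blast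
    qed simp
    finally show ?thesis .
  qed
  have diff: "sq_integrable M (\<lambda>x. r n x - R x)" "(\<integral>x. (r n x - R x)\<^sup>2 \<partial>M) \<le> e"
    if L: "\<And>i j. i \<ge> L \<Longrightarrow> j \<ge> L \<Longrightarrow> (\<integral>x. (r i x - r j x)\<^sup>2 \<partial>M) \<le> e" and "n \<ge> L" "0 \<le> e" for n L e
  proof -
    have i: "integrable M (\<lambda>x. (r n x - R x)\<^sup>2)"
      using Fatou[OF that(1,2)] le_less_trans[OF _ ennreal_less_top] by (intro integrableI_bounded) auto
    then show "sq_integrable M (\<lambda>x. r n x - R x)" by (simp add: sq_integrable_def)
    have "ennreal (\<integral>x. (r n x - R x)\<^sup>2 \<partial>M) \<le> ennreal e"
      using Fatou[OF that(1,2)] nn_integral_eq_integral[OF i] by simp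
    then show "(\<integral>x. (r n x - R x)\<^sup>2 \<partial>M) \<le> e" using \<open>0 \<le> e\<close> by simp
  qed
  obtain L where "\<And>i j. i \<ge> L \<Longrightarrow> j \<ge> L \<Longrightarrow> (\<integral>x. (r i x - r j x)\<^sup>2 \<partial>M) \<le> 1"
    using Cauchy[of 1] by auto
  then have "sq_integrable M (\<lambda>x. r L x - R x)" by (rule diff(1)) auto
  then have "sq_integrable M R"
    using sq_integrable_diff[OF r[of L], of "\<lambda>x. r L x - R x"] by simp
  moreover have "(\<lambda>n. \<integral>x. (r n x - R x)\<^sup>2 \<partial>M) \<longlonglongrightarrow> 0"
  proof (rule LIMSEQ_I)
    fix e :: real assume "0 < e"
    then obtain L where L: "\<And>i j. i \<ge> L \<Longrightarrow> j \<ge> L \<Longrightarrow> (\<integral>x. (r i x - r j x)\<^sup>2 \<partial>M) \<le> e / 2"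
      using Cauchy[of "e / 2"] by auto
    have "norm ((\<integral>x. (r n x - R x)\<^sup>2 \<partial>M) - 0) < e" if "n \<ge> L" for n
    proof -
      have "(\<integral>x. (r n x - R x)\<^sup>2 \<partial>M) \<le> e / 2" using L that \<open>0 < e\<close> by (intro diff(2)[of L]) auto
      then show ?thesis using \<open>0 < e\<close> by simp
    qed
    then show "\<exists>no. \<forall>n\<ge>no. norm ((\<integral>x. (r n x - R x)\<^sup>2 \<partial>M) - 0) < e" by blast
  qed
  ultimately show thesis using that by blast
qed

text \<open>A limit of minimal norm of functions \<open>h - \<phi> + T \<phi>\<close> is orthogonal to all \<open>\<psi> - T \<psi>\<close>,
  which for a contraction forces it to be a fixed point of \<open>T\<close>.\<close>

lemma (in prob_space) mean_ergodic_coboundary_approx: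
  fixes T :: "('a \<Rightarrow> real) \<Rightarrow> 'a \<Rightarrow> real"
  assumes T_si: "\<And>\<phi>. sq_integrable M \<phi> \<Longrightarrow> sq_integrable M (T \<phi>)"
    and T_contr: "\<And>\<phi>. sq_integrable M \<phi> \<Longrightarrow> (sq_norm M (T \<phi>)) \<le> sq_norm M \<phi>"
    and T_mean: "\<And>\<phi>. sq_integrable M \<phi> \<Longrightarrow> (\<integral>x. T \<phi> x \<partial>M) = (\<integral>x. \<phi> x \<partial>M)"
    and T_lin: "\<And>\<phi> \<psi> c. sq_integrable M \<phi> \<Longrightarrow> sq_integrable M \<psi> \<Longrightarrow>
        AE x in M. T (\<lambda>x. \<phi> x + c * \<psi> x) x = T \<phi> x + c * T \<psi> x"
    and T_erg: "\<And>\<phi>. sq_integrable M \<phi> \<Longrightarrow> AE x in M. T \<phi> x = \<phi> x \<Longrightarrow> \<exists>c. AE x in M. \<phi> x = c"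
    and h: "sq_integrable M h" "(\<integral>x. h x \<partial>M) = 0" and e: "0 < e"
  shows "\<exists>\<phi>. sq_integrable M \<phi> \<and> (\<integral>x. (h x - \<phi> x + T \<phi> x)\<^sup>2 \<partial>M) < e"
proof -
  define \<rho> where "\<rho> \<phi> x = h x - \<phi> x + T \<phi> x" for \<phi> x
  define J where "J \<phi> = sq_norm M (\<rho> \<phi>)" for \<phi>
  have \<rho>_si: "sq_integrable M (\<rho> \<phi>)" if "sq_integrable M \<phi>" for \<phi>
    unfolding \<rho>_def using that by (intro sq_integrable_add sq_integrable_diff h T_si)
  have \<rho>_lin: "AE x in M. \<rho> (\<lambda>x. \<phi> x + c * \<psi> x) x = \<rho> \<phi> x - c * (\<psi> x - T \<psi> x)"
    if "sq_integrable M \<phi>" "sq_integrable M \<psi>" for \<phi> \<psi> c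
    using T_lin[OF that, of c] by eventually_elim (simp add: \<rho>_def algebra_simps)
  define d where "d = (INF \<phi>\<in>{\<phi>. sq_integrable M \<phi>}. J \<phi>)"
  have ne: "{\<phi>. sq_integrable M \<phi>} \<noteq> {}" using h by auto
  have bdd: "bdd_below (J ` {\<phi>. sq_integrable M \<phi>})" by (rule bdd_belowI2[of _ 0]) (simp add: J_def)
  have dle: "d \<le> J \<phi>" if "sq_integrable M \<phi>" for \<phi>
    unfolding d_def using that by (intro cINF_lower bdd) auto
  have "\<exists>\<phi>. sq_integrable M \<phi> \<and> J \<phi> < d + 1 / real (Suc n)" for n
    using cINF_less_iff[OF ne bdd, of "d + 1 / real (Suc n)"] by (auto simp: d_def[symmetric])
  then obtain \<phi> where \<phi>: "\<And>n. sq_integrable M (\<phi> n)" "\<And>n. J (\<phi> n) < d + 1 / real (Suc n)"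
    by metis
  define r where "r n = \<rho> (\<phi> n)" for n
  have r: "sq_integrable M (r n)" for n unfolding r_def by (intro \<rho>_si \<phi>)
  \<comment> \<open>Parallelogram law: the mean of \<open>r i\<close> and \<open>r j\<close> is
    again a residual, that of the midpoint \<open>\<psi>\<close>, hence has squared norm at least
    \<open>d\<close>. So the residuals of a minimising sequence are Cauchy, although the
    \<open>\<phi> n\<close> themselves need not converge.\<close>
  have par: "(\<integral>x. (r i x - r j x)\<^sup>2 \<partial>M) \<le> 2 / real (Suc i) + 2 / real (Suc j)" for i j
  proof -
    \<comment> \<open>The midpoint is written in the form \<open>\<phi> + c * \<psi>\<close> in
      which linearity of \<open>T\<close> is available.\<close>
    define \<psi> where "\<psi> x = \<phi> i x + (1/2) * (\<phi> j x - \<phi> i x)" for x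
    have \<psi>: "sq_integrable M \<psi>" unfolding \<psi>_def
      by (intro sq_integrable_add sq_integrable_cmult sq_integrable_diff \<phi>)
    have "AE x in M. \<rho> \<psi> x = \<rho> (\<phi> i) x - 1/2 * ((\<phi> j x - \<phi> i x) - T (\<lambda>x. \<phi> j x - \<phi> i x) x)"
      unfolding \<psi>_def by (intro \<rho>_lin sq_integrable_diff \<phi>)
    moreover have "AE x in M. T (\<lambda>x. \<phi> j x + (-1) * \<phi> i x) x = T (\<phi> j) x + (-1) * T (\<phi> i) x"
      by (intro T_lin \<phi>)
    ultimately have "AE x in M. \<rho> \<psi> x = (1/2) * (r i x + r j x)"
      by eventually_elim (simp add: r_def \<rho>_def field_simps)
    then have "AE x in M. (\<rho> \<psi> x)\<^sup>2 = (1/4) * (r i x + r j x)\<^sup>2"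
      by eventually_elim (simp only: power_mult_distrib, simp add: power_divide)
    then have "J \<psi> = (\<integral>x. (1/4) * (r i x + r j x)\<^sup>2 \<partial>M)"
      unfolding J_def
      using sq_integrable_measurable[OF \<rho>_si[OF \<psi>]] sq_integrable_measurable[OF r[of i]]
        sq_integrable_measurable[OF r[of j]]
      by (intro integral_cong_AE) auto
    also have "\<dots> = (1/4) * (\<integral>x. (r i x + r j x)\<^sup>2 \<partial>M)" by (rule integral_mult_right_zero)
    finally have "4 * d \<le> (\<integral>x. (r i x + r j x)\<^sup>2 \<partial>M)" using dle[OF \<psi>] by simp
    moreover have "sq_norm M (r i) < d + 1 / real (Suc i)" "sq_norm M (r j) < d + 1 / real (Suc j)"
      using \<phi>(2) by (auto simp: J_def r_def)
    ultimately show ?thesis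
      unfolding integral_square_diff[OF r r] integral_square_add[OF r r] by simp
  qed
  have Cauchy: "\<exists>K. \<forall>i\<ge>K. \<forall>j\<ge>K. (\<integral>x. (r i x - r j x)\<^sup>2 \<partial>M) \<le> e" if "0 < e" for e
  proof -
    obtain K :: nat where K: "4 / e < real K" using reals_Archimedean2 by blast
    have "(\<integral>x. (r i x - r j x)\<^sup>2 \<partial>M) \<le> e" if "i \<ge> K" "j \<ge> K" for i j
    proof -
      have *: "2 / real (Suc l) \<le> e / 2" if "l \<ge> K" for l
      proof -
        have "4 / e < real (Suc l)" using K that by linarith
        then show ?thesis using \<open>0 < e\<close> by (simp add: field_simps)
      qed
      show ?thesis using *[OF that(1)] *[OF that(2)] par[of i j] by linarith
    qed
    then show ?thesis by blast
  qed
  obtain R where R: "sq_integrable M R" and lim: "(\<lambda>n. \<integral>x. (r n x - R x)\<^sup>2 \<partial>M) \<longlonglongrightarrow> 0"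
    using L2_complete[OF r Cauchy] by blast
  note TR = T_si[OF R]
  have Jr: "(\<lambda>n. \<integral>x. (r n x)\<^sup>2 \<partial>M) \<longlonglongrightarrow> sq_norm M R"
    by (rule integral_square_tendsto[OF R r lim])
  have d1: "sq_norm M R \<le> d"
  proof (rule LIMSEQ_le[OF Jr])
    have "(\<lambda>n. d + 1 / real (Suc n)) \<longlonglongrightarrow> d + 0"
      by (intro tendsto_intros) (rule LIMSEQ_Suc[OF lim_1_over_n])
    then show "(\<lambda>n. d + 1 / real (Suc n)) \<longlonglongrightarrow> d" by simp
    show "\<exists>N. \<forall>n\<ge>N. (sq_norm M (r n)) \<le> d + 1 / real (Suc n)"
      using \<phi>(2) by (auto simp: J_def r_def intro: less_imp_le)
  qed
  \<comment> \<open>Replacing \<open>\<phi> n\<close> by \<open>\<phi> n + c * R\<close> perturbs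
    the residual by \<open>- c * (R - T R)\<close>. Testing the minimiser \<open>R\<close> in the
    direction of its own coboundary is enough.\<close>
  have d2: "d \<le> (\<integral>x. (R x - c * (R x - T R x))\<^sup>2 \<partial>M)" for c
  proof (rule LIMSEQ_le_const)
    have G: "sq_integrable M (\<lambda>x. c * (R x - T R x))"
      by (intro sq_integrable_cmult sq_integrable_diff R TR)
    show "(\<lambda>n. \<integral>x. (r n x - c * (R x - T R x))\<^sup>2 \<partial>M) \<longlonglongrightarrow> (\<integral>x. (R x - c * (R x - T R x))\<^sup>2 \<partial>M)"
      by (rule integral_square_tendsto) (use R r G lim in \<open>auto intro: sq_integrable_diff\<close>)
    have "d \<le> (\<integral>x. (r n x - c * (R x - T R x))\<^sup>2 \<partial>M)" for n
    proof -
      have si: "sq_integrable M (\<lambda>x. \<phi> n x + c * R x)"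
        by (intro sq_integrable_add sq_integrable_cmult \<phi> R)
      have "AE x in M. (\<rho> (\<lambda>x. \<phi> n x + c * R x) x)\<^sup>2 = (r n x - c * (R x - T R x))\<^sup>2"
        using \<rho>_lin[OF \<phi>(1)[of n] R, of c] by eventually_elim (simp add: r_def)
      then have "J (\<lambda>x. \<phi> n x + c * R x) = (\<integral>x. (r n x - c * (R x - T R x))\<^sup>2 \<partial>M)"
        unfolding J_def using \<rho>_si[OF si] sq_integrable_diff[OF r[of n] G]
        by (intro integral_cong_AE) (auto simp: sq_integrable_def)
      then show ?thesis using dle[OF si] by simp
    qed
    then show "\<exists>N. \<forall>n\<ge>N. d \<le> (\<integral>x. (r n x - c * (R x - T R x))\<^sup>2 \<partial>M)" by blast
  qed
  have dR: "d = sq_norm M R" using d1 d2[of 0] by simp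
  define g where "g x = R x - T R x" for x
  have g: "sq_integrable M g" unfolding g_def by (intro sq_integrable_diff R TR)
  define G C where "G = sq_norm M g" and "C = (\<integral>x. R x * g x \<partial>M)"
  have quad: "0 \<le> c\<^sup>2 * G - 2 * c * C" for c
  proof -
    have "(\<integral>x. (R x - c * g x)\<^sup>2 \<partial>M) = sq_norm M R - 2 * (\<integral>x. R x * (c * g x) \<partial>M) + (\<integral>x. (c * g x)\<^sup>2 \<partial>M)"
      by (intro integral_square_diff R sq_integrable_cmult g)
    also have "(\<integral>x. R x * (c * g x) \<partial>M) = c * C"
      unfolding C_def by (subst integral_mult_right_zero[symmetric]) (simp add: mult_ac)
    also have "(\<integral>x. (c * g x)\<^sup>2 \<partial>M) = c\<^sup>2 * G" by (simp add: power_mult_distrib G_def)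
    finally show ?thesis using d2[of c] dR unfolding g_def by simp
  qed
  have G0: "0 \<le> G" by (simp add: G_def)
  \<comment> \<open>At \<open>c = C / G\<close> the quadratic \<open>c^2 * G - 2 * c * C\<close>
    equals \<open>- C^2 / G\<close>, so its nonnegativity forces \<open>C = 0\<close>.\<close>
  have "C = 0"
  proof (cases "G = 0")
    case True
    then show ?thesis using quad[of 1] quad[of "-1"] by simp
  next
    case False
    have "(C / G)\<^sup>2 * G - 2 * (C / G) * C = - (C\<^sup>2 / G)"
      using False by (simp add: power2_eq_square field_simps)
    then have "C\<^sup>2 / G \<le> 0" using quad[of "C / G"] by linarith
    then show ?thesis using False G0 by (simp add: divide_le_0_iff)
  qed
  have "G = sq_norm M R - 2 * (\<integral>x. R x * T R x \<partial>M) + sq_norm M (T R)"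
    unfolding G_def g_def by (rule integral_square_diff[OF R TR])
  moreover have "C = sq_norm M R - (\<integral>x. R x * T R x \<partial>M)"
  proof -
    have "C = (\<integral>x. (R x)\<^sup>2 - R x * T R x \<partial>M)"
      unfolding C_def g_def by (simp add: power2_eq_square algebra_simps)
    then show ?thesis
      using R sq_integrable_mult[OF R TR] by (simp add: sq_integrable_def)
  qed
  \<comment> \<open>By contraction \<open>G\<close> is at most \<open>2 * C\<close>: in the
    expansion, the squared norm of \<open>T R\<close> is replaced by that of
    \<open>R\<close>.\<close>
  ultimately have "G \<le> 0" using T_contr[OF R] \<open>C = 0\<close> by linarith
  then have "G = 0" using G0 by simp
  then have "AE x in M. (g x)\<^sup>2 = 0"
    using integral_nonneg_eq_0_iff_AE[OF sq_integrable_square[OF g]]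
    by (simp add: G_def)
  then have "AE x in M. T R x = R x" by eventually_elim (simp add: g_def)
  then obtain c where c: "AE x in M. R x = c" using T_erg[OF R] by blast
  \<comment> \<open>Residuals have mean zero because \<open>h\<close> does and \<open>T\<close>
    preserves means, and the mean is continuous in norm. So the constant \<open>c\<close> is 0, and
    therefore \<open>d = 0\<close>.\<close>
  have Rint: "(\<integral>x. R x \<partial>M) = 0"
  proof -
    have rn: "(\<integral>x. r n x \<partial>M) = 0" for n
      unfolding r_def \<rho>_def
      using h T_mean[OF \<phi>(1)] sq_integrable_integrable[OF \<phi>(1)]
        sq_integrable_integrable[OF T_si[OF \<phi>(1)]] sq_integrable_integrable[OF h(1)]
      by simp
    have "\<bar>\<integral>x. R x \<partial>M\<bar> \<le> sqrt (\<integral>x. (r n x - R x)\<^sup>2 \<partial>M)" for n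
    proof -
      note D = sq_integrable_diff[OF r[of n] R]
      have "(\<integral>x. r n x - R x \<partial>M) = - (\<integral>x. R x \<partial>M)"
        using rn[of n] sq_integrable_integrable[OF r] sq_integrable_integrable[OF R] by simp
      then have "\<bar>\<integral>x. R x \<partial>M\<bar> = \<bar>\<integral>x. r n x - R x \<partial>M\<bar>" by simp
      also have "\<dots> \<le> (\<integral>x. \<bar>r n x - R x\<bar> \<partial>M)" by (rule integral_abs_bound)
      finally show ?thesis using integral_abs_le_L2[OF D] by linarith
    qed
    moreover have "(\<lambda>n. sqrt (\<integral>x. (r n x - R x)\<^sup>2 \<partial>M)) \<longlonglongrightarrow> 0"
      using tendsto_real_sqrt[OF lim] by simp
    ultimately have "\<bar>\<integral>x. R x \<partial>M\<bar> \<le> 0" using LIMSEQ_le_const by blast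
    then show ?thesis by simp
  qed
  have "(\<integral>x. R x \<partial>M) = (\<integral>x. c \<partial>M)"
    using c R by (intro integral_cong_AE) (auto simp: sq_integrable_def)
  then have "c = 0" using Rint by (simp add: prob_space)
  then have "AE x in M. (R x)\<^sup>2 = 0" using c by auto
  then have "sq_norm M R = 0"
    using integral_nonneg_eq_0_iff_AE[OF sq_integrable_square[OF R]] by simp
  then have "d < e" using dR e by simp
  then show ?thesis
    unfolding d_def using cINF_less_iff[OF ne bdd, of e] by (auto simp: J_def \<rho>_def)
qed

section \<open>Characteristic functions of martingale sums\<close>

lemma one_minus_le_exp_remainder:
  fixes x :: real assumes "0 \<le> x" shows "\<bar>1 - x - exp (- x)\<bar> \<le> x\<^sup>2"
proof -
  have "1 \<le> (1 + x) * (1 - x + x\<^sup>2)" using assms by (simp add: algebra_simps power2_eq_square)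
  then have "1 / (1 + x) \<le> 1 - x + x\<^sup>2" using assms by (simp add: divide_le_eq mult.commute)
  moreover have "exp (- x) \<le> 1 / (1 + x)"
    using exp_ge_add_one_self[of x] assms by (simp add: exp_minus field_simps)
  moreover have "1 - x \<le> exp (- x)" using exp_ge_add_one_self[of "- x"] by simp
  ultimately show ?thesis by linarith
qed

text \<open>The minimum of both remainders is what a Lindeberg argument with second moments only
  requires: the cube is small near 0, and the square is integrable.\<close>

lemma iexp_second_order:
  "cmod (iexp x - (1 + \<i> * x - x\<^sup>2 / 2)) \<le> min (x\<^sup>2) (\<bar>x\<bar> ^ 3)"
proof -
  have e: "(\<Sum>k\<le>2. (\<i> * complex_of_real x) ^ k / fact k) = 1 + \<i> * x - x\<^sup>2 / 2"
    by (simp add: numeral_2_eq_2 power_mult_distrib)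
  have "cmod (iexp x - (1 + \<i> * x - x\<^sup>2 / 2)) \<le> \<bar>x\<bar> ^ 3 / 6"
    using iexp_approx1[of x 2] unfolding e by (simp add: eval_nat_numeral)
  moreover have "cmod (iexp x - (1 + \<i> * x - x\<^sup>2 / 2)) \<le> x\<^sup>2"
    using iexp_approx2[of x 2] unfolding e by (simp add: numeral_2_eq_2)
  moreover have "\<bar>x\<bar> ^ 3 / 6 \<le> \<bar>x\<bar> ^ 3" using zero_le_power[of "\<bar>x\<bar>" 3] by simp
  ultimately show ?thesis by linarith
qed

lemma norm_iexp_diff_le: "cmod (iexp x - iexp y) \<le> \<bar>x - y\<bar>"
proof -
  have "iexp x - iexp y = iexp y * (iexp (x - y) - 1)"
    by (simp add: exp_diff algebra_simps)
  then have "cmod (iexp x - iexp y) = cmod (iexp (x - y) - 1)" by (simp add: norm_mult)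
  also have "\<dots> \<le> \<bar>x - y\<bar>" using iexp_approx1[of "x - y" 0] by simp
  finally show ?thesis .
qed

text \<open>Since \<open>c\<close> lies between 0 and 1, earlier errors are never amplified, and
  \<open>n\<close> steps cost at most \<open>n\<close> times one error.\<close>

lemma linear_recursion_error:
  fixes A :: "nat \<Rightarrow> complex" and c :: real
  assumes "0 \<le> c" "c \<le> 1" and step: "\<And>k. cmod (A (Suc k) - c * A k) \<le> \<eta>"
  shows "cmod (A n - c ^ n * A 0) \<le> real n * \<eta>"
proof (induction n)
  case (Suc n)
  have "A (Suc n) - c ^ Suc n * A 0 = (A (Suc n) - c * A n) + c * (A n - c ^ n * A 0)"
    by (simp add: algebra_simps)
  moreover have "cmod (c * (A n - c ^ n * A 0)) \<le> c * (real n * \<eta>)"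
    using mult_left_mono[OF Suc.IH \<open>0 \<le> c\<close>] \<open>0 \<le> c\<close> by (simp add: norm_mult)
  ultimately have "cmod (A (Suc n) - c ^ Suc n * A 0) \<le> \<eta> + c * (real n * \<eta>)"
    using norm_triangle_mono[OF step[of n]] by (simp only:)
  also have "0 \<le> \<eta>" using step[of 0] norm_ge_zero order_trans by blast
  then have "c * (real n * \<eta>) \<le> real n * \<eta>" using \<open>c \<le> 1\<close> by (simp add: mult_left_le_one_le \<open>0 \<le> c\<close>)
  finally show ?case by (simp add: algebra_simps)
qed simp

lemma (in prob_space) integrable_unimodular_mult:
  assumes "\<psi> \<in> borel_measurable M" "\<And>z. cmod (\<psi> z) \<le> 1" "integrable M X"
  shows "integrable M (\<lambda>z. \<psi> z * X z :: complex)" "cmod (\<integral>z. \<psi> z * X z \<partial>M) \<le> (\<integral>z. cmod (X z) \<partial>M)"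
proof -
  show "integrable M (\<lambda>z. \<psi> z * X z)"
    using assms by (intro Bochner_Integration.integrable_bound[OF assms(3)]) (auto simp: norm_mult mult_left_le_one_le)
  then have "cmod (\<integral>z. \<psi> z * X z \<partial>M) \<le> (\<integral>z. cmod (\<psi> z * X z) \<partial>M)"
    by (intro integral_norm_bound)
  also have "\<dots> \<le> (\<integral>z. cmod (X z) \<partial>M)"
    using assms integrable_norm[OF \<open>integrable M (\<lambda>z. \<psi> z * X z)\<close>]
    by (intro integral_mono) (simp_all add: norm_mult mult_left_le_one_le)
  finally show "cmod (\<integral>z. \<psi> z * X z \<partial>M) \<le> (\<integral>z. cmod (X z) \<partial>M)" .
qed

text \<open>With \<open>S\<^sub>k\<close> the sum of the first \<open>k\<close> differences, the quantities \<open>E(exp(i s S\<^sub>k) (1 - s\<^sup>2/2 \<Phi>\<^sub>k))\<close>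
  almost satisfy the recursion of the Gaussian characteristic function: the coboundary
  \<open>\<Phi>\<^sub>k - \<Phi>\<^bsub>k+1\<^esub>\<close> absorbs the fluctuations of the conditional variances.\<close>

lemma (in prob_space) char_martingale_sum_error:
  fixes D \<Phi> :: "nat \<Rightarrow> 'a \<Rightarrow> real"
  defines "\<psi> \<equiv> \<lambda>s k z. iexp (s * (\<Sum>j<k. D j z))"
  assumes D: "\<And>k. sq_integrable M (D k)" "\<And>k. (sq_norm M (D k)) = v"
    and \<Phi>: "\<And>k. sq_integrable M (\<Phi> k)" "\<And>k. (sq_norm M (\<Phi> k)) \<le> C\<^sup>2" "0 \<le> C"
    and mart: "\<And>k. (\<integral>z. \<psi> s k z * D k z \<partial>M) = 0"
    and cob: "\<And>k. cmod (\<integral>z. \<psi> s k z * ((D k z)\<^sup>2 - v - \<Phi> k z + \<Phi> (Suc k) z) \<partial>M) \<le> \<epsilon>"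
    and lind: "\<And>k. (\<integral>z. min ((s * D k z)\<^sup>2) (\<bar>s * D k z\<bar> ^ 3) \<partial>M) \<le> \<delta>"
  shows "cmod ((\<integral>z. \<psi> s n z \<partial>M) - exp (- (s\<^sup>2 * v / 2)) ^ n)
    \<le> real n * (\<delta> + (s\<^sup>2 * v)\<^sup>2 + s\<^sup>2 / 2 * (\<epsilon> + (\<bar>s\<bar> * sqrt v * C + s\<^sup>2 * v * C))) + s\<^sup>2 * C"
proof -
  note [measurable] = sq_integrable_measurable[OF D(1)] sq_integrable_measurable[OF \<Phi>(1)]
  have v0: "0 \<le> v" using D(2)[of 0, symmetric] by simp
  \<comment> \<open>\<open>c\<close> is the factor by which the characteristic function of a
    centered normal variable with variance \<open>k * v\<close> shrinks when \<open>k\<close> grows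
    by one.\<close>
  define c where "c = exp (- (s\<^sup>2 * v / 2))"
  have c: "0 \<le> c" "c \<le> 1" using v0 by (auto simp: c_def)
  define P where "P k z = \<psi> s k z" for k z
  have Pm[measurable]: "P k \<in> borel_measurable M" for k unfolding P_def \<psi>_def by measurable
  have Pn: "cmod (P k z) = 1" for k z by (simp add: P_def \<psi>_def)
  have P0: "P 0 z = 1" for z by (simp add: P_def \<psi>_def)
  have PSuc: "P (Suc k) z = P k z * iexp (s * D k z)" for k z
    by (simp add: P_def \<psi>_def ring_distribs flip: exp_add)
  note Pint = integrable_unimodular_mult(1)[OF Pm eq_refl[OF Pn]] and Pbnd = integrable_unimodular_mult(2)[OF Pm eq_refl[OF Pn]]
  note Di = sq_integrable_integrable[OF D(1)] and \<Phi>i = sq_integrable_integrable[OF \<Phi>(1)]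
  have D2i: "integrable M (\<lambda>z. (D k z)\<^sup>2)" for k using D(1) by (rule sq_integrable_square)
  have \<Phi>L2: "sqrt (sq_norm M (\<Phi> k)) \<le> C" for k
    using real_sqrt_le_mono[OF \<Phi>(2)[of k]] \<Phi>(3) by simp
  have \<Phi>L1: "(\<integral>z. \<bar>\<Phi> k z\<bar> \<partial>M) \<le> C" for k
    using integral_abs_le_L2[OF \<Phi>(1)] \<Phi>L2[of k] order_trans by blast
  define A where "A k = (\<integral>z. P k z * (1 - s\<^sup>2 / 2 * \<Phi> k z) \<partial>M)" for k
  have Ai: "integrable M (\<lambda>z. P k z * complex_of_real (1 - s\<^sup>2 / 2 * \<Phi> k z))" for k
    using \<Phi>i by (intro Pint) auto
  \<comment> \<open>The correction factor costs at most \<open>s^2 / 2 * C\<close>. It is paid once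
    at time \<open>n\<close> and once at time 0, whence the term \<open>s^2 * C\<close> outside the
    factor \<open>n\<close>.\<close>
  have A_near: "cmod (A k - (\<integral>z. P k z \<partial>M)) \<le> s\<^sup>2 / 2 * C" for k
  proof -
    have i1: "integrable M (P k)" using Pint[of "\<lambda>_. 1" k] by simp
    have "A k - (\<integral>z. P k z \<partial>M) = (\<integral>z. P k z * complex_of_real (1 - s\<^sup>2 / 2 * \<Phi> k z) - P k z \<partial>M)"
      unfolding A_def using Ai i1 by simp
    also have "\<dots> = (\<integral>z. P k z * complex_of_real (- (s\<^sup>2 / 2 * \<Phi> k z)) \<partial>M)"
      by (simp add: algebra_simps)
    also have "cmod \<dots> \<le> (\<integral>z. cmod (complex_of_real (- (s\<^sup>2 / 2 * \<Phi> k z))) \<partial>M)"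
      using \<Phi>i by (intro Pbnd) (auto simp del: of_real_minus of_real_mult)
    also have "\<dots> = s\<^sup>2 / 2 * (\<integral>z. \<bar>\<Phi> k z\<bar> \<partial>M)"
      by (simp only: norm_of_real abs_minus_cancel abs_mult, simp)
    also have "\<dots> \<le> s\<^sup>2 / 2 * C" by (intro mult_left_mono \<Phi>L1) auto
    finally show ?thesis .
  qed
  define \<eta> where "\<eta> = \<delta> + (s\<^sup>2 * v)\<^sup>2 + s\<^sup>2 / 2 * (\<epsilon> + (\<bar>s\<bar> * sqrt v * C + s\<^sup>2 * v * C))"
  have step: "cmod (A (Suc k) - c * A k) \<le> \<eta>" for k
  proof -
    define R where "R z = iexp (s * D k z) - (1 + \<i> * (s * D k z) - (s * D k z)\<^sup>2 / 2)" for z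
    define G where "G z = (D k z)\<^sup>2 - v - \<Phi> k z + \<Phi> (Suc k) z" for z
    define \<kappa> where "\<kappa> = 1 - s\<^sup>2 * v / 2 - c"
    define W where "W z = (iexp (s * D k z) - 1) * \<Phi> (Suc k) z + (1 - c) * \<Phi> k z" for z
    have Rm[measurable]: "R \<in> borel_measurable M" unfolding R_def by measurable
    have Wm[measurable]: "W \<in> borel_measurable M" unfolding W_def by measurable
    have Gi: "integrable M G" unfolding G_def using D2i \<Phi>i by auto
    have Rb: "cmod (R z) \<le> min ((s * D k z)\<^sup>2) (\<bar>s * D k z\<bar> ^ 3)" for z
      using iexp_second_order[of "s * D k z"] by (simp add: R_def)
    have sDi: "integrable M (\<lambda>z. (s * D k z)\<^sup>2)" using D2i by (simp add: power_mult_distrib)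
    have mi: "integrable M (\<lambda>z. min ((s * D k z)\<^sup>2) (\<bar>s * D k z\<bar> ^ 3))"
      by (rule Bochner_Integration.integrable_bound[OF sDi]) (auto simp: abs_of_nonneg[OF min.boundedI])
    have Ri: "integrable M R"
      using Rb by (intro Bochner_Integration.integrable_bound[OF mi]) (auto intro: order_trans)
    have Wb: "cmod (W z) \<le> \<bar>s\<bar> * \<bar>D k z * \<Phi> (Suc k) z\<bar> + (1 - c) * \<bar>\<Phi> k z\<bar>" for z
    proof -
      have "cmod (iexp (s * D k z) - 1) \<le> \<bar>s * D k z\<bar>" using norm_iexp_diff_le[of "s * D k z" 0] by simp
      then have "cmod (iexp (s * D k z) - 1) * \<bar>\<Phi> (Suc k) z\<bar> \<le> \<bar>s * D k z\<bar> * \<bar>\<Phi> (Suc k) z\<bar>"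
        by (rule mult_right_mono) simp
      moreover have "cmod ((1 - c) * complex_of_real (\<Phi> k z)) = (1 - c) * \<bar>\<Phi> k z\<bar>"
      proof -
        have "(1 - c) * complex_of_real (\<Phi> k z) = complex_of_real ((1 - c) * \<Phi> k z)" by simp
        then show ?thesis using c by (simp only: norm_of_real abs_mult)
      qed
      ultimately show ?thesis
        unfolding W_def by (intro norm_triangle_mono) (auto simp: norm_mult abs_mult mult.assoc)
    qed
    have D\<Phi>i: "integrable M (\<lambda>z. \<bar>D k z * \<Phi> (Suc k) z\<bar>)"
      using sq_integrable_mult[OF D(1) \<Phi>(1)] by auto
    have Wdom: "integrable M (\<lambda>z. \<bar>s\<bar> * \<bar>D k z * \<Phi> (Suc k) z\<bar> + (1 - c) * \<bar>\<Phi> k z\<bar>)"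
      using D\<Phi>i \<Phi>i by auto
    have Wi: "integrable M W"
      by (rule Bochner_Integration.integrable_bound[OF Wdom]) (use Wb in \<open>auto intro!: AE_I2 intro: order_trans[OF _ abs_ge_self]\<close>)
    \<comment> \<open>Expansion of one step, sorted by origin: \<open>R\<close> is the Taylor
      remainder, the linear term vanishes by the martingale property, \<open>G\<close> is the defect
      of the coboundary equation, \<open>\<kappa>\<close> compares \<open>1 - s^2 * v / 2\<close>
      with \<open>c\<close>, and \<open>W\<close> collects the products of the correction with
      \<open>iexp (s * D k z) - 1\<close> and with \<open>1 - c\<close>.\<close>
    have point: "P (Suc k) z * complex_of_real (1 - s\<^sup>2 / 2 * \<Phi> (Suc k) z) - c * (P k z * complex_of_real (1 - s\<^sup>2 / 2 * \<Phi> k z))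
      = P k z * R z + \<i> * s * (P k z * D k z) - s\<^sup>2 / 2 * (P k z * G z) + \<kappa> * P k z - s\<^sup>2 / 2 * (P k z * W z)" for z
      unfolding PSuc R_def G_def \<kappa>_def W_def
      by (simp add: field_simps power_mult_distrib)
    have i1: "integrable M (\<lambda>z. P k z * R z)" by (rule Pint[OF Ri])
    have i2: "integrable M (\<lambda>z. P k z * complex_of_real (D k z))" by (rule Pint) (use Di in auto)
    have i3: "integrable M (\<lambda>z. P k z * complex_of_real (G z))" by (rule Pint) (use Gi in auto)
    have i4: "integrable M (P k)" using Pint[of "\<lambda>_. 1" k] by simp
    have i5: "integrable M (\<lambda>z. P k z * W z)" by (rule Pint[OF Wi])
    have "A (Suc k) - c * A k = (\<integral>z. P (Suc k) z * complex_of_real (1 - s\<^sup>2 / 2 * \<Phi> (Suc k) z) - c * (P k z * complex_of_real (1 - s\<^sup>2 / 2 * \<Phi> k z)) \<partial>M)"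
      unfolding A_def using Ai[of "Suc k"] Ai[of k] by simp
    also have "\<dots> = (\<integral>z. P k z * R z + \<i> * s * (P k z * D k z) - s\<^sup>2 / 2 * (P k z * G z) + \<kappa> * P k z - s\<^sup>2 / 2 * (P k z * W z) \<partial>M)"
      unfolding point ..
    also have "\<dots> = (\<integral>z. P k z * R z \<partial>M) + \<i> * s * (\<integral>z. P k z * D k z \<partial>M) - s\<^sup>2 / 2 * (\<integral>z. P k z * G z \<partial>M)
        + \<kappa> * (\<integral>z. P k z \<partial>M) - s\<^sup>2 / 2 * (\<integral>z. P k z * W z \<partial>M)"
      using i1 i2 i3 i4 i5 by simp
    also have "(\<integral>z. P k z * D k z \<partial>M) = 0" using mart[of k] by (simp add: P_def)
    finally have eq: "A (Suc k) - c * A k = (\<integral>z. P k z * R z \<partial>M) - s\<^sup>2 / 2 * (\<integral>z. P k z * G z \<partial>M)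
        + \<kappa> * (\<integral>z. P k z \<partial>M) - s\<^sup>2 / 2 * (\<integral>z. P k z * W z \<partial>M)" by simp
    have b1: "cmod (\<integral>z. P k z * R z \<partial>M) \<le> \<delta>"
    proof -
      have "(\<integral>z. cmod (R z) \<partial>M) \<le> (\<integral>z. min ((s * D k z)\<^sup>2) (\<bar>s * D k z\<bar> ^ 3) \<partial>M)"
        using Ri mi Rb by (intro integral_mono) auto
      then show ?thesis using Pbnd[OF Ri, of k] lind[of k] by linarith
    qed
    have b2: "cmod (\<integral>z. P k z * G z \<partial>M) \<le> \<epsilon>" using cob[of k] by (simp add: P_def G_def)
    have b3: "cmod (\<kappa> * (\<integral>z. P k z \<partial>M)) \<le> (s\<^sup>2 * v)\<^sup>2"
    proof -
      have "\<bar>\<kappa>\<bar> \<le> (s\<^sup>2 * v / 2)\<^sup>2"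
        unfolding \<kappa>_def c_def using v0 by (intro one_minus_le_exp_remainder) auto
      also have "\<dots> \<le> (s\<^sup>2 * v)\<^sup>2" using v0 by (intro power_mono) auto
      finally have "\<bar>\<kappa>\<bar> \<le> (s\<^sup>2 * v)\<^sup>2" .
      moreover have "cmod (\<integral>z. P k z \<partial>M) \<le> 1"
        using Pbnd[of "\<lambda>_. 1" k] by (simp add: prob_space)
      ultimately have "\<bar>\<kappa>\<bar> * cmod (\<integral>z. P k z \<partial>M) \<le> (s\<^sup>2 * v)\<^sup>2 * 1" by (intro mult_mono) auto
      then show ?thesis by (simp add: norm_mult)
    qed
    \<comment> \<open>\<open>W\<close> is at least of first order in \<open>s\<close>, so after the
      factor \<open>s^2 / 2\<close> it vanishes in the limit even when multiplied by a number of
      steps of order \<open>1 / s^2\<close>.\<close>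
    have b4: "cmod (\<integral>z. P k z * W z \<partial>M) \<le> \<bar>s\<bar> * sqrt v * C + s\<^sup>2 * v * C"
    proof -
      have "(\<integral>z. cmod (W z) \<partial>M) \<le> (\<integral>z. \<bar>s\<bar> * \<bar>D k z * \<Phi> (Suc k) z\<bar> + (1 - c) * \<bar>\<Phi> k z\<bar> \<partial>M)"
        using Wi Wdom Wb by (intro integral_mono) auto
      also have "\<dots> = \<bar>s\<bar> * (\<integral>z. \<bar>D k z * \<Phi> (Suc k) z\<bar> \<partial>M) + (1 - c) * (\<integral>z. \<bar>\<Phi> k z\<bar> \<partial>M)"
        using D\<Phi>i \<Phi>i by simp
      also have "\<dots> \<le> \<bar>s\<bar> * (sqrt v * C) + (s\<^sup>2 * v) * C"
      proof (intro add_mono mult_mono \<Phi>L1)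
        have "(\<integral>z. \<bar>D k z * \<Phi> (Suc k) z\<bar> \<partial>M) \<le> sqrt v * sqrt (sq_norm M (\<Phi> (Suc k)))"
          using integral_Cauchy_Schwarz[OF D(1)[of k] \<Phi>(1)[of "Suc k"]] by (simp add: D(2))
        also have "\<dots> \<le> sqrt v * C" using v0 by (intro mult_left_mono \<Phi>L2) auto
        finally show "(\<integral>z. \<bar>D k z * \<Phi> (Suc k) z\<bar> \<partial>M) \<le> sqrt v * C" .
        have "1 - s\<^sup>2 * v / 2 \<le> c" unfolding c_def using exp_ge_add_one_self[of "- (s\<^sup>2 * v / 2)"] by simp
        moreover have "0 \<le> s\<^sup>2 * v" using v0 by simp
        ultimately show "1 - c \<le> s\<^sup>2 * v" by linarith
      qed (use v0 in auto)
      finally show ?thesis using Pbnd[OF Wi, of k] by (simp add: mult.assoc)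
    qed
    have n3: "cmod (a - t * b + d - t * e) \<le> cmod a + t * cmod b + cmod d + t * cmod e" if "0 \<le> t" for a b d e :: complex and t :: real
      using norm_triangle_ineq4[of "a - t * b + d" "t * e"] norm_triangle_ineq[of "a - t * b" d] norm_triangle_ineq4[of a "t * b"] that
      by (simp add: norm_mult)
    have "cmod (A (Suc k) - c * A k) \<le> cmod (\<integral>z. P k z * R z \<partial>M) + s\<^sup>2 / 2 * cmod (\<integral>z. P k z * G z \<partial>M)
        + cmod (\<kappa> * (\<integral>z. P k z \<partial>M)) + s\<^sup>2 / 2 * cmod (\<integral>z. P k z * W z \<partial>M)"
      unfolding eq using n3[of "s\<^sup>2 / 2"] by simp
    also have "\<dots> \<le> \<delta> + s\<^sup>2 / 2 * \<epsilon> + (s\<^sup>2 * v)\<^sup>2 + s\<^sup>2 / 2 * (\<bar>s\<bar> * sqrt v * C + s\<^sup>2 * v * C)"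
      by (intro add_mono mult_left_mono b1 b2 b3 b4) auto
    finally show ?thesis by (simp add: \<eta>_def algebra_simps)
  qed
  have "cmod (A n - c ^ n * A 0) \<le> real n * \<eta>" using linear_recursion_error[of c A \<eta> n] c step by simp
  moreover have "cmod (c ^ n * A 0 - c ^ n) \<le> s\<^sup>2 / 2 * C"
  proof -
    have "cmod (A 0 - 1) \<le> s\<^sup>2 / 2 * C" using A_near[of 0] by (simp add: P0 prob_space)
    moreover have "c ^ n \<le> 1" using c by (simp add: power_le_one)
    ultimately have "c ^ n * cmod (A 0 - 1) \<le> 1 * (s\<^sup>2 / 2 * C)" using c by (intro mult_mono) auto
    moreover have "complex_of_real c ^ n * A 0 - c ^ n = c ^ n * (A 0 - 1)" by (simp add: algebra_simps)
    ultimately show ?thesis using c by (simp add: norm_mult norm_power)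
  qed
  moreover have "cmod ((\<integral>z. P n z \<partial>M) - c ^ n) \<le>
    cmod (A n - (\<integral>z. P n z \<partial>M)) + cmod (A n - c ^ n * A 0) + cmod (c ^ n * A 0 - c ^ n)"
  proof -
    have "(\<integral>z. P n z \<partial>M) - c ^ n = - (A n - (\<integral>z. P n z \<partial>M)) + (A n - c ^ n * A 0) + (c ^ n * A 0 - c ^ n)"
      by simp
    moreover have "cmod (- a + b + d) \<le> cmod a + cmod b + cmod d" for a b d :: complex
      using norm_triangle_ineq[of "- a + b" d] norm_triangle_ineq[of "- a" b] by simp
    ultimately show ?thesis by metis
  qed
  ultimately have "cmod ((\<integral>z. P n z \<partial>M) - c ^ n) \<le> s\<^sup>2 / 2 * C + real n * \<eta> + s\<^sup>2 / 2 * C"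
    using A_near[of n] by linarith
  then show ?thesis unfolding \<eta>_def c_def P_def by (simp add: mult.commute add.commute)
qed

text \<open>Both branches of \<open>normal_law\<close> obey one formula, so a degenerate limit needs
  no separate treatment later.\<close>

lemma char_normal_law:
  assumes "0 \<le> s2"
  shows "real_distribution (normal_law s2)" "char (normal_law s2) t = complex_of_real (exp (- (t\<^sup>2 * s2 / 2)))"
proof -
  have "real_distribution (normal_law s2) \<and> char (normal_law s2) t = complex_of_real (exp (- (t\<^sup>2 * s2 / 2)))"
  proof (cases "s2 > 0")
    case True
    define \<sigma> where "\<sigma> = sqrt s2"
    have \<sigma>: "0 < \<sigma>" "\<sigma>\<^sup>2 = s2" using True by (auto simp: \<sigma>_def)
    define N where "N = density lborel (normal_density 0 \<sigma>)"
    have law: "normal_law s2 = N" using True by (simp add: normal_law_def N_def \<sigma>_def)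
    interpret N: prob_space N unfolding N_def by (rule prob_space_normal_density[OF \<sigma>(1)])
    have sN [measurable_cong]: "sets N = sets borel" by (simp add: N_def)
    have rd: "real_distribution N"
      using N.prob_space_axioms sets_eq_imp_space_eq[OF sN] sN by (auto simp: real_distribution_def real_distribution_axioms_def)
    have "distr N lborel (\<lambda>x. x) = N" by (rule distr_id2) (simp add: sN)
    then have "distributed N lborel (\<lambda>x. x) (normal_density 0 \<sigma>)"
      by (auto simp: distributed_def N_def)
    then have "distributed N lborel (\<lambda>x. (x - 0) / \<sigma>) std_normal_density"
      by (simp add: N.normal_standard_normal_convert[OF \<sigma>(1)])
    then have std: "distr N lborel (\<lambda>x. x / \<sigma>) = std_normal_distribution"
      by (simp add: distributed_def)
    have "char N t = (\<integral>x. iexp ((t * \<sigma>) * (x / \<sigma>)) \<partial>N)"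
      using \<sigma> by (simp add: char_def)
    also have "\<dots> = (\<integral>y. iexp ((t * \<sigma>) * y) \<partial>distr N lborel (\<lambda>x. x / \<sigma>))"
      by (rule integral_distr[symmetric]) auto
    also have "\<dots> = char std_normal_distribution (t * \<sigma>)" by (simp add: std char_def)
    also have "\<dots> = complex_of_real (exp (- (t\<^sup>2 * s2 / 2)))"
      by (simp add: char_std_normal_distribution power_mult_distrib \<sigma>)
    finally show ?thesis using rd law by simp
  next
    case False
    then have "s2 = 0" using assms by simp
    interpret R: prob_space "return borel (0::real)" by (rule prob_space_return) simp
    have "real_distribution (return borel (0::real))"
      using R.prob_space_axioms by (auto simp: real_distribution_def real_distribution_axioms_def)
    moreover have "char (return borel 0) t = 1"
      by (simp add: char_def integral_return)
    ultimately show ?thesis using \<open>s2 = 0\<close> by (simp add: normal_law_def)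
  qed
  then show "real_distribution (normal_law s2)" "char (normal_law s2) t = complex_of_real (exp (- (t\<^sup>2 * s2 / 2)))" by auto
qed

text \<open>This carries limits of characteristic functions over to variables close in
  \<open>L2\<close>; the reason is that \<open>\<lambda>x. iexp (s * x)\<close> is Lipschitz with
  constant \<open>\<bar>s\<bar>\<close>.\<close>

lemma (in prob_space) char_diff_le_L2:
  assumes X: "sq_integrable M X" and Y: "sq_integrable M Y"
  shows "cmod ((\<integral>z. iexp (s * X z) \<partial>M) - (\<integral>z. iexp (s * Y z) \<partial>M)) \<le> \<bar>s\<bar> * sqrt (\<integral>z. (X z - Y z)\<^sup>2 \<partial>M)"
proof -
  note [measurable] = sq_integrable_measurable[OF X] sq_integrable_measurable[OF Y]
  have i: "integrable M (\<lambda>z. iexp (s * X z))" "integrable M (\<lambda>z. iexp (s * Y z))"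
    by (auto intro!: integrable_const_bound[where B = 1])
  note D = sq_integrable_diff[OF X Y]
  have "cmod ((\<integral>z. iexp (s * X z) \<partial>M) - (\<integral>z. iexp (s * Y z) \<partial>M)) = cmod (\<integral>z. iexp (s * X z) - iexp (s * Y z) \<partial>M)"
    using i by simp
  also have "\<dots> \<le> (\<integral>z. cmod (iexp (s * X z) - iexp (s * Y z)) \<partial>M)" by (rule integral_norm_bound)
  also have "\<dots> \<le> (\<integral>z. \<bar>s\<bar> * \<bar>X z - Y z\<bar> \<partial>M)"
  proof (intro integral_mono)
    show "integrable M (\<lambda>z. cmod (iexp (s * X z) - iexp (s * Y z)))" using i by auto
    show "integrable M (\<lambda>z. \<bar>s\<bar> * \<bar>X z - Y z\<bar>)" using sq_integrable_integrable[OF D] by auto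
    show "cmod (iexp (s * X z) - iexp (s * Y z)) \<le> \<bar>s\<bar> * \<bar>X z - Y z\<bar>" for z
      using norm_iexp_diff_le[of "s * X z" "s * Y z"] by (simp add: abs_mult[symmetric] right_diff_distrib)
  qed
  also have "\<dots> = \<bar>s\<bar> * (\<integral>z. \<bar>X z - Y z\<bar> \<partial>M)" by (rule integral_mult_right_zero)
  also have "\<dots> \<le> \<bar>s\<bar> * sqrt (\<integral>z. (X z - Y z)\<^sup>2 \<partial>M)" by (intro mult_left_mono integral_abs_le_L2 D) simp
  finally show ?thesis .
qed

lemma const_over_sqrt_tendsto_0: "(\<lambda>n. t / sqrt (real n)) \<longlonglongrightarrow> 0"
  by (intro tendsto_divide_0[OF tendsto_const] filterlim_at_top_imp_at_infinity
      filterlim_compose[OF sqrt_at_top filterlim_real_sequentially])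

text \<open>Dominated convergence under a second moment only: the square in the minimum supplies the
  dominating function \<open>(t * X)^2\<close>, the cube the pointwise decay of order
  \<open>1 / sqrt n\<close>.\<close>

lemma (in prob_space) Lindeberg_term_tendsto_0:
  assumes X: "sq_integrable M X"
  shows "(\<lambda>n. real n * (\<integral>z. min ((t / sqrt (real n) * X z)\<^sup>2) (\<bar>t / sqrt (real n) * X z\<bar> ^ 3) \<partial>M)) \<longlonglongrightarrow> 0"
proof -
  note [measurable] = sq_integrable_measurable[OF X]
  define w where "w n z = real n * min ((t / sqrt (real n) * X z)\<^sup>2) (\<bar>t / sqrt (real n) * X z\<bar> ^ 3)" for n :: nat and z
  have w0: "0 \<le> w n z" for n z by (simp add: w_def)
  have w1: "w n z \<le> (t * X z)\<^sup>2" for n z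
  proof (cases "n = 0")
    case False
    have "w n z \<le> real n * (t / sqrt (real n) * X z)\<^sup>2" unfolding w_def by (intro mult_left_mono) auto
    also have "\<dots> = (t * X z)\<^sup>2" using False by (simp add: power_mult_distrib power_divide)
    finally show ?thesis .
  qed (simp add: w_def)
  have w2: "w n z \<le> \<bar>t * X z\<bar> ^ 3 / sqrt (real n)" for n z
  proof (cases "n = 0")
    case False
    have "w n z \<le> real n * \<bar>t / sqrt (real n) * X z\<bar> ^ 3" unfolding w_def by (intro mult_left_mono) auto
    also have "\<bar>t / sqrt (real n) * X z\<bar> ^ 3 = \<bar>t * X z\<bar> ^ 3 / (real n * sqrt (real n))"
      using False by (simp add: abs_mult abs_divide power_mult_distrib power_divide power3_eq_cube)
    finally show ?thesis using False by simp
  qed (simp add: w_def)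
  have "(\<lambda>n. \<integral>z. w n z \<partial>M) \<longlonglongrightarrow> (\<integral>z. 0 \<partial>M)"
  proof (rule integral_dominated_convergence[where w = "\<lambda>z. (t * X z)\<^sup>2"])
    show "integrable M (\<lambda>z. (t * X z)\<^sup>2)" using sq_integrable_cmult[OF X, of t] by (simp add: sq_integrable_def)
    show "AE z in M. norm (w n z) \<le> (t * X z)\<^sup>2" for n using w0 w1 by simp
    show "AE z in M. (\<lambda>n. w n z) \<longlonglongrightarrow> 0"
    proof (rule AE_I2)
      fix z
      show "(\<lambda>n. w n z) \<longlonglongrightarrow> 0"
        by (rule real_tendsto_sandwich[OF _ _ tendsto_const const_over_sqrt_tendsto_0[of "\<bar>t * X z\<bar> ^ 3"]])
           (use w0 w2 in auto)
    qed
    show "w n \<in> borel_measurable M" for n unfolding w_def by measurable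
  qed simp
  then show ?thesis unfolding w_def by simp
qed

section \<open>Conditional expectations\<close>

lemma (in finite_measure_subalgebra) sq_integrable_cond_exp:
  assumes "sq_integrable M X"
  shows "sq_integrable M (real_cond_exp M F X)"
proof -
  have "integrable M (\<lambda>x. (real_cond_exp M F X x)\<^sup>2)"
    using assms sq_integrable_integrable[OF assms] convex_power2 emeasure_finite
    by (intro integrable_convex_cond_exp[where X = X and I = UNIV and q = "\<lambda>x. x\<^sup>2"]) (auto simp: sq_integrable_def)
  then show ?thesis by (simp add: sq_integrable_def)
qed

lemma (in finite_measure_subalgebra) cond_exp_L2_inner:
  assumes X: "sq_integrable M X" and Z: "sq_integrable M Z" "Z \<in> borel_measurable F"
  shows "(\<integral>x. Z x * real_cond_exp M F X x \<partial>M) = (\<integral>x. Z x * X x \<partial>M)"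
  using Z X sq_integrable_mult[OF Z(1) X] by (intro real_cond_exp_intg) (auto simp: sq_integrable_def)

lemma (in finite_measure_subalgebra) cond_exp_pythagoras:
  assumes X: "sq_integrable M X"
  shows "(\<integral>x. (X x - real_cond_exp M F X x)\<^sup>2 \<partial>M) = sq_norm M X - sq_norm M (real_cond_exp M F X)"
proof -
  note E = sq_integrable_cond_exp[OF X]
  have "(\<integral>x. X x * real_cond_exp M F X x \<partial>M) = sq_norm M (real_cond_exp M F X)"
    using cond_exp_L2_inner[OF X E] by (simp add: power2_eq_square mult.commute)
  then show ?thesis using integral_square_diff[OF X E] by simp
qed

lemma (in finite_measure_subalgebra) cond_exp_L2_contraction:
  assumes X: "sq_integrable M X"
  shows "sq_norm M (real_cond_exp M F X) \<le> sq_norm M X"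
proof -
  have "0 \<le> (\<integral>x. (X x - real_cond_exp M F X x)\<^sup>2 \<partial>M)" by simp
  then show ?thesis using cond_exp_pythagoras[OF X] by linarith
qed

text \<open>The sets on which both integrals agree form a Dynkin system. Membership of the whole
  space in \<open>P\<close> provides the total integrals needed for complements.\<close>

lemma (in finite_measure_subalgebra) real_cond_exp_charact_generator:
  assumes sets: "sets F = sigma_sets (space M) P" and Int: "Int_stable P" and P: "P \<subseteq> Pow (space M)" "space M \<in> P"
    and f: "integrable M f" and g: "integrable M g" "g \<in> borel_measurable F"
    and eq: "\<And>A. A \<in> P \<Longrightarrow> (\<integral>x. indicator A x * f x \<partial>M) = (\<integral>x. indicator A x * g x \<partial>M)"
  shows "AE x in M. real_cond_exp M F f x = g x"
proof (rule real_cond_exp_charact[OF _ f g])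
  fix A assume "A \<in> sets F"
  have FM: "A \<in> sets M" if "A \<in> sigma_sets (space M) P" for A
    using that subalg sets by (auto simp: subalgebra_def)
  have ind: "integrable M (\<lambda>x. indicator A x * u x)" if "A \<in> sigma_sets (space M) P" "integrable M u" for A and u :: "'a \<Rightarrow> real"
    using integrable_mult_indicator[OF FM[OF that(1)] that(2)] by simp
  have "A \<in> sigma_sets (space M) P" using \<open>A \<in> sets F\<close> sets by simp
  with Int P(1) have "(\<integral>x. indicator A x * f x \<partial>M) = (\<integral>x. indicator A x * g x \<partial>M)"
  proof (induction rule: sigma_sets_induct_disjoint)
    case (basic A)
    then show ?case by (rule eq)
  next
    case empty
    then show ?case by simp
  next
    case (compl A)
    have "(\<integral>x. indicator (space M - A) x * u x \<partial>M) = (\<integral>x. indicator (space M) x * u x \<partial>M) - (\<integral>x. indicator A x * u x \<partial>M)"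
      if u: "integrable M u" for u :: "'a \<Rightarrow> real"
    proof -
      have "A \<subseteq> space M" using FM[OF compl(1)] by (rule sets.sets_into_space)
      then have "(\<integral>x. indicator (space M - A) x * u x \<partial>M) = (\<integral>x. indicator (space M) x * u x - indicator A x * u x \<partial>M)"
        by (intro Bochner_Integration.integral_cong) (auto simp: indicator_def)
      also have "\<dots> = (\<integral>x. indicator (space M) x * u x \<partial>M) - (\<integral>x. indicator A x * u x \<partial>M)"
        using compl(1) u P(2) by (intro Bochner_Integration.integral_diff ind) (auto intro: sigma_sets.Basic)
      finally show ?thesis .
    qed
    then show ?case using compl(2) eq[OF P(2)] f g by simp
  next
    case (union A)
    have "(\<integral>x. indicator (\<Union>i. A i) x * u x \<partial>M) = (\<Sum>i. \<integral>x. indicator (A i) x * u x \<partial>M)"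
      if u: "integrable M u" for u :: "'a \<Rightarrow> real"
    proof -
      have "\<Union> (range A) \<in> sigma_sets (space M) P" using union(2) by (auto intro: sigma_sets.Union)
      then have "set_integrable M (\<Union>i. A i) u" using ind[OF _ u] by (simp add: set_integrable_def)
      then have "(LINT x:(\<Union>i. A i)|M. u x) = (\<Sum>i. LINT x:A i|M. u x)"
        using union(1) FM[OF subsetD[OF union(2) rangeI]] by (intro lebesgue_integral_countable_add) (auto simp: disjoint_family_on_def)
      then show ?thesis by (simp add: set_lebesgue_integral_def)
    qed
    from this[OF f] this[OF g(1)] show ?case using union(3) by simp
  qed
  then show "(\<integral>x\<in>A. f x \<partial>M) = (\<integral>x\<in>A. g x \<partial>M)" by (simp add: set_lebesgue_integral_def)
qed

text \<open>The right-hand side depends on \<open>T\<close> only through its law and the final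
  evaluation. Maps with equal laws thus share one factor function, which is how stationarity reaches
  conditional expectations.\<close>

lemma (in finite_measure_subalgebra) real_cond_exp_distr:
  assumes T: "T \<in> M \<rightarrow>\<^sub>M N" and H: "subalgebra N H"
    and F: "sets F = {T -` A \<inter> space M | A. A \<in> sets H}"
    and B: "integrable (distr M N T) B"
  shows "AE x in M. real_cond_exp M F (\<lambda>x. B (T x)) x = real_cond_exp (distr M N T) H B (T x)"
proof -
  have HN: "A \<in> sets N" if "A \<in> sets H" for A using H that by (auto simp: subalgebra_def)
  interpret N: finite_measure_subalgebra "distr M N T" H
    using H finite_measure_distr[OF T] unfolding finite_measure_subalgebra_def finite_measure_subalgebra_axioms_def
    by (simp add: subalgebra_def)
  let ?e = "real_cond_exp (distr M N T) H B"
  have TH: "T \<in> F \<rightarrow>\<^sub>M H"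
  proof (rule measurableI)
    fix x assume "x \<in> space F"
    then show "T x \<in> space H" using T H subalg by (auto simp: subalgebra_def dest: measurable_space)
  next
    fix A assume "A \<in> sets H"
    then show "T -` A \<inter> space F \<in> sets F" using F subalg by (auto simp: subalgebra_def)
  qed
  have Bm: "B \<in> borel_measurable N" using borel_measurable_integrable[OF B] by simp
  have em: "?e \<in> borel_measurable H" by simp
  have eN: "?e \<in> borel_measurable N" using measurable_from_subalg[OF H em] .
  have eint: "integrable (distr M N T) ?e" by (rule N.real_cond_exp_int(1)[OF B])
  show ?thesis
  proof (rule real_cond_exp_charact)
    show "integrable M (\<lambda>x. B (T x))" using B integrable_distr_eq[OF T Bm] by simp
    show "integrable M (\<lambda>x. ?e (T x))" using eint integrable_distr_eq[OF T eN] by simp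
    show "(\<lambda>x. ?e (T x)) \<in> borel_measurable F" by (rule measurable_compose[OF TH em])
    fix A' assume "A' \<in> sets F"
    then obtain A where A: "A \<in> sets H" "A' = T -` A \<inter> space M" using F by auto
    have *: "(\<integral>x\<in>A'. u (T x) \<partial>M) = (\<integral>y\<in>A. u y \<partial>distr M N T)" if u: "u \<in> borel_measurable N" for u :: "'b \<Rightarrow> real"
    proof -
      have "(\<integral>y\<in>A. u y \<partial>distr M N T) = (\<integral>x. indicator A (T x) *\<^sub>R u (T x) \<partial>M)"
        unfolding set_lebesgue_integral_def using u HN[OF A(1)] by (intro integral_distr[OF T]) simp
      also have "\<dots> = (\<integral>x\<in>A'. u (T x) \<partial>M)"
        unfolding set_lebesgue_integral_def by (intro Bochner_Integration.integral_cong) (auto simp: A indicator_def)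
      finally show ?thesis by simp
    qed
    show "(\<integral>x\<in>A'. B (T x) \<partial>M) = (\<integral>x\<in>A'. ?e (T x) \<partial>M)"
      using *[OF Bm] *[OF eN] N.real_cond_exp_intA[OF B A(1)] by simp
  qed
qed

section \<open>Stationary Markov chains\<close>

lemma (in finite_measure) integrable_mult_AE_bounded:
  fixes X Y :: "'a \<Rightarrow> real"
  assumes "integrable M X" "Y \<in> borel_measurable M" "AE x in M. \<bar>Y x\<bar> \<le> 1"
  shows "integrable M (\<lambda>x. X x * Y x)"
proof (rule Bochner_Integration.integrable_bound[OF assms(1)])
  show "AE x in M. norm (X x * Y x) \<le> norm (X x)"
    using assms(3) by eventually_elim (simp add: abs_mult mult_left_le)
qed (use assms in auto)

locale stationary_chain =
  fixes M :: "'a measure" and S :: "'s measure" and \<xi> :: "int \<Rightarrow> 'a \<Rightarrow> 's" and Q :: "'s \<Rightarrow> 's measure"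
  assumes chain: "stationary_markov_chain M S \<xi> Q"

sublocale stationary_chain \<subseteq> prob_space M
  using chain by (simp add: stationary_markov_chain_def)

context stationary_chain
begin

abbreviation F :: "int set \<Rightarrow> 'a measure" where "F K \<equiv> gen_sigma M S \<xi> K"
abbreviation E :: "int set \<Rightarrow> ('a \<Rightarrow> real) \<Rightarrow> 'a \<Rightarrow> real" where "E K X \<equiv> real_cond_exp M (F K) X"

lemma chain_measurable [measurable]: "\<xi> n \<in> M \<rightarrow>\<^sub>M S"
  and kernel_measurable [measurable]: "Q \<in> S \<rightarrow>\<^sub>M prob_algebra S"
  and one_step: "A \<in> sets S \<Longrightarrow> AE z in M. E {..n} (indicator (\<xi> (n + 1) -` A \<inter> space M)) z = measure (Q (\<xi> n z)) A"
  and stationary: "finite J \<Longrightarrow> distr M (Pi\<^sub>M J (\<lambda>_. S)) (\<lambda>z. \<lambda>j\<in>J. \<xi> (j + h) z) =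
        distr M (Pi\<^sub>M J (\<lambda>_. S)) (\<lambda>z. \<lambda>j\<in>J. \<xi> j z)"
  using chain by (auto simp: stationary_markov_chain_def)

section \<open>Sigma-algebras generated by sets of times\<close>

lemma gen_sigma_Pow: "(\<Union>k\<in>K. {\<xi> k -` A \<inter> space M | A. A \<in> sets S}) \<subseteq> Pow (space M)"
  by auto

lemma space_F [simp]: "space (F K) = space M"
  using gen_sigma_Pow[of K] by (simp add: gen_sigma_def)

lemma sets_F: "sets (F K) = sigma_sets (space M) (\<Union>k\<in>K. {\<xi> k -` A \<inter> space M | A. A \<in> sets S})"
  using gen_sigma_Pow[of K] by (simp add: gen_sigma_def)

lemma subalgebra_F: "subalgebra M (F K)"
proof -
  have "sigma_sets (space M) (\<Union>k\<in>K. {\<xi> k -` A \<inter> space M | A. A \<in> sets S}) \<subseteq> sets M"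
    by (rule sets.sigma_sets_subset) auto
  then show ?thesis by (simp add: subalgebra_def sets_F)
qed

lemma sets_F_mono: "K \<subseteq> L \<Longrightarrow> sets (F K) \<subseteq> sets (F L)"
  unfolding sets_F by (rule sigma_sets_mono') auto

lemma sets_F_M: "A \<in> sets (F K) \<Longrightarrow> A \<in> sets M"
  using subalgebra_F[of K] by (auto simp: subalgebra_def)

lemma subalgebra_F_mono: "K \<subseteq> L \<Longrightarrow> subalgebra (F L) (F K)"
  using sets_F_mono by (simp add: subalgebra_def)

lemma measurable_F_mono: "X \<in> F K \<rightarrow>\<^sub>M N \<Longrightarrow> K \<subseteq> L \<Longrightarrow> X \<in> F L \<rightarrow>\<^sub>M N"
  using measurable_from_subalg subalgebra_F_mono by blast

lemma measurable_F_M: "X \<in> F K \<rightarrow>\<^sub>M N \<Longrightarrow> X \<in> M \<rightarrow>\<^sub>M N"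
  using measurable_from_subalg subalgebra_F by blast

lemma vimage_in_F: "k \<in> K \<Longrightarrow> A \<in> sets S \<Longrightarrow> \<xi> k -` A \<inter> space M \<in> sets (F K)"
  unfolding sets_F by (rule sigma_sets.Basic) auto

lemma chain_measurable_F: "k \<in> K \<Longrightarrow> \<xi> k \<in> F K \<rightarrow>\<^sub>M S"
  using measurable_space[OF chain_measurable] vimage_in_F by (intro measurableI) auto

lemma finite_measure_subalgebra_F: "finite_measure_subalgebra M (F K)"
  using subalgebra_F by unfold_locales

interpretation F: finite_measure_subalgebra M "F K" for K
  by (rule finite_measure_subalgebra_F)

lemma sets_F_singleton: "sets (F {k}) = {\<xi> k -` A \<inter> space M | A. A \<in> sets S}"
proof -
  have "sets (F {k}) = sets (vimage_algebra (space M) (\<xi> k) S)"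
    by (auto simp: sets_F sets_vimage_algebra)
  also have "\<dots> = {\<xi> k -` A \<inter> space M | A. A \<in> sets S}"
    by (rule sets_vimage_algebra2) (use measurable_space[OF chain_measurable] in auto)
  finally show ?thesis .
qed

text \<open>Rectangles are intersection stable, whereas the defining generators of
  \<open>F (K \<union> L)\<close> need not be. Conditioning on two groups of times can thereby be
  tested on products of one indicator from each.\<close>

lemma sets_F_Un:
  "sets (F (K \<union> L)) = sigma_sets (space M) {A \<inter> B | A B. A \<in> sets (F K) \<and> B \<in> sets (F L)}" (is "_ = sigma_sets _ ?P")
proof
  have top: "space M \<in> sets (F K)" for K using sets.top[of "F K"] by simp
  have "C \<in> ?P" if C: "C \<in> (\<Union>k\<in>K \<union> L. {\<xi> k -` A \<inter> space M | A. A \<in> sets S})" for C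
  proof -
    from C obtain k A where k: "k \<in> K \<union> L" "A \<in> sets S" "C = \<xi> k -` A \<inter> space M" by auto
    show ?thesis
    proof (cases "k \<in> K")
      case True
      then have "C = C \<inter> space M" "C \<in> sets (F K)" using k vimage_in_F by auto
      then show ?thesis using top by blast
    next
      case False
      then have "C = space M \<inter> C" "C \<in> sets (F L)" using k vimage_in_F by auto
      then show ?thesis using top by blast
    qed
  qed
  then show "sets (F (K \<union> L)) \<subseteq> sigma_sets (space M) ?P"
    unfolding sets_F[of "K \<union> L"] by (intro sigma_sets_mono' subsetI)
  have "?P \<subseteq> sets (F (K \<union> L))"
  proof
    fix C assume "C \<in> ?P"
    then obtain A B where C: "C = A \<inter> B" "A \<in> sets (F K)" "B \<in> sets (F L)" by blast
    have "A \<in> sets (F (K \<union> L))" "B \<in> sets (F (K \<union> L))"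
      using C sets_F_mono[of K "K \<union> L"] sets_F_mono[of L "K \<union> L"] by auto
    then show "C \<in> sets (F (K \<union> L))" by (simp add: C)
  qed
  then show "sigma_sets (space M) ?P \<subseteq> sets (F (K \<union> L))"
    using sets.sigma_sets_subset[of ?P "F (K \<union> L)"] by simp
qed

lemma E_charact_Un:
  assumes f: "integrable M f" and g: "integrable M g" "g \<in> borel_measurable (F (K \<union> L))"
    and eq: "\<And>A B. A \<in> sets (F K) \<Longrightarrow> B \<in> sets (F L) \<Longrightarrow>
      (\<integral>x. indicator A x * indicator B x * f x \<partial>M) = (\<integral>x. indicator A x * indicator B x * g x \<partial>M)"
  shows "AE x in M. E (K \<union> L) f x = g x"
proof (rule F.real_cond_exp_charact_generator[OF sets_F_Un _ _ _ f g])
  let ?P = "{A \<inter> B | A B. A \<in> sets (F K) \<and> B \<in> sets (F L)}"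
  show "Int_stable ?P"
  proof (rule Int_stableI)
    fix C C' assume "C \<in> ?P" "C' \<in> ?P"
    then obtain A B A' B' where "C = A \<inter> B" "A \<in> sets (F K)" "B \<in> sets (F L)"
      "C' = A' \<inter> B'" "A' \<in> sets (F K)" "B' \<in> sets (F L)" by blast
    then have "C \<inter> C' = (A \<inter> A') \<inter> (B \<inter> B')" "A \<inter> A' \<in> sets (F K)" "B \<inter> B' \<in> sets (F L)" by auto
    then show "C \<inter> C' \<in> ?P" by blast
  qed
  show "?P \<subseteq> Pow (space M)" using sets.sets_into_space[of _ "F K"] by auto
  have "space M = space M \<inter> space M" by simp
  then show "space M \<in> ?P" using sets.top[of "F K"] sets.top[of "F L"] by fastforce
  fix C assume "C \<in> ?P"
  then obtain A B where "C = A \<inter> B" "A \<in> sets (F K)" "B \<in> sets (F L)" by blast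
  then show "(\<integral>x. indicator C x * f x \<partial>M) = (\<integral>x. indicator C x * g x \<partial>M)"
    using eq[of A B] by (simp add: indicator_inter_arith)
qed

lemma integrable_indicator': "A \<in> sets M \<Longrightarrow> integrable M (indicator A :: 'a \<Rightarrow> real)"
  by (simp add: less_top[symmetric])

lemma E_indicator_bounded:
  assumes "A \<in> sets M" shows "AE x in M. \<bar>E K (indicator A) x\<bar> \<le> 1"
proof -
  have "AE x in M. 0 \<le> E K (indicator A) x"
    using integrable_indicator'[OF assms] by (intro F.real_cond_exp_ge_c) auto
  moreover have "AE x in M. E K (indicator A) x \<le> 1"
    using integrable_indicator'[OF assms] by (intro F.real_cond_exp_le_c) (auto simp: indicator_def)
  ultimately show ?thesis by eventually_elim auto
qed

lemma E_measurable [measurable]: "E K X \<in> borel_measurable (F K)" "E K X \<in> borel_measurable M"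
  by auto

lemma integral_mult_E_eq:
  assumes "integrable M (\<lambda>x. Z x * X x)" "Z \<in> borel_measurable (F K)" "X \<in> borel_measurable M"
    "AE x in M. E K X x = Y x" "Y \<in> borel_measurable M"
  shows "(\<integral>x. Z x * X x \<partial>M) = (\<integral>x. Z x * Y x \<partial>M)"
proof -
  have [measurable]: "Z \<in> borel_measurable M" "Y \<in> borel_measurable M"
    using assms(2,5) measurable_F_M by auto
  have "(\<integral>x. Z x * X x \<partial>M) = (\<integral>x. Z x * E K X x \<partial>M)"
    using F.real_cond_exp_intg(2)[OF assms(1-3)] by simp
  also have "\<dots> = (\<integral>x. Z x * Y x \<partial>M)"
    using assms(4) by (intro integral_cong_AE) auto
  finally show ?thesis .
qed

section \<open>Two-sided Markov property\<close>

lemma kernel_eval_measurable: "A \<in> sets S \<Longrightarrow> (\<lambda>x. measure (Q x) A) \<in> borel_measurable S"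
  unfolding measure_def
  using measurable_compose[OF measurable_prob_algebraD[OF kernel_measurable] measurable_emeasure_subprob_algebra]
  by measurable

lemma kernel_prob_space: "x \<in> space S \<Longrightarrow> prob_space (Q x)"
  using measurable_space[OF kernel_measurable] by (simp add: space_prob_algebra)

lemma integral_one_step:
  assumes Z: "integrable M Z" "Z \<in> borel_measurable (F {..n})" and A: "A \<in> sets S"
  shows "(\<integral>z. Z z * indicator (\<xi> (n + 1) -` A \<inter> space M) z \<partial>M) = (\<integral>z. Z z * measure (Q (\<xi> n z)) A \<partial>M)"
proof (rule integral_mult_E_eq[OF _ Z(2) _ one_step[OF A]])
  show "integrable M (\<lambda>z. Z z * indicator (\<xi> (n + 1) -` A \<inter> space M) z)"
    using A by (intro integrable_mult_AE_bounded Z(1)) (auto simp: indicator_def)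
  show "(\<lambda>z. measure (Q (\<xi> n z)) A) \<in> borel_measurable M"
    by (rule measurable_compose[OF chain_measurable kernel_eval_measurable[OF A]])
qed (use A in auto)

text \<open>Time reversal from the forward transition alone: the event at the newest time is
  replaced by its transition probability \<open>q\<close>, which depends on the shorter window, so
  the induction hypothesis applies; afterwards \<open>q\<close> is turned back into the event. No
  kernel of the reversed chain is constructed.\<close>

lemma past_given_finite_future:
  assumes A: "A \<in> sets (F {..a})"
  shows "AE x in M. E {a..a + int N} (indicator A) x = E {a} (indicator A) x"
proof (induction N)
  case 0
  show ?case by simp
next
  case (Suc N)
  let ?V = "E {a} (indicator A)" and ?n = "a + int N"
  have AM: "A \<in> sets M" using A sets_F_M by blast
  have un: "{a..a + int (Suc N)} = {a..?n} \<union> {?n + 1}" by auto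
  note Ai = integrable_indicator'[OF AM]
  have Vi: "integrable M ?V" by (rule F.real_cond_exp_int(1)[OF Ai])
  have Vm: "?V \<in> borel_measurable (F K)" if "a \<in> K" for K
    using measurable_F_mono[OF E_measurable(1), of "{a}" K] that by simp
  show ?case unfolding un
  proof (rule E_charact_Un[OF Ai Vi])
    show "?V \<in> borel_measurable (F ({a..?n} \<union> {?n + 1}))" by (rule Vm) simp
    fix B C' assume B: "B \<in> sets (F {a..?n})" and C': "C' \<in> sets (F {?n + 1})"
    then obtain C where C: "C \<in> sets S" "C' = \<xi> (?n + 1) -` C \<inter> space M"
      by (auto simp: sets_F_singleton)
    have BM: "B \<in> sets M" using B sets_F_M by blast
    have B': "B \<in> sets (F {..?n})" using B sets_F_mono[of "{a..?n}" "{..?n}"] by auto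
    have A': "A \<in> sets (F {..?n})" using A sets_F_mono[of "{..a}" "{..?n}"] by auto
    have Bm: "(indicator B :: 'a \<Rightarrow> real) \<in> borel_measurable (F {a..?n})"
      "(indicator B :: 'a \<Rightarrow> real) \<in> borel_measurable (F {..?n})"
      "(indicator B :: 'a \<Rightarrow> real) \<in> borel_measurable M"
      using B B' BM by auto
    define q where "q z = measure (Q (\<xi> ?n z)) C" for z
    have q: "q \<in> borel_measurable (F {a..?n})" unfolding q_def
      by (rule measurable_compose[OF chain_measurable_F kernel_eval_measurable[OF C(1)]]) simp
    have qM: "q \<in> borel_measurable M" using measurable_F_M[OF q] .
    have q1: "AE x in M. \<bar>q x\<bar> \<le> 1"
      using kernel_prob_space measurable_space[OF chain_measurable]
      by (intro AE_I2) (auto simp: q_def prob_space.prob_le_1)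
    \<comment> \<open>Used in both directions, for \<open>U\<close> the indicator of
      \<open>A\<close> and for its projection \<open>?V\<close>: both are determined by time
      \<open>?n\<close>, so the one-step law applies to each.\<close>
    have step: "(\<integral>x. indicator B x * indicator C' x * U x \<partial>M) = (\<integral>x. (indicator B x * q x) * U x \<partial>M)"
      if U: "integrable M U" "U \<in> borel_measurable (F {..?n})" for U
    proof -
      have "(\<integral>x. indicator B x * indicator C' x * U x \<partial>M) = (\<integral>x. (U x * indicator B x) * indicator C' x \<partial>M)"
        by (simp add: mult_ac)
      also have "\<dots> = (\<integral>x. (U x * indicator B x) * q x \<partial>M)"
        unfolding C(2) q_def using U Bm C(1)
        by (intro integral_one_step integrable_mult_AE_bounded) (auto split: split_indicator)
      finally show ?thesis by (simp add: mult_ac)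
    qed
    have "(\<integral>x. indicator B x * indicator C' x * indicator A x \<partial>M) = (\<integral>x. (indicator B x * q x) * indicator A x \<partial>M)"
      using A' by (intro step Ai) auto
    also have "\<dots> = (\<integral>x. (indicator B x * q x) * ?V x \<partial>M)"
    proof (rule integral_mult_E_eq[OF _ _ _ Suc.IH])
      have "integrable M (\<lambda>x. indicator B x * q x)"
        using q1 qM BM by (intro integrable_mult_AE_bounded integrable_indicator') auto
      then show "integrable M (\<lambda>x. indicator B x * q x * indicator A x)"
        by (rule integrable_mult_AE_bounded) (use AM in \<open>auto split: split_indicator\<close>)
      show "(\<lambda>x. indicator B x * q x) \<in> borel_measurable (F {a..?n})"
        using Bm(1) q by simp
    qed (use AM in auto)
    also have "\<dots> = (\<integral>x. indicator B x * indicator C' x * ?V x \<partial>M)"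
      using step[OF Vi Vm] by simp
    finally show "(\<integral>x. indicator B x * indicator C' x * indicator A x \<partial>M) = (\<integral>x. indicator B x * indicator C' x * ?V x \<partial>M)" .
  qed
qed

text \<open>Finite future windows are nested, hence the union of their sigma-algebras is an
  intersection-stable generator of the whole future.\<close>

lemma past_given_future:
  assumes A: "A \<in> sets (F {..a})"
  shows "AE x in M. E {a..} (indicator A) x = E {a} (indicator A) x"
proof (rule F.real_cond_exp_charact_generator)
  let ?P = "\<Union>N. sets (F {a..a + int N})"
  have AM: "A \<in> sets M" using A sets_F_M by blast
  show "integrable M (indicator A :: 'a \<Rightarrow> real)" "integrable M (E {a} (indicator A))"
    using integrable_indicator'[OF AM] F.real_cond_exp_int(1) by auto
  show "E {a} (indicator A) \<in> borel_measurable (F {a..})"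
    using measurable_F_mono[OF E_measurable(1), of "{a}" "{a..}"] by simp
  have PF: "?P \<subseteq> sets (F {a..})" using sets_F_mono[of "{a..a + int N}" "{a..}" for N] by auto
  show "sets (F {a..}) = sigma_sets (space M) ?P"
  proof
    show "sigma_sets (space M) ?P \<subseteq> sets (F {a..})"
      using sets.sigma_sets_subset[OF PF] by simp
    have "C \<in> ?P" if "k \<in> {a..}" "C \<in> {\<xi> k -` A \<inter> space M | A. A \<in> sets S}" for k C
    proof -
      have "k \<in> {a..a + int (nat (k - a))}" using that by auto
      then have "C \<in> sets (F {a..a + int (nat (k - a))})" using that(2) vimage_in_F by blast
      then show ?thesis by blast
    qed
    then show "sets (F {a..}) \<subseteq> sigma_sets (space M) ?P"
      unfolding sets_F[of "{a..}"] by (intro sigma_sets_mono') blast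
  qed
  show "Int_stable ?P"
  proof (rule Int_stableI)
    fix B C assume "B \<in> ?P" "C \<in> ?P"
    then obtain N N' where "B \<in> sets (F {a..a + int N})" "C \<in> sets (F {a..a + int N'})" by blast
    then have "B \<in> sets (F {a..a + int (max N N')})" "C \<in> sets (F {a..a + int (max N N')})"
      using sets_F_mono[of "{a..a + int N}" "{a..a + int (max N N')}"]
        sets_F_mono[of "{a..a + int N'}" "{a..a + int (max N N')}"] by auto
    then show "B \<inter> C \<in> ?P" by blast
  qed
  show "?P \<subseteq> Pow (space M)" using sets.sets_into_space[of _ "F K" for K] by fastforce
  show "space M \<in> ?P" using sets.top[of "F {a..a + int 0}"] by (simp only: space_F) blast
  fix B assume "B \<in> ?P"
  then obtain N where B: "B \<in> sets (F {a..a + int N})" by blast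
  show "(\<integral>x. indicator B x * indicator A x \<partial>M) = (\<integral>x. indicator B x * E {a} (indicator A) x \<partial>M)"
    using B sets_F_M[OF B] AM
    by (intro integral_mult_E_eq[OF _ _ _ past_given_finite_future[OF A, of N]] integrable_mult_AE_bounded integrable_indicator')
       (auto simp: indicator_def)
qed

text \<open>Independence of past and future given the present is symmetric: \<open>E {a}\<close> is
  self-adjoint, so it can be moved from the indicator to \<open>W\<close>. This exchanges the roles
  of \<open>K\<close> and \<open>L\<close>.\<close>

lemma E_eq_of_dual_indicators:
  assumes dual: "\<And>A. A \<in> sets (F K) \<Longrightarrow> AE x in M. E L (indicator A) x = E {a} (indicator A) x"
    and a: "a \<in> K" and W: "integrable M W" "W \<in> borel_measurable (F L)"
  shows "AE x in M. E K W x = E {a} W x"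
proof (rule F.real_cond_exp_charact[OF _ W(1) F.real_cond_exp_int(1)[OF W(1)]])
  show "E {a} W \<in> borel_measurable (F K)"
    using measurable_F_mono[OF E_measurable(1), of "{a}" K] a by simp
  fix A assume A: "A \<in> sets (F K)"
  then have AM: "A \<in> sets M" using sets_F_M by blast
  note V1 = E_indicator_bounded[OF AM, of "{a}"]
  have WA: "integrable M (\<lambda>x. W x * indicator A x)"
    using AM by (intro integrable_mult_AE_bounded W) (auto simp: indicator_def)
  have EA: "integrable M (\<lambda>x. E {a} W x * indicator A x)"
    using AM by (intro integrable_mult_AE_bounded F.real_cond_exp_int(1) W) (auto simp: indicator_def)
  have "(\<integral>x. W x * indicator A x \<partial>M) = (\<integral>x. W x * E {a} (indicator A) x \<partial>M)"
    using AM by (intro integral_mult_E_eq[OF WA W(2) _ dual[OF A]]) auto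
  also have "\<dots> = (\<integral>x. E {a} (indicator A) x * W x \<partial>M)" by (simp add: mult.commute)
  also have "\<dots> = (\<integral>x. E {a} (indicator A) x * E {a} W x \<partial>M)"
    using integrable_mult_AE_bounded[OF W(1) _ V1] W(1)
    by (intro F.real_cond_exp_intg(2)[symmetric]) (auto simp: mult.commute)
  also have "\<dots> = (\<integral>x. E {a} W x * E {a} (indicator A) x \<partial>M)" by (simp add: mult.commute)
  also have "\<dots> = (\<integral>x. E {a} W x * indicator A x \<partial>M)"
    using AM by (intro F.real_cond_exp_intg(2)[OF EA]) auto
  finally show "(\<integral>x\<in>A. W x \<partial>M) = (\<integral>x\<in>A. E {a} W x \<partial>M)"
    by (simp add: set_lebesgue_integral_def mult.commute)
qed

lemma future_given_past:
  assumes "integrable M W" "W \<in> borel_measurable (F {a..})"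
  shows "AE x in M. E {..a} W x = E {a} W x"
  by (rule E_eq_of_dual_indicators[OF past_given_future _ assms]) auto

text \<open>A second exchange of roles, fed by \<open>future_given_past\<close>, extends
  \<open>past_given_future\<close> from indicators to integrable variables.\<close>

lemma past_given_future_integrable:
  assumes "integrable M W" "W \<in> borel_measurable (F {..a})"
  shows "AE x in M. E {a..} W x = E {a} W x"
  by (rule E_eq_of_dual_indicators[OF _ _ assms])
     (auto intro!: future_given_past integrable_indicator' dest: sets_F_M)

text \<open>An event before \<open>a\<close> and one after \<open>b\<close> are removed in turn:
  given the chain up to \<open>b\<close>, the later event becomes a function \<beta> of
  \<open>\<xi> b\<close>; given the chain from \<open>a\<close> on, the earlier one becomes a
  function \<alpha> of \<open>\<xi> a\<close>. What remains is a weight that the two end points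
  determine.\<close>

lemma block_given_outside:
  assumes Y: "integrable M Y" "Y \<in> borel_measurable (F {a..b})" and ab: "a \<le> b"
  shows "AE x in M. E ({..a} \<union> {b..}) Y x = E {a, b} Y x"
proof (rule E_charact_Un[OF Y(1) F.real_cond_exp_int(1)[OF Y(1)]])
  show "E {a, b} Y \<in> borel_measurable (F ({..a} \<union> {b..}))"
    by (rule measurable_F_mono[OF E_measurable(1)]) auto
  fix A B assume A: "A \<in> sets (F {..a})" and B: "B \<in> sets (F {b..})"
  define \<alpha> \<beta> where "\<alpha> = E {a} (indicator A)" and "\<beta> = E {b} (indicator B)"
  have AM: "A \<in> sets M" and BM: "B \<in> sets M" using A B sets_F_M by auto
  have A': "A \<in> sets (F {..b})" using A sets_F_mono[of "{..a}" "{..b}"] ab by auto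
  have \<alpha>: "\<alpha> \<in> borel_measurable (F {a, b})" "\<alpha> \<in> borel_measurable M" "AE x in M. \<bar>\<alpha> x\<bar> \<le> 1"
    unfolding \<alpha>_def using measurable_F_mono[OF E_measurable(1), of "{a}" "{a,b}"] E_indicator_bounded[OF AM] by auto
  have \<beta>: "\<beta> \<in> borel_measurable (F {a, b})" "\<beta> \<in> borel_measurable (F {a..})" "\<beta> \<in> borel_measurable M" "AE x in M. \<bar>\<beta> x\<bar> \<le> 1"
    unfolding \<beta>_def using measurable_F_mono[OF E_measurable(1), of "{b}" "{a,b}"]
      measurable_F_mono[OF E_measurable(1), of "{b}" "{a..}"] ab E_indicator_bounded[OF BM] by auto
  have Aind: "(indicator A :: 'a \<Rightarrow> real) \<in> borel_measurable M" "AE x in M. \<bar>indicator A x :: real\<bar> \<le> 1"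
    using AM by (auto simp: indicator_def)
  have Bind: "(indicator B :: 'a \<Rightarrow> real) \<in> borel_measurable M" "AE x in M. \<bar>indicator B x :: real\<bar> \<le> 1"
    using BM by (auto simp: indicator_def)
  \<comment> \<open>The same weight \<open>\<alpha> * \<beta>\<close> arises for every
    \<open>U\<close> living on the block, so it serves both for \<open>Y\<close> and for its
    projection on the end points.\<close>
  have red: "(\<integral>x. indicator A x * indicator B x * U x \<partial>M) = (\<integral>x. (\<alpha> x * \<beta> x) * U x \<partial>M)"
    if U: "integrable M U" "U \<in> borel_measurable (F {a..b})" for U
  proof -
    have Ub: "U \<in> borel_measurable (F {..b})" and Ua: "U \<in> borel_measurable (F {a..})"
      using measurable_F_mono[OF U(2)] by auto
    have "(\<integral>x. indicator A x * indicator B x * U x \<partial>M) = (\<integral>x. (U x * indicator A x) * indicator B x \<partial>M)"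
      by (simp add: mult_ac)
    also have "\<dots> = (\<integral>x. (U x * indicator A x) * \<beta> x \<partial>M)"
    proof (rule integral_mult_E_eq)
      show "AE x in M. E {..b} (indicator B) x = \<beta> x"
        unfolding \<beta>_def using B BM by (intro future_given_past integrable_indicator') auto
      show "(\<lambda>x. U x * indicator A x) \<in> borel_measurable (F {..b})" using Ub A' by auto
      show "integrable M (\<lambda>x. U x * indicator A x * indicator B x)"
        by (intro integrable_mult_AE_bounded U Aind Bind)
    qed (use Bind \<beta> in auto)
    also have "\<dots> = (\<integral>x. (U x * \<beta> x) * indicator A x \<partial>M)" by (simp add: mult_ac)
    also have "\<dots> = (\<integral>x. (U x * \<beta> x) * \<alpha> x \<partial>M)"
    proof (rule integral_mult_E_eq)
      show "AE x in M. E {a..} (indicator A) x = \<alpha> x"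
        unfolding \<alpha>_def by (rule past_given_future[OF A])
      show "(\<lambda>x. U x * \<beta> x) \<in> borel_measurable (F {a..})" using Ua \<beta> by auto
      show "integrable M (\<lambda>x. U x * \<beta> x * indicator A x)"
        by (intro integrable_mult_AE_bounded U Aind \<beta>)
    qed (use Aind \<alpha> in auto)
    finally show ?thesis by (simp add: mult_ac)
  qed
  have "(\<integral>x. indicator A x * indicator B x * Y x \<partial>M) = (\<integral>x. (\<alpha> x * \<beta> x) * Y x \<partial>M)"
    by (rule red[OF Y])
  also have "\<dots> = (\<integral>x. (\<alpha> x * \<beta> x) * E {a, b} Y x \<partial>M)"
  proof (rule F.real_cond_exp_intg(2)[symmetric])
    have "integrable M (\<lambda>x. (Y x * \<alpha> x) * \<beta> x)" by (intro integrable_mult_AE_bounded Y \<alpha> \<beta>)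
    then show "integrable M (\<lambda>x. (\<alpha> x * \<beta> x) * Y x)" by (simp add: mult_ac)
  qed (use \<alpha> \<beta> Y in auto)
  also have "\<dots> = (\<integral>x. indicator A x * indicator B x * E {a, b} Y x \<partial>M)"
    using ab by (intro red[symmetric] F.real_cond_exp_int(1) Y measurable_F_mono[OF E_measurable(1)]) auto
  finally show "(\<integral>x. indicator A x * indicator B x * Y x \<partial>M) = (\<integral>x. indicator A x * indicator B x * E {a, b} Y x \<partial>M)" .
qed

section \<open>Invariant distribution and Markov operator\<close>

abbreviation \<pi> :: "'s measure" where "\<pi> \<equiv> inv_dist M S \<xi>"

lemma sets_inv_dist [simp, measurable_cong]: "sets \<pi> = sets S"
  by (simp add: inv_dist_def)

lemma measurable_inv_dist [simp]: "borel_measurable \<pi> = borel_measurable S"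
  by (rule measurable_cong_sets) auto

lemma distr_chain: "distr M S (\<xi> n) = \<pi>"
proof -
  have *: "distr M S (\<xi> k) = distr (distr M (Pi\<^sub>M {0} (\<lambda>_. S)) (\<lambda>z. \<lambda>j\<in>{0}. \<xi> (j + k) z)) S (\<lambda>x. x 0)" for k
    by (subst distr_distr) (auto simp: comp_def)
  show ?thesis unfolding inv_dist_def *[of n] *[of 0] by (simp only: stationary[of "{0}" n] stationary[of "{0}" 0] finite.intros)
qed

lemma prob_space_inv_dist: "prob_space \<pi>"
  unfolding inv_dist_def by (rule prob_space_distr) simp

lemma integrable_inv_dist:
  fixes \<phi> :: "'s \<Rightarrow> real"
  assumes "\<phi> \<in> borel_measurable S"
  shows "integrable \<pi> \<phi> \<longleftrightarrow> integrable M (\<lambda>z. \<phi> (\<xi> n z))"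
  using integrable_distr_eq[OF chain_measurable assms, of n] by (simp add: distr_chain)

lemma integral_inv_dist:
  fixes \<phi> :: "'s \<Rightarrow> real"
  assumes "\<phi> \<in> borel_measurable S"
  shows "(\<integral>x. \<phi> x \<partial>\<pi>) = (\<integral>z. \<phi> (\<xi> n z) \<partial>M)"
  using integral_distr[OF chain_measurable assms, of n] by (simp add: distr_chain)

lemma AE_inv_dist:
  assumes "{x \<in> space S. P x} \<in> sets S"
  shows "(AE x in \<pi>. P x) \<longleftrightarrow> (AE z in M. P (\<xi> n z))"
  using AE_distr_iff[OF chain_measurable assms, of n] unfolding distr_chain .

lemma kernel_measurable_subprob [measurable]: "Q \<in> S \<rightarrow>\<^sub>M subprob_algebra S"
  by (rule measurable_prob_algebraD[OF kernel_measurable])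

lemma space_S_not_empty: "space S \<noteq> {}"
  using not_empty measurable_space[OF chain_measurable] by blast

lemma nn_integral_kernel_measurable [measurable]:
  "\<phi> \<in> borel_measurable S \<Longrightarrow> (\<lambda>x. \<integral>\<^sup>+s. \<phi> s \<partial>Q x) \<in> borel_measurable S"
  using measurable_compose[OF kernel_measurable_subprob nn_integral_measurable_subprob_algebra] .

text \<open>Restricting \<open>M\<close> to the event \<open>A\<close> turns the one-step law into
  an identity between a distribution and a monadic bind with \<open>Q\<close>, so the passage from
  sets to nonnegative functions is the integral formula for bind.\<close>

lemma nn_integral_one_step:
  assumes A: "A \<in> sets (F {..n})" and [measurable]: "\<phi> \<in> borel_measurable S"
  shows "(\<integral>\<^sup>+z. indicator A z * \<phi> (\<xi> (n + 1) z) \<partial>M) = (\<integral>\<^sup>+z. indicator A z * (\<integral>\<^sup>+s. \<phi> s \<partial>Q (\<xi> n z)) \<partial>M)"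
proof -
  have AM [measurable]: "A \<in> sets M" using A sets_F_M by blast
  define N where "N = density M (indicator A)"
  have [measurable_cong]: "sets N = sets M" by (simp add: N_def)
  have bind: "distr N S (\<xi> (n + 1)) = distr N S (\<xi> n) \<bind> Q"
  proof (rule measure_eqI)
    show s: "sets (distr N S (\<xi> (n + 1))) = sets (distr N S (\<xi> n) \<bind> Q)"
      using space_S_not_empty sets_bind[of "distr N S (\<xi> n)" Q S] sets_kernel[OF kernel_measurable_subprob] by simp
    fix C assume "C \<in> sets (distr N S (\<xi> (n + 1)))"
    then have C [measurable]: "C \<in> sets S" by simp
    let ?C = "\<xi> (n + 1) -` C \<inter> space M"
    have "emeasure (distr N S (\<xi> (n + 1))) C = (\<integral>\<^sup>+z. indicator A z * indicator ?C z \<partial>M)"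
      by (subst emeasure_distr) (auto simp: N_def emeasure_density sets_eq_imp_space_eq[of "density M (indicator A)" M])
    also have "\<dots> = (\<integral>\<^sup>+z. ennreal (indicator A z * indicator ?C z) \<partial>M)"
      by (intro nn_integral_cong) (auto split: split_indicator)
    also have "\<dots> = ennreal (\<integral>z. indicator A z * indicator ?C z \<partial>M)"
      by (intro nn_integral_eq_integral integrable_mult_AE_bounded integrable_indicator') (auto split: split_indicator)
    also have "(\<integral>z. indicator A z * indicator ?C z \<partial>M) = (\<integral>z. indicator A z * measure (Q (\<xi> n z)) C \<partial>M)"
      using A by (intro integral_one_step integrable_indicator') auto
    also have "ennreal \<dots> = (\<integral>\<^sup>+z. ennreal (indicator A z * measure (Q (\<xi> n z)) C) \<partial>M)"
    proof (rule nn_integral_eq_integral[symmetric])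
      have "(\<lambda>z. measure (Q (\<xi> n z)) C) \<in> borel_measurable M"
        by (rule measurable_compose[OF chain_measurable kernel_eval_measurable[OF C]])
      moreover have "AE z in M. \<bar>measure (Q (\<xi> n z)) C\<bar> \<le> 1"
        using kernel_prob_space measurable_space[OF chain_measurable]
        by (intro AE_I2) (auto simp: prob_space.prob_le_1)
      ultimately show "integrable M (\<lambda>z. indicator A z * measure (Q (\<xi> n z)) C)"
        by (intro integrable_mult_AE_bounded integrable_indicator') auto
    qed simp
    also have "\<dots> = (\<integral>\<^sup>+z. indicator A z * emeasure (Q (\<xi> n z)) C \<partial>M)"
    proof (rule nn_integral_cong)
      fix z assume "z \<in> space M"
      then interpret q: prob_space "Q (\<xi> n z)" using kernel_prob_space measurable_space[OF chain_measurable] by blast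
      show "ennreal (indicator A z * measure (Q (\<xi> n z)) C) = indicator A z * emeasure (Q (\<xi> n z)) C"
        by (auto simp: q.emeasure_eq_measure split: split_indicator)
    qed
    also have "\<dots> = (\<integral>\<^sup>+x. emeasure (Q x) C \<partial>distr N S (\<xi> n))"
    proof -
      have [measurable]: "(\<lambda>x. emeasure (Q x) C) \<in> borel_measurable S"
        using measurable_compose[OF kernel_measurable_subprob measurable_emeasure_subprob_algebra[OF C]] .
      show ?thesis by (simp add: nn_integral_distr N_def nn_integral_density)
    qed
    also have "\<dots> = emeasure (distr N S (\<xi> n) \<bind> Q) C"
      using space_S_not_empty by (intro emeasure_bind[symmetric, where N = S]) auto
    finally show "emeasure (distr N S (\<xi> (n + 1))) C = emeasure (distr N S (\<xi> n) \<bind> Q) C" .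
  qed
  have "(\<integral>\<^sup>+z. indicator A z * \<phi> (\<xi> (n + 1) z) \<partial>M) = (\<integral>\<^sup>+s. \<phi> s \<partial>distr N S (\<xi> (n + 1)))"
    by (simp add: nn_integral_distr N_def nn_integral_density)
  also have "\<dots> = (\<integral>\<^sup>+x. \<integral>\<^sup>+s. \<phi> s \<partial>Q x \<partial>distr N S (\<xi> n))"
    unfolding bind by (rule nn_integral_bind[where B = S]) auto
  also have "\<dots> = (\<integral>\<^sup>+z. indicator A z * (\<integral>\<^sup>+s. \<phi> s \<partial>Q (\<xi> n z)) \<partial>M)"
    by (simp add: nn_integral_distr N_def nn_integral_density)
  finally show ?thesis .
qed

text \<open>The kernel integral of \<open>u\<close> may be infinite at exceptional states. Working
  in \<open>ennreal\<close> postpones that question, and \<open>enn2real\<close> puts the value 0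
  there, on a null set.\<close>

lemma E_one_step_nonneg:
  fixes u :: "'s \<Rightarrow> real"
  assumes u [measurable]: "u \<in> borel_measurable S" and nonneg: "\<And>s. 0 \<le> u s" and int: "integrable \<pi> u"
  shows "AE z in M. (\<integral>\<^sup>+s. ennreal (u s) \<partial>Q (\<xi> n z)) < \<infinity>"
    and "integrable M (\<lambda>z. enn2real (\<integral>\<^sup>+s. ennreal (u s) \<partial>Q (\<xi> n z)))"
    and "AE z in M. E {..n} (\<lambda>z. u (\<xi> (n + 1) z)) z = enn2real (\<integral>\<^sup>+s. ennreal (u s) \<partial>Q (\<xi> n z))"
proof -
  define g where "g x = (\<integral>\<^sup>+s. ennreal (u s) \<partial>Q x)" for x
  have g [measurable]: "g \<in> borel_measurable S" unfolding g_def by measurable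
  have ui: "integrable M (\<lambda>z. u (\<xi> (n + 1) z))" using int integrable_inv_dist[OF u] by blast
  have eq: "(\<integral>\<^sup>+z. indicator A z * g (\<xi> n z) \<partial>M) = (\<integral>\<^sup>+z. indicator A z * ennreal (u (\<xi> (n + 1) z)) \<partial>M)"
    if "A \<in> sets (F {..n})" for A
    unfolding g_def using nn_integral_one_step[OF that, of "\<lambda>s. ennreal (u s)"] by simp
  have "(\<integral>\<^sup>+z. g (\<xi> n z) \<partial>M) = (\<integral>\<^sup>+z. ennreal (u (\<xi> (n + 1) z)) \<partial>M)"
  proof -
    have "(\<integral>\<^sup>+z. indicator (space M) z * v z \<partial>M) = (\<integral>\<^sup>+z. v z \<partial>M)" for v
      by (intro nn_integral_cong) auto
    then show ?thesis using eq[of "space M"] sets.top[of "F {..n}"] by simp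
  qed
  also have "\<dots> < \<infinity>" using ui nonneg by (subst nn_integral_eq_integral) auto
  finally have fin: "(\<integral>\<^sup>+z. g (\<xi> n z) \<partial>M) < \<infinity>" .
  then have AEfin: "AE z in M. g (\<xi> n z) \<noteq> \<infinity>" by (intro nn_integral_PInf_AE) auto
  then show "AE z in M. (\<integral>\<^sup>+s. ennreal (u s) \<partial>Q (\<xi> n z)) < \<infinity>"
    by eventually_elim (simp add: g_def less_top)
  have AEeq: "AE z in M. ennreal (enn2real (g (\<xi> n z))) = g (\<xi> n z)"
    using AEfin by eventually_elim (simp add: less_top)
  have nn: "(\<integral>\<^sup>+z. ennreal (enn2real (g (\<xi> n z))) \<partial>M) = (\<integral>\<^sup>+z. g (\<xi> n z) \<partial>M)"
    by (rule nn_integral_cong_AE[OF AEeq])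
  have pi: "integrable M (\<lambda>z. enn2real (g (\<xi> n z)))"
    using fin nn by (intro integrableI_bounded) auto
  then show "integrable M (\<lambda>z. enn2real (\<integral>\<^sup>+s. ennreal (u s) \<partial>Q (\<xi> n z)))" by (simp add: g_def)
  have "AE z in M. E {..n} (\<lambda>z. u (\<xi> (n + 1) z)) z = enn2real (g (\<xi> n z))"
  proof (rule F.real_cond_exp_charact[OF _ ui pi])
    have [measurable]: "\<xi> n \<in> F {..n} \<rightarrow>\<^sub>M S" by (rule chain_measurable_F) simp
    show "(\<lambda>z. enn2real (g (\<xi> n z))) \<in> borel_measurable (F {..n})" by measurable
    fix A assume A: "A \<in> sets (F {..n})"
    then have [measurable]: "A \<in> sets M" using sets_F_M by blast
    have "(\<integral>z\<in>A. u (\<xi> (n + 1) z) \<partial>M) = enn2real (\<integral>\<^sup>+z. indicator A z * ennreal (u (\<xi> (n + 1) z)) \<partial>M)"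
      unfolding set_lebesgue_integral_def
      by (subst integral_eq_nn_integral) (auto simp: nonneg ennreal_mult' ennreal_indicator)
    also have "\<dots> = enn2real (\<integral>\<^sup>+z. indicator A z * ennreal (enn2real (g (\<xi> n z))) \<partial>M)"
      unfolding eq[OF A, symmetric]
      by (intro arg_cong[where f = enn2real] nn_integral_cong_AE) (use AEeq in auto)
    also have "\<dots> = (\<integral>z\<in>A. enn2real (g (\<xi> n z)) \<partial>M)"
      unfolding set_lebesgue_integral_def
      by (subst integral_eq_nn_integral) (auto simp: ennreal_mult' ennreal_indicator)
    finally show "(\<integral>z\<in>A. u (\<xi> (n + 1) z) \<partial>M) = (\<integral>z\<in>A. enn2real (g (\<xi> n z)) \<partial>M)" .
  qed
  then show "AE z in M. E {..n} (\<lambda>z. u (\<xi> (n + 1) z)) z = enn2real (\<integral>\<^sup>+s. ennreal (u s) \<partial>Q (\<xi> n z))"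
    by (simp add: g_def)
qed

lemma markov_op_measurable:
  "\<phi> \<in> borel_measurable S \<Longrightarrow> markov_op Q \<phi> \<in> borel_measurable S"
  unfolding markov_op_def
  using measurable_compose[OF kernel_measurable_subprob integral_measurable_subprob_algebra] .

text \<open>\<open>markov_op\<close> is a Bochner integral and carries no information at states
  where \<open>\<phi>\<close> is not integrable. Such states are almost surely not visited;
  elsewhere the positive and negative parts are treated separately.\<close>

lemma markov_op_E:
  assumes \<phi> [measurable]: "\<phi> \<in> borel_measurable S" and int: "integrable \<pi> \<phi>"
  shows "integrable \<pi> (markov_op Q \<phi>)"
    and "AE z in M. E {..n} (\<lambda>z. \<phi> (\<xi> (n + 1) z)) z = markov_op Q \<phi> (\<xi> n z)"
proof -
  define u v where "u s = max 0 (\<phi> s)" and "v s = max 0 (- \<phi> s)" for s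
  have uv [measurable]: "u \<in> borel_measurable S" "v \<in> borel_measurable S" unfolding u_def v_def by auto
  have uv0: "\<And>s. 0 \<le> u s" "\<And>s. 0 \<le> v s" and uvd: "\<And>s. u s - v s = \<phi> s" by (auto simp: u_def v_def)
  have uvi: "integrable \<pi> u" "integrable \<pi> v" unfolding u_def v_def using int by auto
  define p where "p w k z = enn2real (\<integral>\<^sup>+s. ennreal (w s) \<partial>Q (\<xi> k z))" for w :: "'s \<Rightarrow> real" and k z
  note U = E_one_step_nonneg[OF uv(1) uv0(1) uvi(1)] and V = E_one_step_nonneg[OF uv(2) uv0(2) uvi(2)]
  have op: "AE z in M. markov_op Q \<phi> (\<xi> k z) = p u k z - p v k z" for k
    using U(1)[of k] V(1)[of k] AE_space
  proof eventually_elim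
    case (elim z)
    then have "\<xi> k z \<in> space S" using measurable_space[OF chain_measurable] by blast
    then have "sets (Q (\<xi> k z)) = sets S"
      using sets_kernel[OF kernel_measurable_subprob] by blast
    then have [measurable]: "u \<in> borel_measurable (Q (\<xi> k z))" "v \<in> borel_measurable (Q (\<xi> k z))"
      using uv measurable_cong_sets[of "Q (\<xi> k z)" S borel borel] by auto
    have i: "integrable (Q (\<xi> k z)) u" "integrable (Q (\<xi> k z)) v"
      using elim uv0 by (auto intro!: integrableI_nonneg)
    have "markov_op Q \<phi> (\<xi> k z) = (\<integral>s. u s - v s \<partial>Q (\<xi> k z))" by (simp add: markov_op_def uvd)
    also have "\<dots> = (\<integral>s. u s \<partial>Q (\<xi> k z)) - (\<integral>s. v s \<partial>Q (\<xi> k z))" using i by simp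
    also have "\<dots> = p u k z - p v k z"
      unfolding p_def using uv0 by (simp add: integral_eq_nn_integral)
    finally show ?case .
  qed
  have pi: "integrable M (p u k)" "integrable M (p v k)" for k
    using U(2)[of k] V(2)[of k] by (auto simp: p_def[abs_def])
  have opm: "(\<lambda>z. markov_op Q \<phi> (\<xi> k z)) \<in> borel_measurable M" for k
    by (rule measurable_compose[OF chain_measurable markov_op_measurable[OF \<phi>]])
  have "integrable M (\<lambda>z. markov_op Q \<phi> (\<xi> 0 z))"
    using integrable_cong_AE[OF opm _ op, of 0] pi[of 0] by auto
  then show "integrable \<pi> (markov_op Q \<phi>)"
    using integrable_inv_dist[OF markov_op_measurable[OF \<phi>]] by blast
  have ui: "integrable M (\<lambda>z. u (\<xi> (n + 1) z))" "integrable M (\<lambda>z. v (\<xi> (n + 1) z))"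
    using uvi integrable_inv_dist uv by blast+
  have "AE z in M. E {..n} (\<lambda>z. u (\<xi> (n + 1) z) - v (\<xi> (n + 1) z)) z =
      E {..n} (\<lambda>z. u (\<xi> (n + 1) z)) z - E {..n} (\<lambda>z. v (\<xi> (n + 1) z)) z"
    by (rule F.real_cond_exp_diff[OF ui])
  then show "AE z in M. E {..n} (\<lambda>z. \<phi> (\<xi> (n + 1) z)) z = markov_op Q \<phi> (\<xi> n z)"
    using op[of n] U(3)[of n] V(3)[of n] by eventually_elim (simp add: uvd p_def)
qed

lemma markov_op_pow:
  assumes \<phi>: "\<phi> \<in> borel_measurable S" "integrable \<pi> \<phi>"
  shows "(markov_op Q ^^ m) \<phi> \<in> borel_measurable S"
    and "integrable \<pi> ((markov_op Q ^^ m) \<phi>)"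
    and "AE z in M. E {..n} (\<lambda>z. \<phi> (\<xi> (n + int m) z)) z = (markov_op Q ^^ m) \<phi> (\<xi> n z)"
proof -
  show meas: "(markov_op Q ^^ m) \<phi> \<in> borel_measurable S" for m
    by (induction m) (auto simp: \<phi> markov_op_measurable)
  show int: "integrable \<pi> ((markov_op Q ^^ m) \<phi>)" for m
    by (induction m) (auto simp: \<phi> markov_op_E(1)[OF meas])
  have xi: "integrable M (\<lambda>z. \<phi> (\<xi> k z))" for k using \<phi> integrable_inv_dist by blast
  show "AE z in M. E {..n} (\<lambda>z. \<phi> (\<xi> (n + int m) z)) z = (markov_op Q ^^ m) \<phi> (\<xi> n z)"
  proof (induction m arbitrary: n)
    case 0
    show ?case
      using F.real_cond_exp_F_meas[OF xi[of n] measurable_compose[OF chain_measurable_F \<phi>(1)], of "{..n}"] by simp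
  next
    case (Suc m)
    let ?g = "(markov_op Q ^^ m) \<phi>"
    have eq: "n + int (Suc m) = (n + 1) + int m" by simp
    have "AE z in M. E {..n} (E {..n + 1} (\<lambda>z. \<phi> (\<xi> (n + int (Suc m)) z))) z = E {..n} (\<lambda>z. \<phi> (\<xi> (n + int (Suc m)) z)) z"
      by (intro F.real_cond_exp_nested_subalg subalgebra_F subalgebra_F_mono xi) auto
    moreover have "AE z in M. E {..n} (E {..n + 1} (\<lambda>z. \<phi> (\<xi> (n + int (Suc m)) z))) z = E {..n} (\<lambda>z. ?g (\<xi> (n + 1) z)) z"
      unfolding eq
      by (intro F.real_cond_exp_cong Suc.IH measurable_compose[OF chain_measurable meas]) auto
    ultimately show ?case
      using markov_op_E(2)[OF meas[of m] int[of m], of n] by eventually_elim simp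
  qed
qed

section \<open>Shift invariance of conditional expectations\<close>

definition window :: "int set \<Rightarrow> int \<Rightarrow> 'a \<Rightarrow> int \<Rightarrow> 's" where
  "window J a z = (\<lambda>j\<in>J. \<xi> (j + a) z)"

lemma window_measurable [measurable]: "window J a \<in> M \<rightarrow>\<^sub>M Pi\<^sub>M J (\<lambda>_. S)"
  unfolding window_def by measurable

lemma distr_window: "finite J \<Longrightarrow> distr M (Pi\<^sub>M J (\<lambda>_. S)) (window J a) = distr M (Pi\<^sub>M J (\<lambda>_. S)) (window J 0)"
  using stationary[of J a] stationary[of J 0] unfolding window_def by simp

lemma integral_window:
  fixes u :: "(int \<Rightarrow> 's) \<Rightarrow> real"
  assumes "finite J" and u: "u \<in> borel_measurable (Pi\<^sub>M J (\<lambda>_. S))"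
  shows "(\<integral>z. u (window J a z) \<partial>M) = (\<integral>z. u (window J 0 z) \<partial>M)"
  unfolding integral_distr[OF window_measurable u, symmetric] distr_window[OF \<open>finite J\<close>, of a] ..

text \<open>The essential point is that \<open>e\<close> does not depend on \<open>a\<close>.
  Windows with different starting times have the same law on the product space, and \<open>e\<close>
  is a conditional expectation taken there.\<close>

lemma E_window_factor:
  fixes u :: "(int \<Rightarrow> 's) \<Rightarrow> real"
  assumes J: "finite J" "K \<subseteq> J" and u: "u \<in> borel_measurable (Pi\<^sub>M J (\<lambda>_. S))"
    and int: "integrable M (\<lambda>z. u (window J 0 z))"
  obtains e where "e \<in> borel_measurable (Pi\<^sub>M J (\<lambda>_. S))"
    "\<And>a. AE z in M. E ((\<lambda>k. k + a) ` K) (\<lambda>z. u (window J a z)) z = e (window J a z)"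
proof -
  let ?N = "Pi\<^sub>M J (\<lambda>_. S)"
  \<comment> \<open>The coordinate process on the product space takes the place of the chain; its
    sigma-algebra over \<open>K\<close> is pulled back by \<open>window J a\<close> to that of the
    chain over \<open>K\<close> shifted by \<open>a\<close>.\<close>
  define H where "H = gen_sigma ?N S (\<lambda>k x. x k) K"
  let ?G = "\<Union>k\<in>K. {(\<lambda>x. x k) -` A \<inter> space ?N | A. A \<in> sets S}"
  have G: "?G \<subseteq> sets ?N"
  proof -
    have "(\<lambda>x. x k) -` A \<inter> space ?N \<in> sets ?N" if "k \<in> K" "A \<in> sets S" for k A
      using that J by (intro measurable_sets[of _ ?N S] measurable_component_singleton) auto
    then show ?thesis by auto
  qed
  then have Pow: "?G \<subseteq> Pow (space ?N)" using sets.sets_into_space by blast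
  have Hs: "space H = space ?N" "sets H = sigma_sets (space ?N) ?G"
    unfolding H_def gen_sigma_def using Pow by (simp_all add: space_measure_of sets_measure_of)
  have H: "subalgebra ?N H"
    unfolding subalgebra_def Hs using sets.sigma_sets_subset[OF G] by simp
  define e where "e = real_cond_exp (distr M ?N (window J 0)) H u"
  have eH: "e \<in> borel_measurable H" by (simp add: e_def)
  have "AE z in M. E ((\<lambda>k. k + a) ` K) (\<lambda>z. u (window J a z)) z = e (window J a z)" for a
  proof -
    have ws: "window J a z \<in> space ?N" if "z \<in> space M" for z
      using measurable_space[OF window_measurable that] .
    have "{window J a -` A \<inter> space M | A. A \<in> sets H} = sigma_sets (space M) {window J a -` A \<inter> space M | A. A \<in> ?G}"
      unfolding Hs by (rule sigma_sets_vimage_commute) (use ws in auto)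
    also have "{window J a -` A \<inter> space M | A. A \<in> ?G} = (\<Union>k\<in>(\<lambda>k. k + a) ` K. {\<xi> k -` A \<inter> space M | A. A \<in> sets S})"
    proof -
      have *: "window J a -` ((\<lambda>x. x k) -` A \<inter> space ?N) \<inter> space M = \<xi> (k + a) -` A \<inter> space M" if "k \<in> K" for k A
        using that J ws by (auto simp: window_def)
      have "{window J a -` A \<inter> space M | A. A \<in> ?G} = (\<Union>k\<in>K. {window J a -` ((\<lambda>x. x k) -` A \<inter> space ?N) \<inter> space M | A. A \<in> sets S})"
        by blast
      also have "\<dots> = (\<Union>k\<in>K. {\<xi> (k + a) -` A \<inter> space M | A. A \<in> sets S})"
        using * by (intro SUP_cong) auto
      finally show ?thesis by simp
    qed
    finally have sF: "sets (F ((\<lambda>k. k + a) ` K)) = {window J a -` A \<inter> space M | A. A \<in> sets H}"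
      by (simp add: sets_F)
    have i: "integrable (distr M ?N (window J a)) u"
      using int integrable_distr_eq[OF window_measurable u, of 0] distr_window[OF J(1), of a] by simp
    show ?thesis
      using F.real_cond_exp_distr[OF window_measurable H sF i] by (simp add: distr_window[OF J(1), of a] e_def)
  qed
  then show thesis using that measurable_from_subalg[OF H eH] by blast
qed

section \<open>Coboundary approximation for powers of the Markov operator\<close>

interpretation \<pi>: prob_space \<pi>
  by (rule prob_space_inv_dist)

lemma sq_integrable_inv_dist:
  assumes [measurable]: "\<phi> \<in> borel_measurable S"
  shows "sq_integrable \<pi> \<phi> \<longleftrightarrow> sq_integrable M (\<lambda>z. \<phi> (\<xi> n z))"
  unfolding sq_integrable_def using integrable_inv_dist[of "\<lambda>x. (\<phi> x)\<^sup>2" n] by simp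

text \<open>Contraction and preservation of the mean are inherited from conditional expectation
  along the chain, which avoids applying Jensen's inequality to the kernel at every state.\<close>

lemma markov_op_L2:
  assumes \<phi>: "sq_integrable \<pi> \<phi>"
  shows "(markov_op Q ^^ m) \<phi> \<in> borel_measurable S"
    and "sq_integrable \<pi> ((markov_op Q ^^ m) \<phi>)"
    and "sq_norm \<pi> ((markov_op Q ^^ m) \<phi>) \<le> sq_norm \<pi> \<phi>"
    and "(\<integral>x. (markov_op Q ^^ m) \<phi> x \<partial>\<pi>) = (\<integral>x. \<phi> x \<partial>\<pi>)"
    and "AE z in M. E {..n} (\<lambda>z. \<phi> (\<xi> (n + int m) z)) z = (markov_op Q ^^ m) \<phi> (\<xi> n z)"
proof -
  have \<phi>m [measurable]: "\<phi> \<in> borel_measurable S" using sq_integrable_measurable[OF \<phi>] by simp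
  note \<phi>i = \<pi>.sq_integrable_integrable[OF \<phi>]
  note P = markov_op_pow[OF \<phi>m \<phi>i]
  show Pm [measurable]: "(markov_op Q ^^ m) \<phi> \<in> borel_measurable S" by (rule P)
  show PE: "AE z in M. E {..n} (\<lambda>z. \<phi> (\<xi> (n + int m) z)) z = (markov_op Q ^^ m) \<phi> (\<xi> n z)" for n
    by (rule P)
  let ?X = "\<lambda>z. \<phi> (\<xi> (0 + int m) z)" and ?Y = "\<lambda>z. (markov_op Q ^^ m) \<phi> (\<xi> 0 z)"
  have X: "sq_integrable M ?X" using \<phi> sq_integrable_inv_dist[OF \<phi>m] by blast
  have Y: "sq_integrable M ?Y"
    by (rule sq_integrable_cong_AE[OF PE[of 0] _ F.sq_integrable_cond_exp[OF X]]) simp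
  then show "sq_integrable \<pi> ((markov_op Q ^^ m) \<phi>)" using sq_integrable_inv_dist[OF Pm] by blast
  have "sq_norm M ?Y = sq_norm M (E {..0} ?X)"
    using PE[of 0] by (intro integral_cong_AE) auto
  also have "\<dots> \<le> sq_norm M ?X" by (rule F.cond_exp_L2_contraction[OF X])
  finally show "sq_norm \<pi> ((markov_op Q ^^ m) \<phi>) \<le> sq_norm \<pi> \<phi>"
    using integral_inv_dist[of "\<lambda>x. ((markov_op Q ^^ m) \<phi> x)\<^sup>2" 0] integral_inv_dist[of "\<lambda>x. (\<phi> x)\<^sup>2" "0 + int m"] by simp
  have "(\<integral>z. ?Y z \<partial>M) = (\<integral>z. E {..0} ?X z \<partial>M)"
    using PE[of 0] by (intro integral_cong_AE) auto
  also have "\<dots> = (\<integral>z. ?X z \<partial>M)" by (rule F.real_cond_exp_int(2)[OF sq_integrable_integrable[OF X]])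
  finally show "(\<integral>x. (markov_op Q ^^ m) \<phi> x \<partial>\<pi>) = (\<integral>x. \<phi> x \<partial>\<pi>)"
    using integral_inv_dist[OF Pm, of 0] integral_inv_dist[OF \<phi>m, of "0 + int m"] by simp
qed

text \<open>Total ergodicity enters here, through the fixed points of the \<open>m\<close>-th power.
  Linearity is claimed almost everywhere only, as kernel integrals may fail to exist at some states,
  and it is read off from conditional expectations.\<close>

lemma L2_coboundary_approx:
  assumes erg: "totally_ergodic \<pi> Q" and m: "1 \<le> m"
    and h: "sq_integrable \<pi> h" "(\<integral>x. h x \<partial>\<pi>) = 0" and e: "0 < e"
  shows "\<exists>\<phi>. sq_integrable \<pi> \<phi> \<and> (\<integral>x. (h x - \<phi> x + (markov_op Q ^^ m) \<phi> x)\<^sup>2 \<partial>\<pi>) < e"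
proof (rule \<pi>.mean_ergodic_coboundary_approx[OF _ _ _ _ _ h e])
  fix \<phi> assume \<phi>: "sq_integrable \<pi> \<phi>"
  show "sq_integrable \<pi> ((markov_op Q ^^ m) \<phi>)"
    "sq_norm \<pi> ((markov_op Q ^^ m) \<phi>) \<le> sq_norm \<pi> \<phi>"
    "(\<integral>x. (markov_op Q ^^ m) \<phi> x \<partial>\<pi>) = (\<integral>x. \<phi> x \<partial>\<pi>)"
    using markov_op_L2[OF \<phi>] by auto
  show "\<exists>c. AE x in \<pi>. \<phi> x = c" if "AE x in \<pi>. (markov_op Q ^^ m) \<phi> x = \<phi> x"
    using erg m \<phi> that unfolding totally_ergodic_def sq_integrable_def by blast
  fix \<psi> c assume \<psi>: "sq_integrable \<pi> \<psi>"
  let ?P = "markov_op Q ^^ m"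
  have \<chi>: "sq_integrable \<pi> (\<lambda>x. \<phi> x + c * \<psi> x)"
    by (intro sq_integrable_add sq_integrable_cmult \<phi> \<psi>)
  note [measurable] = markov_op_L2(1)[OF \<phi>, of m] markov_op_L2(1)[OF \<psi>, of m] markov_op_L2(1)[OF \<chi>, of m]
  have si: "sq_integrable M (\<lambda>z. \<eta> (\<xi> k z))" if "sq_integrable \<pi> \<eta>" for \<eta> k
    using that sq_integrable_inv_dist[of \<eta> k] sq_integrable_measurable[OF that] by simp
  note int = sq_integrable_integrable[OF si]
  let ?k = "0 + int m"
  have "AE z in M. E {..0} (\<lambda>z. \<phi> (\<xi> ?k z) + c * \<psi> (\<xi> ?k z)) z
      = E {..0} (\<lambda>z. \<phi> (\<xi> ?k z)) z + E {..0} (\<lambda>z. c * \<psi> (\<xi> ?k z)) z"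
    using int[OF \<phi>] int[OF \<psi>] by (intro F.real_cond_exp_add) auto
  moreover have "AE z in M. E {..0} (\<lambda>z. c * \<psi> (\<xi> ?k z)) z = c * E {..0} (\<lambda>z. \<psi> (\<xi> ?k z)) z"
    by (rule F.real_cond_exp_cmult[OF int[OF \<psi>]])
  ultimately have "AE z in M. ?P (\<lambda>x. \<phi> x + c * \<psi> x) (\<xi> 0 z) = ?P \<phi> (\<xi> 0 z) + c * ?P \<psi> (\<xi> 0 z)"
    using markov_op_L2(5)[OF \<phi>, of 0 m] markov_op_L2(5)[OF \<psi>, of 0 m] markov_op_L2(5)[OF \<chi>, of 0 m]
    by eventually_elim simp
  then show "AE x in \<pi>. ?P (\<lambda>x. \<phi> x + c * \<psi> x) x = ?P \<phi> x + c * ?P \<psi> x"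
    by (subst AE_inv_dist[of _ 0]) measurable
qed

text \<open>The conditional variances to which this is applied are only known to be integrable, so
  \<open>h\<close> is truncated first. The three thirds of \<open>e\<close> pay for the truncation,
  for the mean it creates, and for the residual, whose \<open>L2\<close> norm dominates its
  \<open>L1\<close> norm.\<close>

lemma L1_coboundary_approx:
  assumes erg: "totally_ergodic \<pi> Q" and m: "1 \<le> m"
    and h: "integrable \<pi> h" "(\<integral>x. h x \<partial>\<pi>) = 0" and e: "0 < e"
  shows "\<exists>\<phi>. sq_integrable \<pi> \<phi> \<and> (\<integral>x. \<bar>h x - \<phi> x + (markov_op Q ^^ m) \<phi> x\<bar> \<partial>\<pi>) \<le> e"
proof -
  define c where "c N x = max (- real N) (min (real N) (h x))" for N x
  note hm [measurable] = borel_measurable_integrable[OF h(1)]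
  have cm [measurable]: "c N \<in> borel_measurable \<pi>" for N unfolding c_def by measurable
  have dom: "\<bar>h x - c N x\<bar> \<le> \<bar>h x\<bar>" for N x by (auto simp: c_def)
  have "(\<lambda>N. \<integral>x. \<bar>h x - c N x\<bar> \<partial>\<pi>) \<longlonglongrightarrow> (\<integral>x. 0 \<partial>\<pi>)"
  proof (rule integral_dominated_convergence[where w = "\<lambda>x. \<bar>h x\<bar>"])
    show "AE x in \<pi>. (\<lambda>N. \<bar>h x - c N x\<bar>) \<longlonglongrightarrow> 0"
    proof (rule AE_I2)
      fix x
      obtain N0 :: nat where N0: "\<bar>h x\<bar> \<le> real N0" using real_arch_simple by blast
      have "\<forall>\<^sub>F N in sequentially. \<bar>h x - c N x\<bar> = 0"
        using eventually_ge_at_top[of N0] by eventually_elim (use N0 in \<open>auto simp: c_def\<close>)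
      then show "(\<lambda>N. \<bar>h x - c N x\<bar>) \<longlonglongrightarrow> 0" by (rule tendsto_eventually)
    qed
  qed (use h dom in auto)
  then have "\<forall>\<^sub>F N in sequentially. (\<integral>x. \<bar>h x - c N x\<bar> \<partial>\<pi>) < e / 3"
    using e by (intro order_tendstoD(2)) auto
  then obtain N where N: "(\<integral>x. \<bar>h x - c N x\<bar> \<partial>\<pi>) < e / 3" by (auto simp: eventually_sequentially)
  have csi: "sq_integrable \<pi> (c N)" by (rule \<pi>.sq_integrable_bounded[of _ "real N"]) (auto simp: c_def)
  note ci = \<pi>.sq_integrable_integrable[OF csi]
  define \<mu> where "\<mu> = (\<integral>x. c N x \<partial>\<pi>)"
  have \<mu>: "\<bar>\<mu>\<bar> < e / 3"
  proof -
    have "\<mu> = - (\<integral>x. h x - c N x \<partial>\<pi>)" using h ci by (simp add: \<mu>_def)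
    then have "\<bar>\<mu>\<bar> \<le> (\<integral>x. \<bar>h x - c N x\<bar> \<partial>\<pi>)" using integral_abs_bound[of \<pi> "\<lambda>x. h x - c N x"] by simp
    then show ?thesis using N by simp
  qed
  have si: "sq_integrable \<pi> (\<lambda>x. c N x - \<mu>)" by (intro sq_integrable_diff csi \<pi>.sq_integrable_const)
  have "(\<integral>x. c N x - \<mu> \<partial>\<pi>) = 0" using ci by (simp add: \<mu>_def \<pi>.prob_space)
  then obtain \<phi> where \<phi>: "sq_integrable \<pi> \<phi>" "(\<integral>x. (c N x - \<mu> - \<phi> x + (markov_op Q ^^ m) \<phi> x)\<^sup>2 \<partial>\<pi>) < (e / 3)\<^sup>2"
    using L2_coboundary_approx[OF erg m si, of "(e / 3)\<^sup>2"] e by auto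
  let ?r = "\<lambda>x. c N x - \<mu> - \<phi> x + (markov_op Q ^^ m) \<phi> x"
  have rsi: "sq_integrable \<pi> ?r" by (intro sq_integrable_add sq_integrable_diff[OF si] \<phi> markov_op_L2)
  have "(\<integral>x. \<bar>?r x\<bar> \<partial>\<pi>) \<le> sqrt (sq_norm \<pi> ?r)" by (rule \<pi>.integral_abs_le_L2[OF rsi])
  also have "\<dots> \<le> sqrt ((e / 3)\<^sup>2)" using \<phi>(2) by (intro real_sqrt_le_mono) simp
  finally have r: "(\<integral>x. \<bar>?r x\<bar> \<partial>\<pi>) \<le> e / 3" using e by simp
  note ri = \<pi>.sq_integrable_integrable[OF rsi]
  note Pi = \<pi>.sq_integrable_integrable[OF markov_op_L2(2)[OF \<phi>(1), of m]] \<pi>.sq_integrable_integrable[OF \<phi>(1)]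
  have "(\<integral>x. \<bar>h x - \<phi> x + (markov_op Q ^^ m) \<phi> x\<bar> \<partial>\<pi>) \<le> (\<integral>x. \<bar>h x - c N x\<bar> + \<bar>?r x\<bar> + \<bar>\<mu>\<bar> \<partial>\<pi>)"
    by (intro integral_mono) (use h ci ri Pi in auto)
  also have "\<dots> = (\<integral>x. \<bar>h x - c N x\<bar> \<partial>\<pi>) + (\<integral>x. \<bar>?r x\<bar> \<partial>\<pi>) + \<bar>\<mu>\<bar>"
    using h ci ri by (simp add: \<pi>.prob_space)
  finally show ?thesis using N r \<mu> \<phi>(1) by (intro exI[of _ \<phi>]) auto
qed

text \<open>Conditional expectations are real valued here; cosine and sine are bounded real weights
  to which orthogonality and conditioning apply directly.\<close>

lemma integral_iexp_mult_split:
  assumes "\<theta> \<in> borel_measurable M" "integrable M X"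
  shows "(\<integral>z. iexp (\<theta> z) * complex_of_real (X z) \<partial>M)
    = complex_of_real (\<integral>z. cos (\<theta> z) * X z \<partial>M) + \<i> * complex_of_real (\<integral>z. sin (\<theta> z) * X z \<partial>M)"
proof -
  have [measurable]: "\<theta> \<in> borel_measurable M" by fact
  have i: "integrable M (\<lambda>z. cos (\<theta> z) * X z)" "integrable M (\<lambda>z. sin (\<theta> z) * X z)"
    using integrable_mult_AE_bounded[OF assms(2), of "\<lambda>z. cos (\<theta> z)"]
      integrable_mult_AE_bounded[OF assms(2), of "\<lambda>z. sin (\<theta> z)"] by (auto simp: mult.commute)
  have "(\<integral>z. iexp (\<theta> z) * complex_of_real (X z) \<partial>M)
      = (\<integral>z. complex_of_real (cos (\<theta> z) * X z) + \<i> * complex_of_real (sin (\<theta> z) * X z) \<partial>M)"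
    by (simp add: exp_Euler algebra_simps flip: cos_of_real sin_of_real)
  also have "\<dots> = (\<integral>z. complex_of_real (cos (\<theta> z) * X z) \<partial>M) + \<i> * (\<integral>z. complex_of_real (sin (\<theta> z) * X z) \<partial>M)"
    using i[THEN integrable_of_real[where 'a = complex]] by simp
  also have "\<dots> = complex_of_real (\<integral>z. cos (\<theta> z) * X z \<partial>M) + \<i> * complex_of_real (\<integral>z. sin (\<theta> z) * X z \<partial>M)"
    by (simp only: integral_complex_of_real)
  finally show ?thesis .
qed

end

section \<open>Additive functionals\<close>

locale additive_functional = stationary_chain +
  fixes f :: "'b \<Rightarrow> real"
  assumes f: "f \<in> L2_0 (inv_dist M S \<xi>)"
begin

interpretation F: finite_measure_subalgebra M "F K" for K
  by (rule finite_measure_subalgebra_F)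

section \<open>Blocks and bridges\<close>

lemma f_measurable [measurable]: "f \<in> borel_measurable S"
  using f by (simp add: L2_0_def)

definition block :: "int \<Rightarrow> nat \<Rightarrow> 'a \<Rightarrow> real" where
  "block a n z = (\<Sum>i=1..n. f (\<xi> (a + int i) z))"

text \<open>This is \<open>D(a, a + n)\<close> of the overview; start and length replace the two end
  points, so that lengths are natural numbers and shifts act on \<open>a\<close> alone.\<close>

definition bridge :: "int \<Rightarrow> nat \<Rightarrow> 'a \<Rightarrow> real" where
  "bridge a n z = block a n z - E {a, a + int n} (block a n) z"

lemma block_si: "sq_integrable M (block a n)"
proof -
  have "sq_integrable M (\<lambda>z. f (\<xi> k z))" for k
  proof -
    have "integrable \<pi> (\<lambda>x. (f x)\<^sup>2)" using f by (simp add: L2_0_def)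
    then have "integrable M (\<lambda>z. (f (\<xi> k z))\<^sup>2)" by (subst integrable_inv_dist[symmetric]) auto
    then show ?thesis by (simp add: sq_integrable_def)
  qed
  then show ?thesis unfolding block_def by (intro sq_integrable_sum)
qed

lemmas block_integrable = sq_integrable_integrable[OF block_si]

lemma block_measurable_F: "{a..a + int n} \<subseteq> K \<Longrightarrow> block a n \<in> borel_measurable (F K)"
  unfolding block_def
  by (intro borel_measurable_sum measurable_compose[OF chain_measurable_F f_measurable]) auto

lemma block_measurable [measurable]: "block a n \<in> borel_measurable M"
  using block_si by (rule sq_integrable_measurable)

lemma block_add: "block a (n + m) z = block a n z + block (a + int n) m z"
proof -
  have "(\<Sum>i=1..n + m. f (\<xi> (a + int i) z)) = (\<Sum>i=1..n. f (\<xi> (a + int i) z)) + (\<Sum>i=n + 1..n + m. f (\<xi> (a + int i) z))"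
    by (rule sum.ub_add_nat) simp
  also have "(\<Sum>i=n + 1..n + m. f (\<xi> (a + int i) z)) = (\<Sum>i=1..m. f (\<xi> (a + int n + int i) z))"
    using sum.shift_bounds_cl_nat_ivl[of "\<lambda>i. f (\<xi> (a + int i) z)" 1 n m] by (simp add: algebra_simps)
  finally show ?thesis by (simp add: block_def)
qed

lemma E_block_si: "sq_integrable M (E K (block a n))"
  by (rule F.sq_integrable_cond_exp[OF block_si])

lemma bridge_si: "sq_integrable M (bridge a n)"
  unfolding bridge_def by (intro sq_integrable_diff block_si E_block_si)

lemma bridge_measurable_F: "{a..a + int n} \<subseteq> K \<Longrightarrow> bridge a n \<in> borel_measurable (F K)"
  unfolding bridge_def
  by (intro borel_measurable_diff block_measurable_F measurable_F_mono[OF E_measurable(1)]) auto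

lemma block_window: "block a n z = (\<Sum>i=1..n. f (window {0..int n} a z (int i)))"
  unfolding block_def window_def by (intro sum.cong) (auto simp: add.commute)

lemma block_window_measurable:
  "(\<lambda>x. \<Sum>i=1..n. f (x (int i))) \<in> borel_measurable (Pi\<^sub>M {0..int n} (\<lambda>_. S))"
  by (intro borel_measurable_sum measurable_compose[OF measurable_component_singleton[where M = "\<lambda>_. S"] f_measurable]) auto

lemma E_block_factor:
  assumes "K \<subseteq> {0..int n}"
  obtains e where "e \<in> borel_measurable (Pi\<^sub>M {0..int n} (\<lambda>_. S))"
    "\<And>a. AE z in M. E ((\<lambda>k. k + a) ` K) (block a n) z = e (window {0..int n} a z)"
proof -
  have int: "integrable M (\<lambda>z. (\<Sum>i=1..n. f (window {0..int n} 0 z (int i))))"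
    using block_integrable[of 0 n] by (simp add: block_window[abs_def])
  show thesis
    by (rule E_window_factor[OF _ assms block_window_measurable int])
       (use that in \<open>auto simp: block_window[abs_def]\<close>)
qed

lemma integral_E_block_square_shift:
  assumes "K \<subseteq> {0..int n}"
  shows "(\<integral>z. (E ((\<lambda>k. k + a) ` K) (block a n) z)\<^sup>2 \<partial>M) = sq_norm M (E K (block 0 n))"
proof -
  obtain e where e [measurable]: "e \<in> borel_measurable (Pi\<^sub>M {0..int n} (\<lambda>_. S))"
    and eq: "\<And>a. AE z in M. E ((\<lambda>k. k + a) ` K) (block a n) z = e (window {0..int n} a z)"
    using E_block_factor[OF assms] by blast
  have *: "(\<integral>z. (E ((\<lambda>k. k + a) ` K) (block a n) z)\<^sup>2 \<partial>M) = (\<integral>z. (e (window {0..int n} a z))\<^sup>2 \<partial>M)" for a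
    using eq[of a] by (intro integral_cong_AE) auto
  show ?thesis using *[of a] *[of 0] integral_window[of "{0..int n}" "\<lambda>x. (e x)\<^sup>2" a] by simp
qed

lemma bridge_factor:
  obtains d where "d \<in> borel_measurable (Pi\<^sub>M {0..int n} (\<lambda>_. S))"
    "\<And>a. AE z in M. bridge a n z = d (window {0..int n} a z)"
proof -
  obtain e where e: "e \<in> borel_measurable (Pi\<^sub>M {0..int n} (\<lambda>_. S))"
    and eq: "\<And>a. AE z in M. E ((\<lambda>k. k + a) ` {0, int n}) (block a n) z = e (window {0..int n} a z)"
    using E_block_factor[of "{0, int n}" n] by auto
  have "AE z in M. bridge a n z = (\<Sum>i=1..n. f (window {0..int n} a z (int i))) - e (window {0..int n} a z)" for a
    using eq[of a] by eventually_elim (simp add: bridge_def block_window add.commute)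
  then show thesis
    using that[of "\<lambda>x. (\<Sum>i=1..n. f (x (int i))) - e x"] e block_window_measurable by auto
qed

text \<open>The starting state is carried along with the bridge because the conditional variance
  given \<open>\<xi> a\<close> has to be the same function for all \<open>a\<close>.\<close>

lemma integral_bridge_shift:
  fixes \<psi> :: "'b \<Rightarrow> real \<Rightarrow> real"
  assumes [measurable]: "(\<lambda>(x, y). \<psi> x y) \<in> borel_measurable (S \<Otimes>\<^sub>M borel)"
  shows "(\<integral>z. \<psi> (\<xi> a z) (bridge a n z) \<partial>M) = (\<integral>z. \<psi> (\<xi> 0 z) (bridge 0 n z) \<partial>M)"
proof -
  obtain d where d [measurable]: "d \<in> borel_measurable (Pi\<^sub>M {0..int n} (\<lambda>_. S))"
    and eq: "\<And>a. AE z in M. bridge a n z = d (window {0..int n} a z)" using bridge_factor by blast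
  note [measurable] = sq_integrable_measurable[OF bridge_si]
  have [measurable]: "(\<lambda>x. x 0) \<in> Pi\<^sub>M {0..int n} (\<lambda>_. S) \<rightarrow>\<^sub>M S"
    by (rule measurable_component_singleton) simp
  have w: "window {0..int n} a z 0 = \<xi> a z" for a z by (simp add: window_def)
  have u: "(\<lambda>x. \<psi> (x 0) (d x)) \<in> borel_measurable (Pi\<^sub>M {0..int n} (\<lambda>_. S))" by measurable
  have *: "(\<integral>z. \<psi> (\<xi> a z) (bridge a n z) \<partial>M) = (\<integral>z. \<psi> (window {0..int n} a z 0) (d (window {0..int n} a z)) \<partial>M)" for a
  proof (rule integral_cong_AE)
    show "(\<lambda>z. \<psi> (\<xi> a z) (bridge a n z)) \<in> borel_measurable M" by measurable
    show "(\<lambda>z. \<psi> (window {0..int n} a z 0) (d (window {0..int n} a z))) \<in> borel_measurable M"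
      unfolding w by measurable
    show "AE z in M. \<psi> (\<xi> a z) (bridge a n z) = \<psi> (window {0..int n} a z 0) (d (window {0..int n} a z))"
      using eq[of a] by eventually_elim (simp add: w)
  qed
  show ?thesis unfolding *[of a] *[of 0] using integral_window[OF _ u, of a] by simp
qed

section \<open>Orthogonality and variance of bridges\<close>

lemma bridge_orthogonal:
  assumes Z: "sq_integrable M Z" "Z \<in> borel_measurable (F ({..a} \<union> {a + int n..}))"
  shows "(\<integral>z. Z z * bridge a n z \<partial>M) = 0"
proof -
  \<comment> \<open>Conditioning on all times outside the open interval sees only the two end
    points, so subtracting the projection on them removes all correlation with the outside.\<close>
  have "AE x in M. E ({..a} \<union> {a + int n..}) (block a n) x = E {a, a + int n} (block a n) x"
    by (intro block_given_outside block_integrable block_measurable_F) auto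
  then have "(\<integral>z. Z z * block a n z \<partial>M) = (\<integral>z. Z z * E {a, a + int n} (block a n) z \<partial>M)"
    by (intro integral_mult_E_eq[OF sq_integrable_mult[OF Z(1) block_si] Z(2)]) auto
  then show ?thesis
    unfolding bridge_def
    using sq_integrable_mult[OF Z(1) block_si] sq_integrable_mult[OF Z(1) E_block_si]
    by (simp add: right_diff_distrib)
qed

text \<open>The large bridge differs from the small one by \<open>Z\<close>, which consists of the
  two outer blocks and the two projections. All of these are determined by times outside the
  interior of the small interval.\<close>

lemma bridge_inner_sub_bridge:
  assumes "l + k \<le> n"
  shows "(\<integral>z. bridge 0 n z * bridge (int l) k z \<partial>M) = sq_norm M (bridge (int l) k)"
proof -
  define Z where "Z z = block 0 l z + block (int (l + k)) (n - l - k) z - E {0, int n} (block 0 n) z + E {int l, int l + int k} (block (int l) k) z" for z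
  have Zsi: "sq_integrable M Z" unfolding Z_def
    by (intro sq_integrable_add sq_integrable_diff block_si E_block_si)
  have Zm: "Z \<in> borel_measurable (F ({..int l} \<union> {int l + int k..}))"
    unfolding Z_def using assms
    by (intro borel_measurable_add borel_measurable_diff block_measurable_F measurable_F_mono[OF E_measurable(1)]) auto
  have "bridge 0 n z = bridge (int l) k z + Z z" for z
  proof -
    have "block 0 n z = block 0 l z + block (int l) k z + block (int (l + k)) (n - l - k) z"
      using block_add[of 0 "l + k" "n - l - k" z] block_add[of 0 l k z] assms by simp
    then show ?thesis by (simp add: bridge_def Z_def)
  qed
  then have "(\<integral>z. bridge 0 n z * bridge (int l) k z \<partial>M) = (\<integral>z. (bridge (int l) k z)\<^sup>2 + Z z * bridge (int l) k z \<partial>M)"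
    by (simp add: algebra_simps power2_eq_square)
  also have "\<dots> = sq_norm M (bridge (int l) k)"
    using bridge_si sq_integrable_mult[OF Zsi bridge_si] bridge_orthogonal[OF Zsi Zm]
    by (simp add: sq_integrable_def)
  finally show ?thesis .
qed

definition bridge_var :: "nat \<Rightarrow> real" where
  "bridge_var n = sq_norm M (bridge 0 n)"

lemma integral_bridge_square: "sq_norm M (bridge a n) = bridge_var n"
  unfolding bridge_var_def by (rule integral_bridge_shift[where \<psi> = "\<lambda>_ y. y\<^sup>2"]) measurable

lemma sum_bridge_measurable_F:
  "(\<lambda>z. \<Sum>k<u. bridge (int (k * m)) m z) \<in> borel_measurable (F {..int (u * m)})"
proof (intro borel_measurable_sum bridge_measurable_F)
  fix k assume "k \<in> {..<u}"
  then have "Suc k * m \<le> u * m" by (intro mult_le_mono1) simp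
  then have "int (Suc k * m) \<le> int (u * m)" by (simp only: of_nat_le_iff)
  then have "int (k * m) + int m \<le> int (u * m)" by simp
  then show "{int (k * m)..int (k * m) + int m} \<subseteq> {..int (u * m)}" by auto
qed

lemma sum_bridge_si: "sq_integrable M (\<lambda>z. \<Sum>k<u. bridge (int (k * m)) m z)"
  by (intro sq_integrable_sum bridge_si)

text \<open>Each further sub-bridge is orthogonal to the earlier ones and has inner product
  \<open>bridge_var m\<close> with the large bridge, so the square expands to a loss of twice
  \<open>bridge_var m\<close> and a gain of once. Being an identity, it yields superadditivity and
  the approximation error alike.\<close>

lemma bridge_minus_sum:
  assumes "u * m \<le> n"
  shows "(\<integral>z. (bridge 0 n z - (\<Sum>k<u. bridge (int (k * m)) m z))\<^sup>2 \<partial>M) = bridge_var n - real u * bridge_var m"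
  using assms
proof (induction u)
  case 0
  show ?case by (simp add: integral_bridge_square)
next
  case (Suc u)
  let ?S = "\<lambda>z. \<Sum>k<u. bridge (int (k * m)) m z" and ?Y = "bridge (int (u * m)) m"
  note si = sq_integrable_diff[OF bridge_si[of 0 n] sum_bridge_si[of m u]]
  have orth: "(\<integral>z. ?S z * ?Y z \<partial>M) = 0"
    by (intro bridge_orthogonal sum_bridge_si measurable_F_mono[OF sum_bridge_measurable_F]) auto
  have "u * m + m \<le> n" using Suc.prems by simp
  then have in1: "(\<integral>z. bridge 0 n z * ?Y z \<partial>M) = bridge_var m"
    using bridge_inner_sub_bridge[of "u * m" m n] by (simp add: integral_bridge_square)
  have "(\<integral>z. (bridge 0 n z - ?S z) * ?Y z \<partial>M) = (\<integral>z. bridge 0 n z * ?Y z \<partial>M) - (\<integral>z. ?S z * ?Y z \<partial>M)"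
    using sq_integrable_mult[OF bridge_si[of 0 n] bridge_si[of "int (u * m)" m]]
      sq_integrable_mult[OF sum_bridge_si[of m u] bridge_si[of "int (u * m)" m]]
    by (simp add: left_diff_distrib)
  then have in2: "(\<integral>z. (bridge 0 n z - ?S z) * ?Y z \<partial>M) = bridge_var m" by (simp only: in1 orth)
  have "(\<integral>z. (bridge 0 n z - (\<Sum>k<Suc u. bridge (int (k * m)) m z))\<^sup>2 \<partial>M) = (\<integral>z. ((bridge 0 n z - ?S z) - ?Y z)\<^sup>2 \<partial>M)"
    by (simp add: diff_diff_eq)
  also have "\<dots> = (bridge_var n - real u * bridge_var m) - 2 * bridge_var m + bridge_var m"
    unfolding integral_square_diff[OF si bridge_si] in2 integral_bridge_square using Suc by simp
  finally show ?case by (simp add: algebra_simps)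
qed

lemma bridge_var_nonneg: "0 \<le> bridge_var n"
  by (simp add: bridge_var_def)

lemma bridge_var_superadditive: "real (n div m) * bridge_var m \<le> bridge_var n"
proof -
  have "n div m * m \<le> n" by simp
  from bridge_minus_sum[OF this] have "0 \<le> bridge_var n - real (n div m) * bridge_var m"
    using Bochner_Integration.integral_nonneg[of M "\<lambda>z. (bridge 0 n z - (\<Sum>k<n div m. bridge (int (k * m)) m z))\<^sup>2"]
    by (simp only: zero_le_power2)
  then show ?thesis by simp
qed

section \<open>Variance of the block sums\<close>

definition block_var :: "nat \<Rightarrow> real" where
  "block_var n = sq_norm M (block 0 n)"

lemma bridge_var_eq: "bridge_var n = block_var n - sq_norm M (E {0, int n} (block 0 n))"
  unfolding bridge_var_def block_var_def bridge_def using F.cond_exp_pythagoras[OF block_si[of 0 n], of "{0, int n}"] by simp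

definition fwd_norm :: "nat \<Rightarrow> real" where
  "fwd_norm n = L2_norm_P M (E {0} (block 0 n))"

definition bwd_norm :: "nat \<Rightarrow> real" where
  "bwd_norm n = L2_norm_P M (E {int n} (block 0 n))"

lemma fwd_norm_shift: "L2_norm_P M (E {a} (block a n)) = fwd_norm n"
  using integral_E_block_square_shift[of "{0}" n a] by (simp add: fwd_norm_def L2_norm_P_def)

lemma bwd_norm_shift: "L2_norm_P M (E {a + int n} (block a n)) = bwd_norm n"
  using integral_E_block_square_shift[of "{int n}" n a] by (simp add: bwd_norm_def L2_norm_P_def add.commute)

lemma integral_block_square: "sq_norm M (block a n) = block_var n"
proof -
  have u: "(\<lambda>x. (\<Sum>i=1..n. f (x (int i)))\<^sup>2) \<in> borel_measurable (Pi\<^sub>M {0..int n} (\<lambda>_. S))"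
    using block_window_measurable[of n] by measurable
  show ?thesis unfolding block_var_def block_window using integral_window[OF _ u, of a] by simp
qed

text \<open>The Markov property lets the projection on a distant state factor through the nearest
  state \<open>K'\<close>, and a second projection cannot increase the norm. This gives
  subadditivity in both time directions.\<close>

lemma L2_norm_tower_le:
  assumes X: "sq_integrable M X" and KL: "K \<subseteq> L" and eq: "AE z in M. E L X z = E K' X z"
  shows "L2_norm_P M (E K X) \<le> L2_norm_P M (E K' X)"
proof -
  have "AE z in M. E K (E L X) z = E K X z"
    by (intro F.real_cond_exp_nested_subalg subalgebra_F subalgebra_F_mono KL sq_integrable_integrable[OF X])
  moreover have "AE z in M. E K (E L X) z = E K (E K' X) z"
    by (intro F.real_cond_exp_cong eq) auto
  ultimately have "AE z in M. (E K X z)\<^sup>2 = (E K (E K' X) z)\<^sup>2" by eventually_elim simp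
  then have "sq_norm M (E K X) = sq_norm M (E K (E K' X))"
    by (intro integral_cong_AE) auto
  also have "\<dots> \<le> sq_norm M (E K' X)"
    by (intro F.cond_exp_L2_contraction F.sq_integrable_cond_exp X)
  finally show ?thesis by (simp add: L2_norm_P_def)
qed

lemma L2_norm_E_block_add:
  "L2_norm_P M (E K (block a (n + m))) \<le> L2_norm_P M (E K (block a n)) + L2_norm_P M (E K (block (a + int n) m))"
proof -
  have "AE z in M. E K (block a (n + m)) z = E K (block a n) z + E K (block (a + int n) m) z"
    using F.real_cond_exp_add[OF block_integrable[of a n] block_integrable[of "a + int n" m], of K]
    by (simp add: block_add[abs_def])
  then have "AE z in M. (E K (block a (n + m)) z)\<^sup>2 = (E K (block a n) z + E K (block (a + int n) m) z)\<^sup>2"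
    by eventually_elim simp
  then have "(\<integral>z. (E K (block a (n + m)) z)\<^sup>2 \<partial>M) = (\<integral>z. (E K (block a n) z + E K (block (a + int n) m) z)\<^sup>2 \<partial>M)"
    by (intro integral_cong_AE) auto
  then show ?thesis unfolding L2_norm_P_def using L2_triangle[OF E_block_si E_block_si] by simp
qed

lemma fwd_norm_subadditive: "fwd_norm (n + m) \<le> fwd_norm n + fwd_norm m"
proof -
  have "L2_norm_P M (E {0} (block (int n) m)) \<le> L2_norm_P M (E {int n} (block (int n) m))"
    by (intro L2_norm_tower_le[where L = "{..int n}"] block_si future_given_past block_integrable block_measurable_F) auto
  then show ?thesis
    using L2_norm_E_block_add[of "{0}" 0 n m] by (simp add: fwd_norm_shift)
qed

lemma bwd_norm_subadditive: "bwd_norm (n + m) \<le> bwd_norm n + bwd_norm m"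
proof -
  have "L2_norm_P M (E {int (n + m)} (block 0 n)) \<le> L2_norm_P M (E {int n} (block 0 n))"
    by (intro L2_norm_tower_le[where L = "{int n..}"] block_si past_given_future_integrable block_integrable block_measurable_F) auto
  moreover have "L2_norm_P M (E {int (n + m)} (block (int n) m)) = bwd_norm m"
    using bwd_norm_shift[of "int n" m] by simp
  ultimately show ?thesis
    using L2_norm_E_block_add[of "{int (n + m)}" 0 n m] by (simp add: bwd_norm_def)
qed

text \<open>Adjacent blocks interact only through the state between them: the later block is
  conditioned on the past, then the earlier one on that state.\<close>

lemma block_var_nearly_additive:
  "\<bar>block_var (n + m) - block_var n - block_var m\<bar> \<le> (bwd_norm n)\<^sup>2 + (fwd_norm m)\<^sup>2"
proof -
  let ?X = "block 0 n" and ?Y = "block (int n) m"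
  have "block_var (n + m) = (\<integral>z. (?X z + ?Y z)\<^sup>2 \<partial>M)" by (simp add: block_var_def block_add)
  also have "\<dots> = block_var n + 2 * (\<integral>z. ?X z * ?Y z \<partial>M) + block_var m"
    by (simp add: integral_square_add[OF block_si block_si] integral_block_square)
  finally have 1: "block_var (n + m) - block_var n - block_var m = 2 * (\<integral>z. ?X z * ?Y z \<partial>M)" by simp
  have "AE x in M. E {..int n} ?Y x = E {int n} ?Y x"
    by (intro future_given_past block_integrable block_measurable_F) auto
  then have "(\<integral>z. ?X z * ?Y z \<partial>M) = (\<integral>z. ?X z * E {int n} ?Y z \<partial>M)"
    by (intro integral_mult_E_eq[where K = "{..int n}"] sq_integrable_mult block_si block_measurable_F) auto
  also have "\<dots> = (\<integral>z. E {int n} ?Y z * ?X z \<partial>M)" by (simp add: mult.commute)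
  also have "\<dots> = (\<integral>z. E {int n} ?Y z * E {int n} ?X z \<partial>M)"
    by (intro F.cond_exp_L2_inner[symmetric] block_si E_block_si) auto
  finally have "\<bar>\<integral>z. ?X z * ?Y z \<partial>M\<bar> \<le> fwd_norm m * bwd_norm n"
    using abs_integral_mult_le[OF E_block_si[of "{int n}" "int n" m] E_block_si[of "{int n}" 0 n]]
      fwd_norm_shift[of "int n" m] by (simp add: bwd_norm_def L2_norm_P_def)
  \<comment> \<open>The inequality between arithmetic and geometric mean separates \<open>n\<close>
    from \<open>m\<close>, the form in which the lemmas on nearly additive sequences take their
    error.\<close>
  moreover have "2 * (fwd_norm m * bwd_norm n) \<le> (bwd_norm n)\<^sup>2 + (fwd_norm m)\<^sup>2"
    using zero_le_power2[of "fwd_norm m - bwd_norm n"] by (simp add: power2_eq_square algebra_simps)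
  ultimately show ?thesis unfolding 1 by linarith
qed

lemma block_var_limit:
  assumes fwd: "summable (\<lambda>n. (fwd_norm (Suc n))\<^sup>2 / (real (Suc n))\<^sup>2)"
    and bwd: "summable (\<lambda>n. (bwd_norm (Suc n))\<^sup>2 / (real (Suc n))\<^sup>2)"
  obtains s2 where "0 \<le> s2" "(\<lambda>n. block_var n / real n) \<longlonglongrightarrow> s2"
proof -
  have nn: "0 \<le> fwd_norm n" "0 \<le> bwd_norm n" for n
    by (simp_all add: fwd_norm_def bwd_norm_def L2_norm_P_def)
  note fs = subadditive_square_summable_imp[OF nn(1) fwd_norm_subadditive fwd]
  note bs = subadditive_square_summable_imp[OF nn(2) bwd_norm_subadditive bwd]
  obtain s2 where "(\<lambda>k. block_var (2 ^ k) / 2 ^ k) \<longlonglongrightarrow> s2"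
    using dyadic_limit_of_nearly_additive[OF block_var_nearly_additive fs(2) bs(2)] by (auto simp: convergent_def)
  then have lim: "(\<lambda>n. block_var n / real n) \<longlonglongrightarrow> s2"
    by (rule nearly_additive_limit[OF block_var_nearly_additive fs(1) bs(1)])
  then have "0 \<le> s2"
    by (rule LIMSEQ_le_const) (auto simp: block_var_def)
  then show thesis using that lim by blast
qed

section \<open>Central limit theorem for bridges\<close>

interpretation \<pi>: prob_space \<pi>
  by (rule prob_space_inv_dist)

text \<open>The conditional variance must be one function of the state for all starting times,
  because the coboundary equation is solved for it on the state space. A conditional expectation on
  \<open>M\<close> does not come as such a function, so \<open>g\<close> is taken as a Radon-Nikodym
  derivative on \<open>S\<close>.\<close>

lemma bridge_cond_var:
  obtains g where "g \<in> borel_measurable S" "integrable \<pi> g" "(\<integral>x. g x \<partial>\<pi>) = bridge_var n"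
    "\<And>a. AE z in M. E {..a} (\<lambda>z. (bridge a n z)\<^sup>2) z = g (\<xi> a z)"
proof -
  note [measurable] = sq_integrable_measurable[OF bridge_si]
  have b2: "integrable M (\<lambda>z. (bridge a n z)\<^sup>2)" for a
    by (rule sq_integrable_square[OF bridge_si])
  define N where "N = density M (\<lambda>z. ennreal ((bridge 0 n z)\<^sup>2))"
  have [measurable_cong]: "sets N = sets M" by (simp add: N_def)
  \<comment> \<open>\<open>\<nu>\<close> is the law of \<open>\<xi> 0\<close> weighted by the
    squared bridge; its density with respect to \<open>\<pi>\<close> is the conditional variance
    given the starting state.\<close>
  define \<nu> where "\<nu> = distr N S (\<xi> 0)"
  have \<nu>: "emeasure \<nu> A = (\<integral>\<^sup>+z. ennreal ((bridge 0 n z)\<^sup>2) * indicator (\<xi> 0 -` A \<inter> space M) z \<partial>M)" if [measurable]: "A \<in> sets S" for A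
    unfolding \<nu>_def by (subst emeasure_distr) (auto simp: N_def emeasure_density)
  have fin: "(\<integral>\<^sup>+z. ennreal ((bridge 0 n z)\<^sup>2) \<partial>M) < \<infinity>"
    using b2 by (subst nn_integral_eq_integral) auto
  have "finite_measure \<nu>"
  proof (rule finite_measureI)
    have "emeasure \<nu> (space \<nu>) \<le> (\<integral>\<^sup>+z. ennreal ((bridge 0 n z)\<^sup>2) \<partial>M)"
      unfolding \<nu>[of "space S"] by (auto simp: \<nu>_def[symmetric] \<nu> space_distr[of N S "\<xi> 0", folded \<nu>_def] intro!: nn_integral_mono split: split_indicator)
    then show "emeasure \<nu> (space \<nu>) \<noteq> \<infinity>" using fin by (auto simp: top_unique)
  qed
  moreover have ac: "absolutely_continuous \<pi> \<nu>"
    unfolding absolutely_continuous_def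
  proof
    fix A assume "A \<in> null_sets \<pi>"
    then have A: "A \<in> sets S" "emeasure \<pi> A = 0" by auto
    then have "emeasure M (\<xi> 0 -` A \<inter> space M) = 0"
      using emeasure_distr[OF chain_measurable A(1), of 0] by (simp add: inv_dist_def)
    then have "AE z in M. z \<notin> \<xi> 0 -` A \<inter> space M"
      using A by (intro AE_not_in) (auto simp: null_sets_def)
    then have "emeasure \<nu> A = (\<integral>\<^sup>+z. 0 \<partial>M)"
      unfolding \<nu>[OF A(1)] by (intro nn_integral_cong_AE) (auto elim!: eventually_mono)
    then show "A \<in> null_sets \<nu>" using A by (auto simp: null_sets_def \<nu>_def)
  qed
  moreover have s: "sets \<nu> = sets \<pi>" by (simp add: \<nu>_def)
  ultimately obtain g where g: "g \<in> borel_measurable \<pi>" "AE x in \<pi>. RN_deriv \<pi> \<nu> x = ennreal (g x)" "\<And>x. 0 \<le> g x"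
    using \<pi>.real_RN_deriv by metis
  have gm [measurable]: "g \<in> borel_measurable S" using g(1) by simp
  have dens: "density \<pi> (\<lambda>x. ennreal (g x)) = \<nu>"
  proof -
    have "density \<pi> (RN_deriv \<pi> \<nu>) = \<nu>" by (rule \<pi>.density_RN_deriv[OF ac s])
    moreover have "density \<pi> (RN_deriv \<pi> \<nu>) = density \<pi> (\<lambda>x. ennreal (g x))"
      using g by (intro density_cong) auto
    ultimately show ?thesis by simp
  qed
  have nn: "(\<integral>\<^sup>+x. ennreal (g x) * indicator A x \<partial>\<pi>) = (\<integral>\<^sup>+z. ennreal ((bridge 0 n z)\<^sup>2) * indicator (\<xi> 0 -` A \<inter> space M) z \<partial>M)"
    if "A \<in> sets S" for A
    using that \<nu>[OF that] emeasure_density[of "\<lambda>x. ennreal (g x)" \<pi> A] unfolding dens by simp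
  have "(\<integral>\<^sup>+x. ennreal (g x) \<partial>\<pi>) = (\<integral>\<^sup>+x. ennreal (g x) * indicator (space S) x \<partial>\<pi>)"
    by (intro nn_integral_cong) (auto simp: inv_dist_def)
  also have "\<dots> \<le> (\<integral>\<^sup>+z. ennreal ((bridge 0 n z)\<^sup>2) \<partial>M)"
    unfolding nn[OF sets.top] by (intro nn_integral_mono) (auto split: split_indicator)
  finally have "(\<integral>\<^sup>+x. ennreal (g x) \<partial>\<pi>) < \<infinity>" using fin by simp
  then have gi: "integrable \<pi> g" using g by (intro integrableI_nonneg) auto
  have ind: "(\<integral>x. indicator A x * g x \<partial>\<pi>) = (\<integral>z. indicator A (\<xi> 0 z) * (bridge 0 n z)\<^sup>2 \<partial>M)" if [measurable]: "A \<in> sets S" for A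
  proof -
    have "(\<integral>x. indicator A x * g x \<partial>\<pi>) = enn2real (\<integral>\<^sup>+x. ennreal (g x) * indicator A x \<partial>\<pi>)"
      using g(3) by (subst integral_eq_nn_integral) (auto simp: ennreal_mult' ennreal_indicator mult.commute)
    also have "\<dots> = enn2real (\<integral>\<^sup>+z. ennreal (indicator A (\<xi> 0 z) * (bridge 0 n z)\<^sup>2) \<partial>M)"
      unfolding nn[OF that] by (intro arg_cong[where f = enn2real] nn_integral_cong) (auto split: split_indicator)
    also have "\<dots> = (\<integral>z. indicator A (\<xi> 0 z) * (bridge 0 n z)\<^sup>2 \<partial>M)"
      by (subst integral_eq_nn_integral) auto
    finally show ?thesis .
  qed
  have gxi: "integrable M (\<lambda>z. g (\<xi> a z))" for a using gi integrable_inv_dist[OF gm] by blast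
  have E1: "AE z in M. E {a} (\<lambda>z. (bridge a n z)\<^sup>2) z = g (\<xi> a z)" for a
  proof (rule F.real_cond_exp_charact[OF _ b2 gxi])
    show "(\<lambda>z. g (\<xi> a z)) \<in> borel_measurable (F {a})"
      by (rule measurable_compose[OF chain_measurable_F gm]) simp
    fix A' assume "A' \<in> sets (F {a})"
    then obtain A where A [measurable]: "A \<in> sets S" and A': "A' = \<xi> a -` A \<inter> space M" by (auto simp: sets_F_singleton)
    have *: "(\<integral>z\<in>A'. X z \<partial>M) = (\<integral>z. indicator A (\<xi> a z) * X z \<partial>M)" for X :: "'a \<Rightarrow> real"
      unfolding set_lebesgue_integral_def by (intro Bochner_Integration.integral_cong) (auto simp: A' split: split_indicator)
    have "(\<integral>z. indicator A (\<xi> a z) * (bridge a n z)\<^sup>2 \<partial>M) = (\<integral>z. indicator A (\<xi> 0 z) * (bridge 0 n z)\<^sup>2 \<partial>M)"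
      by (rule integral_bridge_shift[where \<psi> = "\<lambda>x y. indicator A x * y\<^sup>2"]) measurable
    also have "\<dots> = (\<integral>x. indicator A x * g x \<partial>\<pi>)" by (rule ind[OF A, symmetric])
    also have "\<dots> = (\<integral>z. indicator A (\<xi> a z) * g (\<xi> a z) \<partial>M)"
      by (rule integral_inv_dist) measurable
    finally show "(\<integral>z\<in>A'. (bridge a n z)\<^sup>2 \<partial>M) = (\<integral>z\<in>A'. g (\<xi> a z) \<partial>M)" by (simp add: *)
  qed
  \<comment> \<open>The bridge depends on times from \<open>a\<close> on, so the whole past tells no
    more about it than \<open>\<xi> a\<close>.\<close>
  have E2: "AE z in M. E {..a} (\<lambda>z. (bridge a n z)\<^sup>2) z = E {a} (\<lambda>z. (bridge a n z)\<^sup>2) z" for a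
    using bridge_measurable_F[of a n "{a..}"] by (intro future_given_past b2) auto
  have "AE z in M. E {..a} (\<lambda>z. (bridge a n z)\<^sup>2) z = g (\<xi> a z)" for a
    using E1[of a] E2[of a] by eventually_elim simp
  moreover have "(\<integral>x. g x \<partial>\<pi>) = bridge_var n"
  proof -
    have "(\<integral>x. g x \<partial>\<pi>) = (\<integral>z. E {0} (\<lambda>z. (bridge 0 n z)\<^sup>2) z \<partial>M)"
      unfolding integral_inv_dist[OF gm, of 0] using E1[of 0] by (intro integral_cong_AE) auto
    also have "\<dots> = bridge_var n" unfolding bridge_var_def by (rule F.real_cond_exp_int(2)[OF b2])
    finally show ?thesis .
  qed
  ultimately show thesis using that gm gi by blast
qed

text \<open>\<open>C\<close> is the norm of the approximate solution \<phi>; it is chosen from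
  \<open>m\<close> and \<epsilon> before \<open>s\<close> and \<open>u\<close>, so its terms
  disappear as \<open>s\<close> tends to 0 however large it is. The factor 2 in
  \<open>2 * \<epsilon>\<close> counts the real and the imaginary part.\<close>

lemma bridge_sum_char_error:
  assumes erg: "totally_ergodic \<pi> Q" and m: "1 \<le> m" and \<epsilon>: "0 < \<epsilon>"
  obtains C where "0 \<le> C"
    "\<And>s u. cmod ((\<integral>z. iexp (s * (\<Sum>k<u. bridge (int (k * m)) m z)) \<partial>M) - exp (- (s\<^sup>2 * bridge_var m / 2)) ^ u)
      \<le> real u * ((\<integral>z. min ((s * bridge 0 m z)\<^sup>2) (\<bar>s * bridge 0 m z\<bar> ^ 3) \<partial>M) + (s\<^sup>2 * bridge_var m)\<^sup>2
        + s\<^sup>2 / 2 * (2 * \<epsilon> + (\<bar>s\<bar> * sqrt (bridge_var m) * C + s\<^sup>2 * bridge_var m * C))) + s\<^sup>2 * C"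
proof -
  let ?v = "bridge_var m" and ?P = "markov_op Q ^^ m"
  obtain g where g: "g \<in> borel_measurable S" "integrable \<pi> g" "(\<integral>x. g x \<partial>\<pi>) = ?v"
    and gE: "\<And>a. AE z in M. E {..a} (\<lambda>z. (bridge a m z)\<^sup>2) z = g (\<xi> a z)" using bridge_cond_var by blast
  have "integrable \<pi> (\<lambda>x. g x - ?v)" "(\<integral>x. g x - ?v \<partial>\<pi>) = 0"
    using g by (auto simp: \<pi>.prob_space)
  then obtain \<phi> where \<phi>: "sq_integrable \<pi> \<phi>" and r: "(\<integral>x. \<bar>(g x - ?v) - \<phi> x + ?P \<phi> x\<bar> \<partial>\<pi>) \<le> \<epsilon>"
    using L1_coboundary_approx[OF erg m _ _ \<epsilon>] by blast
  have [measurable]: "g \<in> borel_measurable S" "\<phi> \<in> borel_measurable S" "?P \<phi> \<in> borel_measurable S"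
    using g sq_integrable_measurable[OF \<phi>] markov_op_L2(1)[OF \<phi>] by auto
  define \<Phi> where "\<Phi> k z = \<phi> (\<xi> (int (k * m)) z)" for k z
  define C where "C = sqrt (sq_norm \<pi> \<phi>)"
  have C0: "0 \<le> C" by (simp add: C_def)
  have \<Phi>si: "sq_integrable M (\<Phi> k)" for k
    unfolding \<Phi>_def using \<phi> sq_integrable_inv_dist[of \<phi>] by simp
  have \<Phi>C: "sq_norm M (\<Phi> k) \<le> C\<^sup>2" for k
    unfolding \<Phi>_def C_def using integral_inv_dist[of "\<lambda>x. (\<phi> x)\<^sup>2" "int (k * m)"] by simp
  let ?D = "\<lambda>k. bridge (int (k * m)) m"
  let ?\<theta> = "\<lambda>s k z. s * (\<Sum>j<k. ?D j z)"
  have \<theta>F: "?\<theta> s k \<in> borel_measurable (F {..int (k * m)})" for s k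
    using sum_bridge_measurable_F[of m k] by simp
  note \<theta>M = measurable_F_M[OF \<theta>F]
  have mart: "(\<integral>z. iexp (?\<theta> s k z) * complex_of_real (?D k z) \<partial>M) = 0" for s k
  proof -
    \<comment> \<open>\<open>W\<close> will be cosine or sine; bounded functions of the earlier
      bridges are admissible test variables for orthogonality.\<close>
    have *: "(\<integral>z. W (?\<theta> s k z) * ?D k z \<partial>M) = 0" if W: "W \<in> borel_measurable borel" "\<And>x. \<bar>W x\<bar> \<le> 1" for W :: "real \<Rightarrow> real"
    proof (rule bridge_orthogonal)
      show "sq_integrable M (\<lambda>z. W (?\<theta> s k z))"
        using W measurable_compose[OF \<theta>M W(1)] by (intro sq_integrable_bounded[of _ 1]) auto
      show "(\<lambda>z. W (?\<theta> s k z)) \<in> borel_measurable (F ({..int (k * m)} \<union> {int (k * m) + int m..}))"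
        by (rule measurable_F_mono[OF measurable_compose[OF \<theta>F W(1)]]) auto
    qed
    show ?thesis
      unfolding integral_iexp_mult_split[OF \<theta>M sq_integrable_integrable[OF bridge_si]]
      using *[of cos] *[of sin] by simp
  qed
  have cob: "cmod (\<integral>z. iexp (?\<theta> s k z) * complex_of_real ((?D k z)\<^sup>2 - ?v - \<Phi> k z + \<Phi> (Suc k) z) \<partial>M) \<le> 2 * \<epsilon>" for s k
  proof -
    let ?a = "int (k * m)"
    note [measurable] = sq_integrable_measurable[OF bridge_si]
    have i1: "integrable M (\<lambda>z. (?D k z)\<^sup>2)" by (rule sq_integrable_square[OF bridge_si])
    have i2: "integrable M (\<Phi> k)" "integrable M (\<Phi> (Suc k))" by (rule sq_integrable_integrable[OF \<Phi>si])+
    have i3: "integrable M (\<lambda>z. g (\<xi> ?a z))" using g integrable_inv_dist[of g] by simp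
    have i4: "integrable M (\<lambda>z. ?P \<phi> (\<xi> ?a z))"
      using markov_op_L2(2)[OF \<phi>, of m] sq_integrable_inv_dist[of "?P \<phi>"] sq_integrable_integrable by simp
    have \<Phi>Suc: "\<Phi> (Suc k) = (\<lambda>z. \<phi> (\<xi> (?a + int m) z))" by (simp add: \<Phi>_def[abs_def] algebra_simps)
    have *: "\<bar>\<integral>z. W (?\<theta> s k z) * ((?D k z)\<^sup>2 - ?v - \<Phi> k z + \<Phi> (Suc k) z) \<partial>M\<bar> \<le> \<epsilon>"
      if W: "W \<in> borel_measurable borel" "\<And>x. \<bar>W x\<bar> \<le> 1" for W :: "real \<Rightarrow> real"
    proof -
      define w where "w z = W (?\<theta> s k z)" for z
      have wF: "w \<in> borel_measurable (F {..?a})" unfolding w_def by (rule measurable_compose[OF \<theta>F W(1)])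
      have wM [measurable]: "w \<in> borel_measurable M" using measurable_F_M[OF wF] .
      have w1: "AE z in M. \<bar>w z\<bar> \<le> 1" using W by (simp add: w_def)
      have wi: "integrable M (\<lambda>z. w z * X z)" if "integrable M X" for X
        using integrable_mult_AE_bounded[OF that wM w1] by (simp add: mult.commute)
      \<comment> \<open>Conditioning on the past turns the squared bridge into \<open>g\<close> and
        the next value of \<phi> into its image under the \<open>m\<close>-th power, both at the
        present state. What is left is the residual of the coboundary equation, small in
        \<open>L1\<close>.\<close>
      have e1: "(\<integral>z. w z * (?D k z)\<^sup>2 \<partial>M) = (\<integral>z. w z * g (\<xi> ?a z) \<partial>M)"
        by (rule integral_mult_E_eq[OF wi[OF i1] wF _ gE]) auto
      have e2: "(\<integral>z. w z * \<Phi> (Suc k) z \<partial>M) = (\<integral>z. w z * ?P \<phi> (\<xi> ?a z) \<partial>M)"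
        unfolding \<Phi>Suc
        by (rule integral_mult_E_eq[OF wi[OF i2(2)[unfolded \<Phi>Suc]] wF _ markov_op_L2(5)[OF \<phi>]]) auto
      have wc: "integrable M (\<lambda>z. w z * ?v)" by (rule wi) simp
      have "(\<integral>z. w z * ((?D k z)\<^sup>2 - ?v - \<Phi> k z + \<Phi> (Suc k) z) \<partial>M)
          = (\<integral>z. w z * (?D k z)\<^sup>2 - w z * ?v - w z * \<Phi> k z + w z * \<Phi> (Suc k) z \<partial>M)"
        by (simp only: right_diff_distrib distrib_left)
      also have "\<dots> = (\<integral>z. w z * (?D k z)\<^sup>2 \<partial>M) - (\<integral>z. w z * ?v \<partial>M) - (\<integral>z. w z * \<Phi> k z \<partial>M) + (\<integral>z. w z * \<Phi> (Suc k) z \<partial>M)"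
        using wi[OF i1] wi[OF i2(1)] wi[OF i2(2)] wc by (simp del: integral_mult_left_zero integral_mult_left)
      also have "\<dots> = (\<integral>z. w z * g (\<xi> ?a z) - w z * ?v - w z * \<Phi> k z + w z * ?P \<phi> (\<xi> ?a z) \<partial>M)"
        unfolding e1 e2
        using wi[OF i3] wi[OF i2(1)] wi[OF i4] wc by (simp del: integral_mult_left_zero integral_mult_left)
      also have "\<dots> = (\<integral>z. w z * ((g (\<xi> ?a z) - ?v) - \<phi> (\<xi> ?a z) + ?P \<phi> (\<xi> ?a z)) \<partial>M)"
        by (simp only: right_diff_distrib distrib_left \<Phi>_def)
      finally have eq: "(\<integral>z. w z * ((?D k z)\<^sup>2 - ?v - \<Phi> k z + \<Phi> (Suc k) z) \<partial>M)
          = (\<integral>z. w z * ((g (\<xi> ?a z) - ?v) - \<phi> (\<xi> ?a z) + ?P \<phi> (\<xi> ?a z)) \<partial>M)" .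
      have ri: "integrable M (\<lambda>z. (g (\<xi> ?a z) - ?v) - \<phi> (\<xi> ?a z) + ?P \<phi> (\<xi> ?a z))"
        using i3 i4 i2(1) by (auto simp: \<Phi>_def[abs_def])
      have "\<bar>\<integral>z. w z * ((?D k z)\<^sup>2 - ?v - \<Phi> k z + \<Phi> (Suc k) z) \<partial>M\<bar>
          \<le> (\<integral>z. \<bar>w z * ((g (\<xi> ?a z) - ?v) - \<phi> (\<xi> ?a z) + ?P \<phi> (\<xi> ?a z))\<bar> \<partial>M)"
        unfolding eq by (rule integral_abs_bound)
      also have "\<dots> \<le> (\<integral>z. \<bar>(g (\<xi> ?a z) - ?v) - \<phi> (\<xi> ?a z) + ?P \<phi> (\<xi> ?a z)\<bar> \<partial>M)"
        using integrable_abs[OF wi[OF ri]] integrable_abs[OF ri] W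
        by (intro integral_mono) (auto simp: w_def abs_mult mult_left_le_one_le)
      also have "\<dots> = (\<integral>x. \<bar>(g x - ?v) - \<phi> x + ?P \<phi> x\<bar> \<partial>\<pi>)"
        by (rule integral_inv_dist[symmetric]) measurable
      finally show ?thesis using r by (simp add: w_def)
    qed
    have xi: "integrable M (\<lambda>z. (?D k z)\<^sup>2 - ?v - \<Phi> k z + \<Phi> (Suc k) z)" using i1 i2 by auto
    have tri: "cmod (complex_of_real x + \<i> * complex_of_real y) \<le> \<bar>x\<bar> + \<bar>y\<bar>" for x y
      using norm_triangle_ineq[of "complex_of_real x" "\<i> * complex_of_real y"] by (simp add: norm_mult)
    have cs: "\<bar>\<integral>z. cos (?\<theta> s k z) * ((?D k z)\<^sup>2 - ?v - \<Phi> k z + \<Phi> (Suc k) z) \<partial>M\<bar> \<le> \<epsilon>"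
      "\<bar>\<integral>z. sin (?\<theta> s k z) * ((?D k z)\<^sup>2 - ?v - \<Phi> k z + \<Phi> (Suc k) z) \<partial>M\<bar> \<le> \<epsilon>"
      by (rule *[of cos] *[of sin]; simp)+
    show ?thesis
      unfolding integral_iexp_mult_split[OF \<theta>M xi] by (rule order_trans[OF tri]) (use cs in linarith)
  qed
  have lind: "(\<integral>z. min ((s * ?D k z)\<^sup>2) (\<bar>s * ?D k z\<bar> ^ 3) \<partial>M) \<le> (\<integral>z. min ((s * bridge 0 m z)\<^sup>2) (\<bar>s * bridge 0 m z\<bar> ^ 3) \<partial>M)" for s k
    by (rule eq_refl, rule integral_bridge_shift[where \<psi> = "\<lambda>_ y. min ((s * y)\<^sup>2) (\<bar>s * y\<bar> ^ 3)"]) measurable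
  show thesis
  proof (rule that[OF C0])
    fix s u
    show "cmod ((\<integral>z. iexp (s * (\<Sum>k<u. bridge (int (k * m)) m z)) \<partial>M) - exp (- (s\<^sup>2 * bridge_var m / 2)) ^ u)
      \<le> real u * ((\<integral>z. min ((s * bridge 0 m z)\<^sup>2) (\<bar>s * bridge 0 m z\<bar> ^ 3) \<partial>M) + (s\<^sup>2 * bridge_var m)\<^sup>2
        + s\<^sup>2 / 2 * (2 * \<epsilon> + (\<bar>s\<bar> * sqrt (bridge_var m) * C + s\<^sup>2 * bridge_var m * C))) + s\<^sup>2 * C"
      by (rule char_martingale_sum_error[where D = ?D and \<Phi> = \<Phi> and s = s and n = u, OF bridge_si integral_bridge_square \<Phi>si \<Phi>C C0 mart cob lind])
  qed
qed

lemma bridge_sum_char_limit: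
  assumes erg: "totally_ergodic \<pi> Q" and m: "1 \<le> m"
  shows "(\<lambda>n. \<integral>z. iexp (t / sqrt (real n) * (\<Sum>k<n div m. bridge (int (k * m)) m z)) \<partial>M)
    \<longlonglongrightarrow> complex_of_real (exp (- (t\<^sup>2 * (bridge_var m / real m) / 2)))"
proof -
  define v where "v = bridge_var m"
  have v0: "0 \<le> v" by (simp add: v_def bridge_var_nonneg)
  define s where "s n = t / sqrt (real n)" for n :: nat
  have s: "s \<longlonglongrightarrow> 0" unfolding s_def by (rule const_over_sqrt_tendsto_0)
  define L where "L n = (\<integral>z. min ((s n * bridge 0 m z)\<^sup>2) (\<bar>s n * bridge 0 m z\<bar> ^ 3) \<partial>M)" for n
  have L: "(\<lambda>n. real n * L n) \<longlonglongrightarrow> 0" unfolding L_def s_def by (rule Lindeberg_term_tendsto_0[OF bridge_si])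
  have L0: "0 \<le> L n" for n unfolding L_def by (rule Bochner_Integration.integral_nonneg) simp
  define u where "u n = n div m" for n
  define Z where "Z n = (\<integral>z. iexp (s n * (\<Sum>k<u n. bridge (int (k * m)) m z)) \<partial>M)" for n
  define c where "c n = exp (- ((s n)\<^sup>2 * v / 2)) ^ u n" for n
  have s2: "(s n)\<^sup>2 = t\<^sup>2 / real n" for n by (simp add: s_def power_divide)
  have un: "real (u n) \<le> real n" for n by (simp add: u_def)
  have us: "real (u n) * (s n)\<^sup>2 \<le> t\<^sup>2" for n
  proof (cases "n = 0")
    case False
    have "real (u n) * (s n)\<^sup>2 \<le> real n * (s n)\<^sup>2" by (rule mult_right_mono[OF un]) simp
    then show ?thesis using False by (simp add: s2)
  qed (simp add: u_def)
  have clim: "(\<lambda>n. complex_of_real (c n)) \<longlonglongrightarrow> complex_of_real (exp (- (t\<^sup>2 * (v / real m) / 2)))"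
  proof -
    have "c n = exp (- (t\<^sup>2 * v / 2 * (real (n div m) / real n)))" for n
      unfolding c_def exp_of_nat_mult[symmetric] s2 u_def by (simp add: mult_ac)
    moreover have "(\<lambda>n. exp (- (t\<^sup>2 * v / 2 * (real (n div m) / real n)))) \<longlonglongrightarrow> exp (- (t\<^sup>2 * v / 2 * (1 / real m)))"
      using m by (intro tendsto_intros real_div_over_tendsto) simp
    ultimately show ?thesis by (intro tendsto_of_real) (simp add: field_simps)
  qed
  have "(\<lambda>n. Z n - complex_of_real (c n)) \<longlonglongrightarrow> 0"
  proof (rule LIMSEQ_I)
    fix r :: real assume r: "0 < r"
    \<comment> \<open>The order of choices is \<epsilon> before \<open>C\<close>, and
      \<open>C\<close> before \<open>n\<close>. As \<open>u n * (s n)^2\<close> stays below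
      \<open>t^2\<close>, the term with \<epsilon> contributes at most
      \<open>t^2 * \<epsilon>\<close>, while all others tend to 0; the added 1 keeps the denominator
      positive for \<open>t = 0\<close>.\<close>
    define \<epsilon> where "\<epsilon> = (r / 2) / (t\<^sup>2 + 1)"
    have t1: "0 < t\<^sup>2 + 1" by (simp add: add_nonneg_pos)
    have \<epsilon>: "0 < \<epsilon>" "t\<^sup>2 * \<epsilon> < r"
    proof -
      show "0 < \<epsilon>" using r t1 by (simp add: \<epsilon>_def)
      have "t\<^sup>2 * \<epsilon> \<le> (t\<^sup>2 + 1) * \<epsilon>" using \<open>0 < \<epsilon>\<close> by (intro mult_right_mono) auto
      also have "\<dots> = r / 2"
        unfolding \<epsilon>_def using t1 by (subst times_divide_eq_right, subst nonzero_mult_div_cancel_left) auto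
      finally show "t\<^sup>2 * \<epsilon> < r" using r by simp
    qed
    obtain C where C: "0 \<le> C" and bnd: "\<And>s u. cmod ((\<integral>z. iexp (s * (\<Sum>k<u. bridge (int (k * m)) m z)) \<partial>M) - exp (- (s\<^sup>2 * v / 2)) ^ u)
      \<le> real u * ((\<integral>z. min ((s * bridge 0 m z)\<^sup>2) (\<bar>s * bridge 0 m z\<bar> ^ 3) \<partial>M) + (s\<^sup>2 * v)\<^sup>2
        + s\<^sup>2 / 2 * (2 * \<epsilon> + (\<bar>s\<bar> * sqrt v * C + s\<^sup>2 * v * C))) + s\<^sup>2 * C"
      using bridge_sum_char_error[OF erg m \<epsilon>(1)] unfolding v_def by blast
    define y where "y n = \<bar>s n\<bar> * sqrt v * C + (s n)\<^sup>2 * v * C" for n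
    have y0: "0 \<le> y n" for n using v0 C by (simp add: y_def)
    define R where "R n = real n * L n + t\<^sup>2 * ((s n)\<^sup>2 * v\<^sup>2) + t\<^sup>2 / 2 * (2 * \<epsilon> + y n) + (s n)\<^sup>2 * C" for n
    have "R \<longlonglongrightarrow> 0 + t\<^sup>2 * (0\<^sup>2 * v\<^sup>2) + t\<^sup>2 / 2 * (2 * \<epsilon> + (\<bar>0\<bar> * sqrt v * C + 0\<^sup>2 * v * C)) + 0\<^sup>2 * C"
      unfolding R_def y_def by (intro tendsto_intros L s)
    then have "R \<longlonglongrightarrow> t\<^sup>2 * \<epsilon>" by simp
    then have ev: "\<forall>\<^sub>F n in sequentially. R n < r" using \<epsilon>(2) by (rule order_tendstoD(2))
    have le: "cmod (Z n - complex_of_real (c n)) \<le> R n" for n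
    proof -
      have "cmod (Z n - complex_of_real (c n)) \<le> real (u n) * (L n + ((s n)\<^sup>2 * v)\<^sup>2 + (s n)\<^sup>2 / 2 * (2 * \<epsilon> + y n)) + (s n)\<^sup>2 * C"
        using bnd[of "s n" "u n"] unfolding Z_def c_def L_def y_def by simp
      also have "\<dots> = real (u n) * L n + (real (u n) * (s n)\<^sup>2) * ((s n)\<^sup>2 * v\<^sup>2) + (real (u n) * (s n)\<^sup>2) / 2 * (2 * \<epsilon> + y n) + (s n)\<^sup>2 * C"
        by (simp add: power2_eq_square algebra_simps)
      also have "\<dots> \<le> R n"
        unfolding R_def using un[of n] us[of n] L0[of n] y0[of n] \<epsilon>(1) C
        by (intro add_mono mult_right_mono divide_right_mono) auto
      finally show ?thesis .
    qed
    show "\<exists>N. \<forall>n\<ge>N. norm (Z n - complex_of_real (c n) - 0) < r"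
      using eventually_mono[OF ev, of "\<lambda>n. norm (Z n - complex_of_real (c n) - 0) < r"] le
      unfolding eventually_sequentially by (auto intro: le_less_trans)
  qed
  from tendsto_add[OF this clim] have "Z \<longlonglongrightarrow> complex_of_real (exp (- (t\<^sup>2 * (v / real m) / 2)))" by simp
  then show ?thesis unfolding Z_def[abs_def] s_def u_def v_def .
qed

text \<open>The block length \<open>m\<close> is fixed before \<open>n\<close> grows. The thirds of
  \<open>r\<close> pay for replacing the bridge by its sub-bridges, for the limit theorem at fixed
  \<open>m\<close>, and for replacing \<open>bridge_var m / m\<close> by its limit.\<close>

lemma bridge_char_limit:
  assumes erg: "totally_ergodic \<pi> Q" and lim: "(\<lambda>n. bridge_var n / real n) \<longlonglongrightarrow> \<theta>2"
    and le: "\<And>n. 1 \<le> n \<Longrightarrow> bridge_var n / real n \<le> \<theta>2"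
  shows "(\<lambda>n. \<integral>z. iexp (t / sqrt (real n) * bridge 0 n z) \<partial>M) \<longlonglongrightarrow> complex_of_real (exp (- (t\<^sup>2 * \<theta>2 / 2)))"
proof (rule LIMSEQ_I)
  fix r :: real assume r: "0 < r"
  have "(\<lambda>m. \<bar>t\<bar> * sqrt (\<theta>2 - bridge_var m / real m)) \<longlonglongrightarrow> \<bar>t\<bar> * sqrt (\<theta>2 - \<theta>2)"
    by (intro tendsto_intros lim)
  then have "\<forall>\<^sub>F m in sequentially. \<bar>t\<bar> * sqrt (\<theta>2 - bridge_var m / real m) < r / 3"
    using r by (intro order_tendstoD(2)) auto
  moreover have "(\<lambda>m. exp (- (t\<^sup>2 * (bridge_var m / real m) / 2))) \<longlonglongrightarrow> exp (- (t\<^sup>2 * \<theta>2 / 2))"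
    by (intro tendsto_intros lim) simp
  then have "\<forall>\<^sub>F m in sequentially. dist (exp (- (t\<^sup>2 * (bridge_var m / real m) / 2))) (exp (- (t\<^sup>2 * \<theta>2 / 2))) < r / 3"
    using r by (intro tendstoD) auto
  ultimately have "\<forall>\<^sub>F m in sequentially. 1 \<le> m \<and> \<bar>t\<bar> * sqrt (\<theta>2 - bridge_var m / real m) < r / 3 \<and>
      dist (exp (- (t\<^sup>2 * (bridge_var m / real m) / 2))) (exp (- (t\<^sup>2 * \<theta>2 / 2))) < r / 3"
    using eventually_ge_at_top[of 1] by eventually_elim auto
  then obtain m where m: "1 \<le> m" "\<bar>t\<bar> * sqrt (\<theta>2 - bridge_var m / real m) < r / 3"
    and m3: "dist (exp (- (t\<^sup>2 * (bridge_var m / real m) / 2))) (exp (- (t\<^sup>2 * \<theta>2 / 2))) < r / 3"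
    by (auto simp: eventually_sequentially)
  let ?c = "\<lambda>x. complex_of_real (exp (- (t\<^sup>2 * x / 2)))"
  let ?S = "\<lambda>n z. \<Sum>k<n div m. bridge (int (k * m)) m z"
  let ?X = "\<lambda>n. \<integral>z. iexp (t / sqrt (real n) * bridge 0 n z) \<partial>M"
  let ?Z = "\<lambda>n. \<integral>z. iexp (t / sqrt (real n) * ?S n z) \<partial>M"
  have XZ: "cmod (?X n - ?Z n) \<le> \<bar>t\<bar> * sqrt (bridge_var n / real n - real (n div m) / real n * bridge_var m)" for n
  proof -
    have "cmod (?X n - ?Z n) \<le> \<bar>t / sqrt (real n)\<bar> * sqrt (bridge_var n - real (n div m) * bridge_var m)"
      using char_diff_le_L2[OF bridge_si[of 0 n] sum_bridge_si[of m "n div m"], of "t / sqrt (real n)"]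
        bridge_minus_sum[of "n div m" m n] by simp
    also have "\<dots> = \<bar>t\<bar> * sqrt ((bridge_var n - real (n div m) * bridge_var m) / real n)"
      by (simp add: real_sqrt_divide abs_divide)
    finally show ?thesis by (simp add: diff_divide_distrib)
  qed
  \<comment> \<open>For fixed \<open>m\<close> the normalised squared distance converges to
    \<open>\<theta>2 - bridge_var m / m\<close>, which was made small by the choice of
    \<open>m\<close>.\<close>
  have "(\<lambda>n. \<bar>t\<bar> * sqrt (bridge_var n / real n - real (n div m) / real n * bridge_var m)) \<longlonglongrightarrow> \<bar>t\<bar> * sqrt (\<theta>2 - 1 / real m * bridge_var m)"
    using m by (intro tendsto_intros lim real_div_over_tendsto) simp
  then have "\<forall>\<^sub>F n in sequentially. \<bar>t\<bar> * sqrt (bridge_var n / real n - real (n div m) / real n * bridge_var m) < r / 3"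
    using m(2) by (intro order_tendstoD(2)) auto
  moreover have "\<forall>\<^sub>F n in sequentially. dist (?Z n) (?c (bridge_var m / real m)) < r / 3"
    using r by (intro tendstoD[OF bridge_sum_char_limit[OF erg m(1)]]) simp
  ultimately have "\<forall>\<^sub>F n in sequentially. norm (?X n - ?c \<theta>2) < r"
  proof eventually_elim
    case (elim n)
    have "cmod (?c (bridge_var m / real m) - ?c \<theta>2) < r / 3"
      using m3 by (simp only: dist_norm of_real_diff[symmetric] norm_of_real real_norm_def)
    moreover have "cmod (?X n - ?c \<theta>2) \<le> cmod (?X n - ?Z n) + cmod (?Z n - ?c (bridge_var m / real m)) + cmod (?c (bridge_var m / real m) - ?c \<theta>2)"
      using norm_triangle_ineq[of "?X n - ?Z n" "?Z n - ?c (bridge_var m / real m)"]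
        norm_triangle_ineq[of "?X n - ?c (bridge_var m / real m)" "?c (bridge_var m / real m) - ?c \<theta>2"] by simp
    ultimately show ?case using elim XZ[of n] unfolding dist_norm by linarith
  qed
  then show "\<exists>N. \<forall>n\<ge>N. norm (?X n - ?c \<theta>2) < r" by (simp add: eventually_sequentially)
qed

end

theorem theorem2:
  fixes M :: "'a measure" and S :: "'s measure" and \<xi> :: "int \<Rightarrow> 'a \<Rightarrow> 's"
    and Q :: "'s \<Rightarrow> 's measure" and f :: "'s \<Rightarrow> real"
  assumes chain: "stationary_markov_chain M S \<xi> Q"
    and f: "f \<in> L2_0 (inv_dist M S \<xi>)"
    and sum0: "summable (\<lambda>n::nat. (L2_norm_P M (real_cond_exp M (gen_sigma M S \<xi> {0})
                   (\<lambda>\<omega>. \<Sum>i=1..Suc n. f (\<xi> (int i) \<omega>))))\<^sup>2 / (real (Suc n))\<^sup>2)"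
    and sumn: "summable (\<lambda>n::nat. (L2_norm_P M (real_cond_exp M (gen_sigma M S \<xi> {int (Suc n)})
                   (\<lambda>\<omega>. \<Sum>i=1..Suc n. f (\<xi> (int i) \<omega>))))\<^sup>2 / (real (Suc n))\<^sup>2)"
  shows "\<exists>\<sigma>2\<ge>0.
     (\<lambda>n::nat. (\<integral>\<omega>. (\<Sum>i=1..n. f (\<xi> (int i) \<omega>))\<^sup>2 \<partial>M) / real n) \<longlonglongrightarrow> \<sigma>2 \<and>
     (totally_ergodic (inv_dist M S \<xi>) Q \<longrightarrow>
        (\<exists>\<eta>2. (\<lambda>n::nat. (L2_norm_P M (real_cond_exp M (gen_sigma M S \<xi> {0, int n})
                     (\<lambda>\<omega>. \<Sum>i=1..n. f (\<xi> (int i) \<omega>))))\<^sup>2 / real n) \<longlonglongrightarrow> \<eta>2 \<and>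
           weak_conv_m
             (\<lambda>n::nat. distr M borel (\<lambda>\<omega>.
                ((\<Sum>i=1..n. f (\<xi> (int i) \<omega>)) -
                 real_cond_exp M (gen_sigma M S \<xi> {0, int n}) (\<lambda>\<omega>'. \<Sum>i=1..n. f (\<xi> (int i) \<omega>')) \<omega>)
                / sqrt (real n)))
             (normal_law (\<sigma>2 - \<eta>2))))"
proof -
  interpret additive_functional M S \<xi> Q f
    using chain f by unfold_locales
  have blk: "(\<lambda>z. \<Sum>i=1..n. f (\<xi> (int i) z)) = block 0 n" for n by (simp add: block_def[abs_def])
  have blk': "(\<Sum>i=1..n. f (\<xi> (int i) z)) = block 0 n z" for n z by (simp add: block_def)
  obtain s2 where s2: "0 \<le> s2" "(\<lambda>n. block_var n / real n) \<longlonglongrightarrow> s2"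
    using block_var_limit sum0 sumn unfolding blk fwd_norm_def bwd_norm_def by blast
  define e where "e n = (\<integral>z. (E {0, int n} (block 0 n) z)\<^sup>2 \<partial>M)" for n
  have norm2: "(L2_norm_P M X)\<^sup>2 = (\<integral>z. (X z)\<^sup>2 \<partial>M)" for X :: "'a \<Rightarrow> real" by (simp add: L2_norm_P_def)
  \<comment> \<open>Convergence of the block variances bounds the bridge variances per unit of time,
    without which their supremum could be infinite.\<close>
  have "Bseq (\<lambda>n. block_var n / real n)" using s2(2) by (intro convergent_imp_Bseq convergentI)
  then obtain K where "\<And>n. norm (block_var n / real n) \<le> K" by (meson BseqE)
  then have K: "block_var n / real n \<le> K" for n by (metis abs_le_D1 real_norm_def)
  have "bridge_var n / real n \<le> K" for n
  proof -
    have "bridge_var n \<le> block_var n" unfolding bridge_var_eq by simp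
    then show ?thesis using K[of n] divide_right_mono[of "bridge_var n" "block_var n" "real n"] by simp
  qed
  then obtain \<theta>2 where \<theta>: "(\<lambda>n. bridge_var n / real n) \<longlonglongrightarrow> \<theta>2" "\<And>n. 1 \<le> n \<Longrightarrow> bridge_var n / real n \<le> \<theta>2"
    using superadditive_limit[OF bridge_var_superadditive] by blast
  have \<theta>0: "0 \<le> \<theta>2" using \<theta>(1) by (rule LIMSEQ_le_const) (auto simp: bridge_var_nonneg)
  \<comment> \<open>By Pythagoras the projection carries what the bridge leaves of the block
    variance, so \<open>\<eta>2\<close> is \<open>s2 - \<theta>2\<close>, and the limit variance
    \<open>s2 - (s2 - \<theta>2)\<close> collapses to \<theta>2.\<close>
  have eta: "(\<lambda>n. e n / real n) \<longlonglongrightarrow> s2 - \<theta>2"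
    using tendsto_diff[OF s2(2) \<theta>(1)] unfolding bridge_var_eq e_def diff_divide_distrib[symmetric] by simp
  have clt: "weak_conv_m (\<lambda>n. distr M borel (\<lambda>z. bridge 0 n z / sqrt (real n))) (normal_law \<theta>2)"
    if erg: "totally_ergodic \<pi> Q"
  proof (rule levy_continuity)
    note [measurable] = sq_integrable_measurable[OF bridge_si]
    show "real_distribution (distr M borel (\<lambda>z. bridge 0 n z / sqrt (real n)))" for n
      by (rule real_distribution_distr) measurable
    show "real_distribution (normal_law \<theta>2)" by (rule char_normal_law(1)[OF \<theta>0])
    fix t
    have "char (distr M borel (\<lambda>z. bridge 0 n z / sqrt (real n))) t = (\<integral>z. iexp (t / sqrt (real n) * bridge 0 n z) \<partial>M)" for n
      unfolding char_def by (subst integral_distr) auto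
    then show "(\<lambda>n. char (distr M borel (\<lambda>z. bridge 0 n z / sqrt (real n))) t) \<longlonglongrightarrow> char (normal_law \<theta>2) t"
      using bridge_char_limit[OF erg \<theta>] by (simp add: char_normal_law(2)[OF \<theta>0])
  qed
  have "(\<lambda>n::nat. (\<integral>z. (\<Sum>i=1..n. f (\<xi> (int i) z))\<^sup>2 \<partial>M) / real n) \<longlonglongrightarrow> s2"
    using s2(2) by (simp only: blk' block_var_def)
  moreover have "(\<lambda>n::nat. (L2_norm_P M (E {0, int n} (\<lambda>z. \<Sum>i=1..n. f (\<xi> (int i) z))))\<^sup>2 / real n) \<longlonglongrightarrow> s2 - \<theta>2"
    using eta by (simp only: blk norm2 e_def)
  moreover have "weak_conv_m (\<lambda>n::nat. distr M borel (\<lambda>z. ((\<Sum>i=1..n. f (\<xi> (int i) z)) -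
      E {0, int n} (\<lambda>z'. \<Sum>i=1..n. f (\<xi> (int i) z')) z) / sqrt (real n))) (normal_law (s2 - (s2 - \<theta>2)))"
    if "totally_ergodic \<pi> Q"
    using clt[OF that] unfolding blk blk' by (simp add: bridge_def)
  ultimately show ?thesis using s2(1) by blast
qed

end
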